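(* Let $G$ be an $H$-type group with $2n=\dim\mathfrak v$, $m=\dim\mathfrak z$. Let $f\in L^1(G)$ and let $Z\subset\mathfrak z^*\setminus\{0\}$ be a zero set of $If$. Then $f\in L^1_\Omega(G)$ with $\Omega=\{\mu\in\mathfrak z^*\setminus\{0\}:|\mu|\le c\}$ in the following cases. 1. $m=1$ and $Z=\{\lambda\in\mathfrak z^*:|\lambda|\in[1,1+\varepsilon]\}$ for some $\varepsilon>0$, with $c=2k_0$, where $k_0$ is the least odd integer $\ge2/(2\varepsilon+\varepsilon^2)$. 2. $m>1$ and $Z\subset S(\mathfrak z^* )$ is compact, connected, and not contained in any affine hyperplane of $\mathfrak z^*$, with $c=4/\delta$, where $\delta$ is the minimal width of $Z$. In particular, for the spherical cap $Z=C_h(\lambda_0)$, $\lambda_0\in S(\mathfrak z^* )$, $0<h\le1$, one may take $c=4/h$. If moreover $I_{\nu,\lambda}f=0$ for all $\nu\in S(\mathfrak v^* )$ and all $\lambda\in Z$, one may take $c=2/\delta$ in part 2, with $c=2/h$ for the cap, and, when $n>1$, $c=2k_1$ in part 1, where $k_1$ is the least integer $\ge1/(2\varepsilon+\varepsilon^2)$.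
   Context: $H$-type group: $\mathfrak g$ is a finite-dimensional real Lie algebra with $[\mathfrak g,[\mathfrak g,\mathfrak g]]=0$ and an inner product; $\mathfrak z\ne0$ is its center, $\mathfrak v\neq 0$ the orthogonal complement of $\mathfrak z$, $2n=\dim\mathfrak v$, $m=\dim\mathfrak z$. For $\mu\in\mathfrak z^*$ let $J_\mu:\mathfrak v\to\mathfrak v$ be the skew-adjoint map with $\langle J_\mu V,W\rangle=\mu([V,W])$; one requires $J_\mu^2=-|\mu|^2\mathrm{Id}$ for all $\mu$. $G$ is $\mathfrak v\times\mathfrak z$ with product $(x,u)(x',u')=(x+x',u+u'+\tfrac12[x,x'])$ and Haar measure $dx\,du$. The inner product identifies $\mathfrak v^*\cong\mathfrak v$, $\mathfrak z^*\cong\mathfrak z$; $S(\mathfrak v^* ),S(\mathfrak z^* )$ are the unit spheres; $\hat\lambda=\lambda/|\lambda|$. For $\nu\in S(\mathfrak v^* )$, $\lambda\in\mathfrak z^*\setminus\{0\}$: $\gamma_{\nu,\lambda}(s)=\big(e^{sJ_\lambda}J_\lambda^{-1}\nu,\tfrac{s}{2|\lambda|}\hat\lambda\big)$, $\Gamma_\lambda=\{(0,j\pi|\lambda|^{-2}\hat\lambda):j\in\mathbb Z\}$, $G_\lambda=G/\Gamma_\lambda$, and $I_{\nu,\lambda}f(x,u)=\int_{\mathbb R}f((x,u)\gamma_{\nu,\lambda}(s))ds\in L^1(G_\lambda)$. A set $Z\subset\mathfrak z^*\setminus\{0\}$ is a zero set of $If$ if for every $\lambda\in Z$ there exists $\nu\in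 S(\mathfrak v^* )$ with $I_{\nu,\lambda}f=0$. Central Fourier transform: $f^\mu(x)=\int_{\mathfrak z}f(x,u)e^{-i\mu\cdot u}du$, $\mu\in\mathfrak z^*$. For $\Omega\subset\mathfrak z^*\setminus\{0\}$, $L^1_\Omega(G)=\{f\in L^1(G):f^\mu=0\text{ for all }\mu\in\Omega^c\}$, where $\Omega^c$ is the complement in $\mathfrak z^*\setminus\{0\}$. Minimal width: $\delta=\min_{\hat\mu\in S(\mathfrak z^* )}\big(\max_{\lambda\in Z}\hat\mu\cdot\lambda-\min_{\lambda\in Z}\hat\mu\cdot\lambda\big)$. Cap: $C_h(\lambda_0)=\{\lambda\in S(\mathfrak z^* ):\lambda\cdot\lambda_0\ge1-h\}$. *)

theory Defs
  imports "HOL-Analysis.Analysis"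
begin

section \<open>H-type Lie algebras\<close>

text \<open>
  The inner product Lie algebra is carried by the product of two Euclidean spaces, so that the
  orthogonal decomposition into \<open>\<v> = 'v \<times> {0}\<close> and the center \<open>\<z> = {0} \<times> 'z\<close> is built into the
  type (the inner product of a product type is the orthogonal sum, and Euclidean spaces are
  nonzero). The duals of \<open>\<v>\<close> and \<open>\<z>\<close> are identified with 'v and 'z by the inner product.
\<close>

definition lie_bracket :: "('g::real_vector \<Rightarrow> 'g \<Rightarrow> 'g) \<Rightarrow> bool" where
  "lie_bracket br \<longleftrightarrow> bilinear br \<and> (\<forall>X. br X X = 0) \<and>
     (\<forall>X Y W. br X (br Y W) + br Y (br W X) + br W (br X Y) = 0)"

definition lie_center :: "('g::real_vector \<Rightarrow> 'g \<Rightarrow> 'g) \<Rightarrow> 'g set" where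
  "lie_center br = {X. \<forall>Y. br X Y = 0}"

definition vbr :: "('v::euclidean_space \<times> 'z::euclidean_space \<Rightarrow> 'v \<times> 'z \<Rightarrow> 'v \<times> 'z) \<Rightarrow> 'v \<Rightarrow> 'v \<Rightarrow> 'z"
  where "vbr br V W = snd (br (V, 0) (W, 0))"

definition Jmap :: "('v::euclidean_space \<times> 'z::euclidean_space \<Rightarrow> 'v \<times> 'z \<Rightarrow> 'v \<times> 'z) \<Rightarrow> 'z \<Rightarrow> 'v \<Rightarrow> 'v"
  where "Jmap br \<mu> = (THE J. \<forall>V W. J V \<bullet> W = \<mu> \<bullet> vbr br V W)"

definition h_type :: "('v::euclidean_space \<times> 'z::euclidean_space \<Rightarrow> 'v \<times> 'z \<Rightarrow> 'v \<times> 'z) \<Rightarrow> bool" where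
  "h_type br \<longleftrightarrow> lie_bracket br \<and> (\<forall>X Y W. br X (br Y W) = 0) \<and>
     lie_center br = {0} \<times> UNIV \<and>
     (\<forall>\<mu> V. Jmap br \<mu> (Jmap br \<mu> V) = - ((norm \<mu>)\<^sup>2 *\<^sub>R V))"

lemma Jmap_inner:
  assumes "h_type br"
  shows "Jmap br \<mu> V \<bullet> W = \<mu> \<bullet> vbr br V W"
proof -
  have bil: "bilinear br" using assms by (simp add: h_type_def lie_bracket_def)
  have lin: "linear (\<lambda>W. \<mu> \<bullet> vbr br V W)" for V
  proof (rule linearI)
    fix a b :: 'a and r :: real
    have "(a + b, 0::'b) = (a, 0) + (b, 0)" by simp
    then show "\<mu> \<bullet> vbr br V (a + b) = \<mu> \<bullet> vbr br V a + \<mu> \<bullet> vbr br V b"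
      unfolding vbr_def by (simp only: bilinear_radd[OF bil] snd_add inner_add_right)
    have "(r *\<^sub>R a, 0::'b) = r *\<^sub>R (a, 0)" by simp
    then show "\<mu> \<bullet> vbr br V (r *\<^sub>R a) = r *\<^sub>R (\<mu> \<bullet> vbr br V a)"
      unfolding vbr_def by (simp only: bilinear_rmul[OF bil] snd_scaleR inner_scaleR_right real_scaleR_def)
  qed
  define J where "J V = adjoint (\<lambda>W. \<mu> \<bullet> vbr br V W) 1" for V
  have J: "\<forall>V W. J V \<bullet> W = \<mu> \<bullet> vbr br V W"
    unfolding J_def using adjoint_works[OF lin] by (simp add: inner_commute)
  have "K = J" if "\<forall>V W. K V \<bullet> W = \<mu> \<bullet> vbr br V W" for K
    using that J by (metis ext vector_eq_rdot)
  then have "\<forall>V W. Jmap br \<mu> V \<bullet> W = \<mu> \<bullet> vbr br V W"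
    unfolding Jmap_def using theI[of "\<lambda>J. \<forall>V W. J V \<bullet> W = \<mu> \<bullet> vbr br V W" J] J by blast
  then show ?thesis by blast
qed

section \<open>The group and the curves\<close>

definition gmult :: "('v::euclidean_space \<times> 'z::euclidean_space \<Rightarrow> 'v \<times> 'z \<Rightarrow> 'v \<times> 'z) \<Rightarrow>
    'v \<times> 'z \<Rightarrow> 'v \<times> 'z \<Rightarrow> 'v \<times> 'z" where
  "gmult br g h = (fst g + fst h, snd g + snd h + (1/2) *\<^sub>R vbr br (fst g) (fst h))"

definition lin_exp :: "('v::euclidean_space \<Rightarrow> 'v) \<Rightarrow> 'v \<Rightarrow> 'v" where
  "lin_exp A x = (\<Sum>k. (A ^^ k) x /\<^sub>R fact k)"

text \<open>
  \<open>l\<close> stands for the frequency \<open>\<lambda>\<close>, and \<^const>\<open>sgn\<close> is the normalization \<open>\<lambda> / |\<lambda>|\<close>.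
\<close>

definition gam :: "('v::euclidean_space \<times> 'z::euclidean_space \<Rightarrow> 'v \<times> 'z \<Rightarrow> 'v \<times> 'z) \<Rightarrow>
    'v \<Rightarrow> 'z \<Rightarrow> real \<Rightarrow> 'v \<times> 'z" where
  "gam br \<nu> l s =
     (lin_exp (\<lambda>x. s *\<^sub>R Jmap br l x) (inv (Jmap br l) \<nu>), (s / (2 * norm l)) *\<^sub>R sgn l)"

section \<open>The quotient by the central lattice\<close>

definition Gam_lattice :: "'z::euclidean_space \<Rightarrow> ('v::euclidean_space \<times> 'z) set" where
  "Gam_lattice l = {(0, (of_int j * pi / (norm l)\<^sup>2) *\<^sub>R sgn l) | j::int. True}"

definition Gam_coset :: "('v::euclidean_space \<times> 'z::euclidean_space \<Rightarrow> 'v \<times> 'z \<Rightarrow> 'v \<times> 'z) \<Rightarrow>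
    'z \<Rightarrow> 'v \<times> 'z \<Rightarrow> ('v \<times> 'z) set" where
  "Gam_coset br l g = gmult br g ` Gam_lattice l"

text \<open>
  The group \<open>G\<^sub>\<lambda>\<close> with its Haar measure: its points are the cosets of the lattice, a set of cosets is
  measurable iff its preimage is Borel, and its measure is that of its preimage intersected with a
  fundamental domain of the lattice.
\<close>

definition Gam_domain :: "'z::euclidean_space \<Rightarrow> ('v::euclidean_space \<times> 'z) set" where
  "Gam_domain l = {(x, u). 0 \<le> u \<bullet> sgn l \<and> u \<bullet> sgn l < pi / (norm l)\<^sup>2}"

definition G_quot :: "('v::euclidean_space \<times> 'z::euclidean_space \<Rightarrow> 'v \<times> 'z \<Rightarrow> 'v \<times> 'z) \<Rightarrow>
    'z \<Rightarrow> ('v \<times> 'z) set measure" where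
  "G_quot br l =
     distr (restrict_space lborel (Gam_domain l))
       (sigma (range (Gam_coset br l))
          {A. A \<subseteq> range (Gam_coset br l) \<and> Gam_coset br l -` A \<in> sets borel})
       (Gam_coset br l)"

definition Iint :: "('v::euclidean_space \<times> 'z::euclidean_space \<Rightarrow> 'v \<times> 'z \<Rightarrow> 'v \<times> 'z) \<Rightarrow>
    'v \<Rightarrow> 'z \<Rightarrow> ('v \<times> 'z \<Rightarrow> complex) \<Rightarrow> 'v \<times> 'z \<Rightarrow> complex" where
  "Iint br \<nu> l f g = (LINT s|lborel. f (gmult br g (gam br \<nu> l s)))"

text \<open>
  \<open>I\<^sub>\<nu>\<^sub>,\<^sub>\<lambda> f = 0\<close> as an element of \<open>L\<^sup>1(G\<^sub>\<lambda>)\<close>. The function \<^const>\<open>Iint\<close> is constant on the cosets of the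
  lattice, as \<open>\<gamma>(s + 2\<pi>/|\<lambda>|) = \<gamma>(s) \<cdot> (0, \<pi>|\<lambda>|\<^sup>-\<^sup>2 \<lambda>/|\<lambda>|)\<close>, and so is a function on \<open>G\<^sub>\<lambda>\<close>.
\<close>

definition I_zero :: "('v::euclidean_space \<times> 'z::euclidean_space \<Rightarrow> 'v \<times> 'z \<Rightarrow> 'v \<times> 'z) \<Rightarrow>
    'v \<Rightarrow> 'z \<Rightarrow> ('v \<times> 'z \<Rightarrow> complex) \<Rightarrow> bool" where
  "I_zero br \<nu> l f \<longleftrightarrow> (AE c in G_quot br l. \<forall>g\<in>c. Iint br \<nu> l f g = 0)"

definition zero_set :: "('v::euclidean_space \<times> 'z::euclidean_space \<Rightarrow> 'v \<times> 'z \<Rightarrow> 'v \<times> 'z) \<Rightarrow>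
    ('v \<times> 'z \<Rightarrow> complex) \<Rightarrow> 'z set \<Rightarrow> bool" where
  "zero_set br f Z \<longleftrightarrow> Z \<subseteq> - {0} \<and> (\<forall>l\<in>Z. \<exists>\<nu>\<in>sphere 0 1. I_zero br \<nu> l f)"

section \<open>Central Fourier transform\<close>

definition central_ft :: "('v::euclidean_space \<times> 'z::euclidean_space \<Rightarrow> complex) \<Rightarrow> 'z \<Rightarrow> 'v \<Rightarrow> complex"
  where "central_ft f \<mu> x = (LINT u|lborel. f (x, u) * exp (- \<i> * of_real (\<mu> \<bullet> u)))"

text \<open>\<open>f\<^sup>\<mu>\<close> is an element of \<open>L\<^sup>1(\<v>)\<close>, so that it vanishes means that it vanishes almost everywhere.\<close>

definition L1_spec :: "'z::euclidean_space set \<Rightarrow> ('v::euclidean_space \<times> 'z \<Rightarrow> complex) set" where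
  "L1_spec \<Omega> = {f. integrable lborel f \<and> (\<forall>\<mu>\<in>- {0} - \<Omega>. AE x in lborel. central_ft f \<mu> x = 0)}"

definition freq_ball :: "real \<Rightarrow> 'z::euclidean_space set" where
  "freq_ball c = {\<mu>. \<mu> \<noteq> 0 \<and> norm \<mu> \<le> c}"

section \<open>Width and caps\<close>

text \<open>All the extrema are attained for nonempty compact \<open>Z\<close>, the only case in which this is used.\<close>

definition min_width :: "'z::euclidean_space set \<Rightarrow> real" where
  "min_width Z = (INF \<mu>\<in>sphere 0 1. (SUP l\<in>Z. \<mu> \<bullet> l) - (INF l\<in>Z. \<mu> \<bullet> l))"

definition sph_cap :: "real \<Rightarrow> 'z::euclidean_space \<Rightarrow> 'z set" where
  "sph_cap h l0 = {l \<in> sphere 0 1. l \<bullet> l0 \<ge> 1 - h}"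

definition in_affine_hyperplane :: "'z::euclidean_space set \<Rightarrow> bool" where
  "in_affine_hyperplane Z \<longleftrightarrow> (\<exists>a b. a \<noteq> 0 \<and> Z \<subseteq> {x. a \<bullet> x = b})"

end

theory Submission
  imports Defs "HOL-Probability.Probability" "HOL-Complex_Analysis.Complex_Analysis"
begin

text \<open>
  Testing \<open>I\<^sub>\<nu>\<^sub>,\<^sub>\<lambda> f = 0\<close> on a fundamental domain against \<open>\<psi>(x) exp(- i \<mu> \<cdot> u)\<close> with \<open>\<mu> \<cdot> \<lambda>/|\<lambda>| = 2 k |\<lambda>|\<^sup>2\<close>, \<open>k\<close> an
  integer, shows that the twisted convolution of \<open>g = f\<^sup>\<mu>\<close> with the measure \<open>exp(i k t) dt\<close> on a circle in the
  plane of \<open>\<nu>, J\<^sub>\<lambda> \<nu>\<close> vanishes. This forces \<open>g = 0\<close> in three cases.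

  If \<open>k\<close> is odd (one may take \<open>k > 0\<close>, by conjugating \<open>f\<close>), test with monomials in the coordinate of the
  plane times the Gaussian \<open>exp(- k |p|\<^sup>2 / 2)\<close>: the circle integrals are multiples of \<open>L\<^sub>j\<^sup>(\<^sup>k\<^sup>)(k)\<close>, nonzero as
  \<open>j! L\<^sub>j\<^sup>(\<^sup>k\<^sup>)(k)\<close> is an odd integer, so by induction all moments of \<open>g\<close> times a Gaussian vanish.

  If \<open>k = 0\<close> and \<open>\<mu> \<noteq> 0\<close>, the plane is isotropic for \<open>\<mu>\<close> and the Fourier transform of \<open>g\<close> times a Bessel
  function \<open>J\<^sub>0\<close> vanishes; the zeros of that factor form a null set.

  If the equations hold for every \<open>\<nu>\<close> and \<open>n > 1\<close>, superposing them turns the circle into a Gaussian on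
  the plane. Averaging over \<open>\<nu>\<close> with a Gaussian weight and testing with Gaussians gives a triangular
  system with positive diagonal for the moments of \<open>g\<close>, which vanish again.

  It remains to find \<open>\<lambda> \<in> Z\<close> for which \<open>k\<close> is an odd, respectively an arbitrary, integer. On the shell
  one rescales \<open>\<mu>\<close>; on the sphere \<open>\<mu> \<cdot> \<lambda> / 2\<close> takes on \<open>Z\<close> all values of an interval of length
  \<open>\<ge> |\<mu>| \<delta> / 2\<close>.
\<close>

section \<open>Lebesgue measure and periodic functions\<close>

text \<open>The condition on \<mu> and \<lambda> says that exp(- i \<mu> . u) is trivial on the
  central lattice, hence a legitimate test function on the quotient.

  Parity is the obstacle: for one direction the factors met may vanish when k is even, as L_2^(2)(2)
  = 0 shows. So with one direction the usable values 2 k lie 4 apart, with all directions 2 apart;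
  this is the origin of the factor 2 between 4/\<delta> and 2/\<delta>. On the sphere the interval
  of values of \<mu> . \<lambda> must reach that gap. On the shell the integer k serves 2 k \<le>
  |\<mu>| \<le> 2 k (1 + \<epsilon>)^2, and consecutive such ranges overlap once k (2 \<epsilon> +
  \<epsilon>^2) is at least the step of k, which is 2 or 1.

  With all directions the kernel on the plane can be lowered to Laguerre degree 0, where parity is
  irrelevant. The price is an average over \<nu> whose weight on the plane, (1 + q |z|^2)^(-n), is
  integrable only for n > 1. A center of dimension above 1 enforces this by itself, so the condition
  n > 1 shows up for m = 1 only.\<close>

lemma nn_integral_lborel_shift:
  fixes f :: "'a::euclidean_space \<Rightarrow> ennreal"
  assumes [measurable]: "f \<in> borel_measurable borel"
  shows "(\<integral>\<^sup>+x. f (x + c) \<partial>lborel) = (\<integral>\<^sup>+x. f x \<partial>lborel)"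
  by (subst (2) lborel_distr_plus[of c, symmetric]) (simp add: nn_integral_distr add.commute)

lemma integral_lborel_shift:
  fixes f :: "'a::euclidean_space \<Rightarrow> 'b::{banach, second_countable_topology}"
  assumes [measurable]: "f \<in> borel_measurable borel"
  shows "(LINT x|lborel. f (x + c)) = (LINT x|lborel. f x)"
  by (subst (2) lborel_distr_plus[of c, symmetric]) (simp add: integral_distr add.commute)

lemma integrable_lborel_shift:
  fixes f :: "'a::euclidean_space \<Rightarrow> 'b::{banach, second_countable_topology}"
  assumes "integrable lborel f"
  shows "integrable lborel (\<lambda>x. f (x + c))"
proof -
  have "integrable (distr lborel borel ((+) c)) f" using assms by (simp add: lborel_distr_plus)
  then show ?thesis
    by (subst (asm) integrable_distr_eq) (use assms in \<open>auto simp: add.commute\<close>)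
qed

lemma integral_lborel_scaleR:
  fixes f :: "'a::euclidean_space \<Rightarrow> 'b::{banach, second_countable_topology}"
  assumes [measurable]: "f \<in> borel_measurable borel" and "c \<noteq> 0"
  shows "(LINT x|lborel. f x) = \<bar>c\<bar>^DIM('a) *\<^sub>R (LINT x|lborel. f (c *\<^sub>R x))"
  by (subst lborel_affine[OF assms(2), of 0]) (simp add: integral_density integral_distr)

text \<open>The indicator of the set of \<open>t\<close> is \<open>F t - F (t + 2\<pi>)\<close> for a cut-off \<open>F\<close> of \<open>P\<close>, so that the
  integral telescopes to one period.\<close>
lemma periodic_cross_section_integral:
  fixes P :: "real \<Rightarrow> 'b::{banach, second_countable_topology}" and \<rho> :: "real \<Rightarrow> real"
  assumes [measurable]: "P \<in> borel_measurable borel" "\<rho> \<in> borel_measurable borel"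
    and bP: "\<And>t. norm (P t) \<le> C" and b\<rho>: "\<And>t. \<bar>\<rho> t\<bar> \<le> B"
    and pP: "\<And>t. P (t + 2 * pi) = P t" and p\<rho>: "\<And>t. \<rho> (t + 2 * pi) = \<rho> t"
  shows "integrable lborel (\<lambda>t. indicator {t. 0 \<le> \<rho> t - t \<and> \<rho> t - t < 2 * pi} t *\<^sub>R P t)"
    and "(LINT t|lborel. indicator {t. 0 \<le> \<rho> t - t \<and> \<rho> t - t < 2 * pi} t *\<^sub>R P t)
       = (LINT t|lborel. indicator {0..<2 * pi} t *\<^sub>R P t)"
proof -
  have ib: "integrable lborel (\<lambda>t. indicator S t *\<^sub>R P t)"
    if "S \<in> sets borel" "S \<subseteq> {-a..a}" for S a
  proof (rule Bochner_Integration.integrable_bound)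
    show "integrable lborel (\<lambda>t. indicator {-a..a} t *\<^sub>R C)"
      by (intro integrable_scaleR_left integrable_real_indicator) (auto simp: emeasure_lborel_Icc_eq)
    have "0 \<le> C" using bP[of 0] norm_ge_zero order_trans by blast
    then show "AE x in lborel. norm (indicator S x *\<^sub>R P x) \<le> norm (indicator {- a..a} x *\<^sub>R C)"
      using that(2) bP by (intro AE_I2) (auto simp: indicator_def)
  qed (use that in measurable)
  let ?S = "{t. 0 \<le> \<rho> t - t \<and> \<rho> t - t < 2 * pi}"
  have "?S \<subseteq> {- (B + 2 * pi)..B + 2 * pi}"
  proof
    fix t assume "t \<in> ?S"
    moreover have "\<bar>\<rho> t\<bar> \<le> B" by (rule b\<rho>)
    ultimately show "t \<in> {- (B + 2 * pi)..B + 2 * pi}" by (auto simp: abs_le_iff)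
  qed
  then show int: "integrable lborel (\<lambda>t. indicator ?S t *\<^sub>R P t)" by (intro ib[of _ "B + 2 * pi"]) auto
  obtain M :: nat where "B / (2 * pi) < real M" using reals_Archimedean2 by blast
  then have M: "B < 2 * pi * real M" by (simp add: field_simps)
  have pPM: "P (t + 2 * pi * real m) = P t" for t m
  proof (induction m)
    case (Suc m)
    have "P (t + 2 * pi * real (Suc m)) = P ((t + 2 * pi * real m) + 2 * pi)" by (simp add: algebra_simps)
    then show ?case using Suc pP by simp
  qed simp
  \<comment> \<open>A is a multiple of 2 pi above the bound of \<rho>. Hence every t < - A satisfies
    0 \<le> \<rho> t - t, so that the boundary term of the telescoping is a whole period, and this
    period is a translate of [0, 2 pi) by a multiple of 2 pi.\<close>
  define A where "A = 2 * pi * real M"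
  define F where "F t = indicator {t. - A \<le> t \<and> 0 \<le> \<rho> t - t} t *\<^sub>R P t" for t
  have [measurable]: "F \<in> borel_measurable borel" unfolding F_def by measurable
  have iF: "integrable lborel F" unfolding F_def
  proof (rule ib)
    show "{t. - A \<le> t \<and> 0 \<le> \<rho> t - t} \<subseteq> {- (\<bar>A\<bar> + \<bar>B\<bar>)..\<bar>A\<bar> + \<bar>B\<bar>}"
    proof safe
      fix t assume "- A \<le> t" "0 \<le> \<rho> t - t"
      with b\<rho>[of t] show "t \<in> {- (\<bar>A\<bar> + \<bar>B\<bar>)..\<bar>A\<bar> + \<bar>B\<bar>}" by auto
    qed
  qed measurable
  let ?T = "{- A - 2 * pi..< - A}"
  have eq: "F t - F (t + 2 * pi) = indicator ?S t *\<^sub>R P t - indicator ?T t *\<^sub>R P t" for t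
    using b\<rho>[of t] M
    by (auto simp: F_def indicator_def pP p\<rho> A_def; use pi_gt_zero in linarith)
  have iT: "integrable lborel (\<lambda>t. indicator ?T t *\<^sub>R P t)"
    by (rule ib[of _ "\<bar>A\<bar> + 2 * pi"]) auto
  have "0 = (LINT t|lborel. F t - F (t + 2 * pi))"
    by (simp add: iF integrable_lborel_shift integral_lborel_shift)
  also have "\<dots> = (LINT t|lborel. indicator ?S t *\<^sub>R P t) - (LINT t|lborel. indicator ?T t *\<^sub>R P t)"
    unfolding eq using int iT by simp
  finally have "(LINT t|lborel. indicator ?S t *\<^sub>R P t) = (LINT t|lborel. indicator ?T t *\<^sub>R P t)" by simp
  also have "\<dots> = (LINT t|lborel. indicator ?T (t + 2 * pi * - real (Suc M)) *\<^sub>R P (t + 2 * pi * - real (Suc M)))"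
    by (rule integral_lborel_shift[symmetric]) simp
  also have "\<dots> = (LINT t|lborel. indicator {0..<2 * pi} t *\<^sub>R P t)"
  proof (rule Bochner_Integration.integral_cong[OF refl])
    fix t
    have "P (t + 2 * pi * - real (Suc M)) = P t"
      using pPM[of "t + 2 * pi * - real (Suc M)" "Suc M"] by (simp add: algebra_simps)
    moreover have "indicator ?T (t + 2 * pi * - real (Suc M)) = (indicator {0..<2 * pi} t :: real)"
      by (auto simp: indicator_def A_def algebra_simps)
    ultimately show "indicator ?T (t + 2 * pi * - real (Suc M)) *\<^sub>R P (t + 2 * pi * - real (Suc M)) =
      indicator {0..<2 * pi} t *\<^sub>R P t" by simp
  qed
  finally show "(LINT t|lborel. indicator ?S t *\<^sub>R P t) = (LINT t|lborel. indicator {0..<2 * pi} t *\<^sub>R P t)" .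
qed

section \<open>The maps \<open>J\<^sub>\<mu>\<close> and the curves\<close>

lemma vbr_bounded_bilinear:
  assumes "h_type br"
  shows "bounded_bilinear (vbr br)"
proof -
  have bil: "bilinear br" using assms by (simp add: h_type_def lie_bracket_def)
  have l1: "(a + b, 0::'b) = (a, 0) + (b, 0)" "(r *\<^sub>R a, 0::'b) = r *\<^sub>R (a, 0)" for a b :: 'a and r :: real
    by auto
  have "bilinear (vbr br)"
    unfolding bilinear_def vbr_def
    by (intro conjI allI linearI; simp only: l1 bilinear_ladd[OF bil] bilinear_radd[OF bil]
        bilinear_lmul[OF bil] bilinear_rmul[OF bil] snd_add snd_scaleR)
  then show ?thesis by (simp add: bilinear_conv_bounded_bilinear)
qed

lemma vbr_self:
  assumes "h_type br"
  shows "vbr br x x = 0"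
  using assms by (simp add: h_type_def lie_bracket_def vbr_def)

lemma vbr_antisym:
  assumes "h_type br"
  shows "vbr br x y = - vbr br y x"
proof -
  interpret bounded_bilinear "vbr br" by (rule vbr_bounded_bilinear[OF assms])
  have "0 = vbr br (x + y) (x + y)" by (simp add: vbr_self[OF assms])
  also have "\<dots> = vbr br x y + vbr br y x"
    by (simp only: add_left add_right) (simp add: vbr_self[OF assms] add.commute)
  finally show ?thesis by (metis eq_neg_iff_add_eq_0)
qed

lemma linear_Jmap:
  assumes "h_type br"
  shows "linear (Jmap br \<mu>)"
proof -
  interpret bounded_bilinear "vbr br" by (rule vbr_bounded_bilinear[OF assms])
  show ?thesis
    by (intro linearI; subst vector_eq_rdot[symmetric])
       (auto simp: Jmap_inner[OF assms] inner_add_left add_left scaleR_left inner_add_right)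
qed

lemma Jmap_add_left:
  assumes "h_type br"
  shows "Jmap br (\<mu> + \<mu>') x = Jmap br \<mu> x + Jmap br \<mu>' x"
  by (subst vector_eq_rdot[symmetric]) (auto simp: Jmap_inner[OF assms] inner_add_left)

lemma Jmap_skew:
  assumes "h_type br"
  shows "Jmap br \<mu> x \<bullet> y = - (x \<bullet> Jmap br \<mu> y)"
  by (subst inner_commute[of x]) (simp add: Jmap_inner[OF assms] vbr_antisym[OF assms, of y x])

lemma Jmap_Jmap:
  assumes "h_type br"
  shows "Jmap br \<mu> (Jmap br \<mu> x) = - ((norm \<mu>)\<^sup>2 *\<^sub>R x)"
  using assms by (simp add: h_type_def)

lemma Jmap_inner_same:
  assumes "h_type br"
  shows "Jmap br \<mu> x \<bullet> Jmap br \<mu> y = (norm \<mu>)\<^sup>2 * (x \<bullet> y)"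
  by (simp add: Jmap_skew[OF assms] Jmap_Jmap[OF assms])

lemma Jmap_inner_self [simp]:
  assumes "h_type br"
  shows "Jmap br \<mu> x \<bullet> x = 0"
  by (simp add: Jmap_inner[OF assms] vbr_self[OF assms])

text \<open>Polarization in \<mu> of the H-type identity. The relation decides how the plane of
  \<nu> and J_l \<nu> sits with respect to the twist by \<mu>: isotropic when
  \<open>\<mu> \<bullet> l = 0\<close>, symplectic otherwise.\<close>

lemma Jmap_inner_Jmap:
  assumes "h_type br"
  shows "Jmap br \<mu> x \<bullet> Jmap br l x = (\<mu> \<bullet> l) * (x \<bullet> x)"
proof -
  have "(norm (\<mu> + l))\<^sup>2 * (x \<bullet> x) = (Jmap br \<mu> x + Jmap br l x) \<bullet> (Jmap br \<mu> x + Jmap br l x)"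
    by (simp add: Jmap_inner_same[OF assms, symmetric] Jmap_add_left[OF assms])
  also have "\<dots> = (norm \<mu>)\<^sup>2 * (x \<bullet> x) + (norm l)\<^sup>2 * (x \<bullet> x) + 2 * (Jmap br \<mu> x \<bullet> Jmap br l x)"
    by (simp add: inner_add_left inner_add_right Jmap_inner_same[OF assms] inner_commute)
  finally show ?thesis
    by (simp add: power2_norm_eq_inner inner_add_left inner_add_right inner_commute algebra_simps)
qed

text \<open>For \<open>z = cis t\<close>, this is the first component of the curve, at \<open>s = t / |\<lambda>|\<close>.\<close>
definition jplane :: "('v::euclidean_space \<times> 'z::euclidean_space \<Rightarrow> 'v \<times> 'z \<Rightarrow> 'v \<times> 'z) \<Rightarrow>
    'z \<Rightarrow> 'v \<Rightarrow> complex \<Rightarrow> 'v" where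
  "jplane br l y z = (1 / norm l) *\<^sub>R (Im z *\<^sub>R y - (Re z / norm l) *\<^sub>R Jmap br l y)"

text \<open>J_l / |l| squares to minus the identity, so the even and the odd terms of the series add
  up to a cosine and a sine of \<open>s * norm l\<close>.\<close>

lemma lin_exp_Jmap:
  assumes h: "h_type br" and l: "l \<noteq> 0"
  shows "lin_exp (\<lambda>x. s *\<^sub>R Jmap br l x) x =
    cos (s * norm l) *\<^sub>R x + (sin (s * norm l) / norm l) *\<^sub>R Jmap br l x"
proof -
  let ?A = "\<lambda>x. s *\<^sub>R Jmap br l x" and ?t = "s * norm l"
  interpret J: linear "Jmap br l" by (rule linear_Jmap[OF h])
  have pow: "(?A ^^ k) x /\<^sub>R fact k =
      (cos_coeff k * ?t ^ k) *\<^sub>R x + (sin_coeff k * ?t ^ k / norm l) *\<^sub>R Jmap br l x" for k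
  proof -
    have even: "(?A ^^ (2 * j)) x = ((-1) ^ j * ?t ^ (2 * j)) *\<^sub>R x" for j
    proof (induction j)
      case (Suc j)
      have "(?A ^^ (2 * Suc j)) x = ?A (?A ((?A ^^ (2 * j)) x))" by simp
      also have "\<dots> = ?A (?A (((-1) ^ j * ?t ^ (2 * j)) *\<^sub>R x))" by (simp only: Suc)
      also have "\<dots> = ((-1) ^ j * ?t ^ (2 * j)) *\<^sub>R (s * s) *\<^sub>R Jmap br l (Jmap br l x)"
        by (simp add: J.scaleR mult_ac)
      also have "\<dots> = ((-1) ^ Suc j * ?t ^ (2 * Suc j)) *\<^sub>R x"
        by (simp add: Jmap_Jmap[OF h] power_mult_distrib power2_eq_square algebra_simps)
      finally show ?case .
    qed simp
    show ?thesis
    proof (cases "even k")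
      case True
      then obtain j where k: "k = 2 * j" by blast
      then show ?thesis using even[of j]
        by (simp add: cos_coeff_def sin_coeff_def divide_inverse mult_ac)
    next
      case False
      then obtain j where k: "k = 2 * j + 1" by (elim oddE)
      have "(?A ^^ k) x = ?A ((?A ^^ (2 * j)) x)" by (simp add: k)
      also have "\<dots> = ?A (((-1) ^ j * ?t ^ (2 * j)) *\<^sub>R x)" by (simp only: even)
      also have "\<dots> = ((-1) ^ j * ?t ^ (2 * j) * s) *\<^sub>R Jmap br l x"
        by (simp add: J.scaleR mult_ac)
      finally show ?thesis using l
        by (simp add: k cos_coeff_def sin_coeff_def field_simps del: fact_Suc)
    qed
  qed
  have "(\<lambda>k. (cos_coeff k * ?t ^ k) *\<^sub>R x + (sin_coeff k * ?t ^ k / norm l) *\<^sub>R Jmap br l x) sums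
      (cos ?t *\<^sub>R x + (sin ?t / norm l) *\<^sub>R Jmap br l x)"
    using cos_converges[of ?t] sin_converges[of ?t]
    by (intro sums_add sums_scaleR_left sums_divide) auto
  then show ?thesis unfolding lin_exp_def pow by (simp add: sums_iff)
qed

lemma inv_Jmap:
  assumes h: "h_type br" and l: "l \<noteq> 0"
  shows "inv (Jmap br l) x = (- 1 / (norm l)\<^sup>2) *\<^sub>R Jmap br l x"
proof (rule inv_f_eq)
  interpret J: linear "Jmap br l" by (rule linear_Jmap[OF h])
  show "inj (Jmap br l)"
  proof (rule injI)
    fix x y assume "Jmap br l x = Jmap br l y"
    then have "Jmap br l (Jmap br l x) = Jmap br l (Jmap br l y)" by simp
    then show "x = y" using l by (simp add: Jmap_Jmap[OF h])
  qed
  show "Jmap br l ((- 1 / (norm l)\<^sup>2) *\<^sub>R Jmap br l x) = x"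
    using l by (simp add: J.scaleR J.neg Jmap_Jmap[OF h])
qed

lemma gam_eq:
  assumes h: "h_type br" and l: "l \<noteq> 0"
  shows "gam br \<nu> l s = (jplane br l \<nu> (cis (s * norm l)), (s / (2 * norm l)) *\<^sub>R sgn l)"
proof -
  interpret J: linear "Jmap br l" by (rule linear_Jmap[OF h])
  have "(sin (s * norm l) / norm l) *\<^sub>R Jmap br l (inv (Jmap br l) \<nu>) = (sin (s * norm l) / norm l) *\<^sub>R \<nu>"
    using l by (simp add: inv_Jmap[OF h l] J.scaleR J.neg Jmap_Jmap[OF h])
  then show ?thesis
    unfolding gam_def lin_exp_Jmap[OF h l]
    using l by (simp add: inv_Jmap[OF h l] jplane_def algebra_simps power2_eq_square)
qed

lemma linear_jplane: "linear (jplane br l y)"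
  by (rule linearI) (auto simp: jplane_def algebra_simps add_divide_distrib)

lemma jplane_scaleR:
  assumes h: "h_type br"
  shows "jplane br l (r *\<^sub>R y) z = r *\<^sub>R jplane br l y z"
proof -
  interpret J: linear "Jmap br l" by (rule linear_Jmap[OF h])
  show ?thesis by (simp add: jplane_def J.scaleR algebra_simps)
qed

section \<open>Measurability of the group law and invariance under right translations\<close>

lemma vbr_measurable:
  fixes f :: "'c \<Rightarrow> 'v::euclidean_space" and br :: "'v \<times> 'z::euclidean_space \<Rightarrow> 'v \<times> 'z \<Rightarrow> 'v \<times> 'z"
  assumes h: "h_type br" and "f \<in> borel_measurable M" "g \<in> borel_measurable M"
  shows "(\<lambda>x. vbr br (f x) (g x)) \<in> borel_measurable M"
proof -
  interpret bounded_bilinear "vbr br" by (rule vbr_bounded_bilinear[OF h])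
  have "continuous_on UNIV (\<lambda>p. vbr br (fst p) (snd p))"
    by (rule continuous_on; intro continuous_intros)
  then show ?thesis using borel_measurable_continuous_on[of "\<lambda>p. vbr br (fst p) (snd p)" "\<lambda>x. (f x, g x)" M]
    assms(2,3) by simp
qed

lemma gmult_measurable:
  fixes f :: "'c \<Rightarrow> 'v::euclidean_space \<times> 'z::euclidean_space"
  assumes h: "h_type br" and [measurable]: "f \<in> borel_measurable M" "g \<in> borel_measurable M"
  shows "(\<lambda>x. gmult br (f x) (g x)) \<in> borel_measurable M"
proof -
  have [measurable]: "(\<lambda>x. fst (f x)) \<in> borel_measurable M" "(\<lambda>x. snd (f x)) \<in> borel_measurable M"
    "(\<lambda>x. fst (g x)) \<in> borel_measurable M" "(\<lambda>x. snd (g x)) \<in> borel_measurable M"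
    by (rule borel_measurable_continuous_on[OF _ assms(2)] borel_measurable_continuous_on[OF _ assms(3)],
        intro continuous_intros)+
  have [measurable]: "(\<lambda>x. vbr br (fst (f x)) (fst (g x))) \<in> borel_measurable M"
    by (rule vbr_measurable[OF h]) measurable
  show ?thesis unfolding gmult_def by measurable
qed

text \<open>For fixed x a right translation only shifts u, by an amount depending on x, and it
  shifts x by a constant. This is the change of variables behind \<open>I_zero_test\<close>.\<close>

lemma nn_integral_gmult_right:
  fixes F :: "'v::euclidean_space \<times> 'z::euclidean_space \<Rightarrow> ennreal"
  assumes h: "h_type br" and [measurable]: "F \<in> borel_measurable borel"
  shows "(\<integral>\<^sup>+g. F (gmult br g p) \<partial>lborel) = (\<integral>\<^sup>+g. F g \<partial>lborel)"
proof -
  have [measurable]: "(\<lambda>g. gmult br g p) \<in> borel_measurable borel" by (rule gmult_measurable[OF h]) auto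
  obtain c d where p: "p = (c, d)" by force
  have [measurable]: "F \<in> borel_measurable (lborel \<Otimes>\<^sub>M lborel)" unfolding lborel_prod by simp
  have 1: "(\<lambda>g. F (gmult br g p)) \<in> borel_measurable (lborel \<Otimes>\<^sub>M lborel)" unfolding lborel_prod by simp
  have "(\<integral>\<^sup>+g. F (gmult br g p) \<partial>lborel) = (\<integral>\<^sup>+x. \<integral>\<^sup>+u. F (gmult br (x, u) p) \<partial>lborel \<partial>lborel)"
    by (subst lborel_prod[symmetric], subst lborel.nn_integral_fst[symmetric, OF 1]) simp
  also have "\<dots> = (\<integral>\<^sup>+x. \<integral>\<^sup>+u. F (x + c, u + (d + (1/2) *\<^sub>R vbr br x c)) \<partial>lborel \<partial>lborel)"
    by (simp add: gmult_def p add.assoc)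
  also have "\<dots> = (\<integral>\<^sup>+x. \<integral>\<^sup>+u. F (x + c, u) \<partial>lborel \<partial>lborel)"
    by (subst nn_integral_lborel_shift) auto
  also have "\<dots> = (\<integral>\<^sup>+x. \<integral>\<^sup>+u. F (x, u) \<partial>lborel \<partial>lborel)"
    by (rule nn_integral_lborel_shift[of "\<lambda>x. \<integral>\<^sup>+u. F (x, u) \<partial>lborel"]) simp
  also have "\<dots> = (\<integral>\<^sup>+g. F g \<partial>lborel)"
    by (subst lborel.nn_integral_fst) (auto simp: lborel_prod)
  finally show ?thesis .
qed

lemma distr_gmult_right:
  fixes br :: "'v::euclidean_space \<times> 'z::euclidean_space \<Rightarrow> 'v \<times> 'z \<Rightarrow> 'v \<times> 'z"
  assumes h: "h_type br"
  shows "distr lborel borel (\<lambda>g. gmult br g p) = lborel"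
proof (rule measure_eqI)
  have [measurable]: "(\<lambda>g. gmult br g p) \<in> borel_measurable borel" by (rule gmult_measurable[OF h]) auto
  fix A assume "A \<in> sets (distr lborel borel (\<lambda>g. gmult br g p))"
  then have [measurable]: "A \<in> sets borel" by simp
  have "emeasure (distr lborel borel (\<lambda>g. gmult br g p)) A =
      (\<integral>\<^sup>+g. indicator A g \<partial>distr lborel borel (\<lambda>g. gmult br g p))"
    by (rule nn_integral_indicator[symmetric]) simp
  also have "\<dots> = (\<integral>\<^sup>+g. indicator A (gmult br g p) \<partial>lborel)"
    by (rule nn_integral_distr) auto
  also have "\<dots> = (\<integral>\<^sup>+g. indicator A g \<partial>lborel)"
    by (rule nn_integral_gmult_right[OF h]) measurable
  finally show "emeasure (distr lborel borel (\<lambda>g. gmult br g p)) A = emeasure lborel A"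
    by simp
qed simp

lemma integral_gmult_right:
  fixes F :: "'v::euclidean_space \<times> 'z::euclidean_space \<Rightarrow> complex"
  assumes h: "h_type br" and [measurable]: "F \<in> borel_measurable borel"
  shows "(LINT g|lborel. F (gmult br g p)) = (LINT g|lborel. F g)"
proof -
  have [measurable]: "(\<lambda>g. gmult br g p) \<in> borel_measurable borel" by (rule gmult_measurable[OF h]) auto
  show ?thesis by (subst (2) distr_gmult_right[OF h, of p, symmetric]) (simp add: integral_distr)
qed

text \<open>The quotient measure is the image of Lebesgue measure on the fundamental domain, so a
  null set of cosets pulls back to a null set there, and every g lies in its own coset. After this
  the quotient measure is not unfolded again.\<close>

lemma I_zero_AE:
  fixes br :: "'v::euclidean_space \<times> 'z::euclidean_space \<Rightarrow> 'v \<times> 'z \<Rightarrow> 'v \<times> 'z"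
  assumes h: "h_type br" and "I_zero br \<nu> l f"
  shows "AE g in lborel. g \<in> Gam_domain l \<longrightarrow> Iint br \<nu> l f g = 0"
proof -
  interpret bounded_bilinear "vbr br" by (rule vbr_bounded_bilinear[OF h])
  let ?S = "sigma (range (Gam_coset br l)) {A. A \<subseteq> range (Gam_coset br l) \<and> Gam_coset br l -` A \<in> sets borel}"
  have snd_meas [measurable]: "(snd :: 'v \<times> 'z \<Rightarrow> 'z) \<in> borel_measurable borel"
    by (intro borel_measurable_continuous_onI continuous_intros)
  have "Gam_domain l = {p::'v \<times> 'z. 0 \<le> snd p \<bullet> sgn l \<and> snd p \<bullet> sgn l < pi / (norm l)\<^sup>2}"
    by (auto simp: Gam_domain_def)
  also have "\<dots> \<in> sets borel" by measurable
  finally have dom: "(Gam_domain l :: ('v \<times> 'z) set) \<in> sets borel" .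
  have "Gam_coset br l \<in> measurable (restrict_space lborel (Gam_domain l)) ?S"
  proof (rule measurable_measure_of)
    fix A assume "A \<in> {A. A \<subseteq> range (Gam_coset br l) \<and> Gam_coset br l -` A \<in> sets borel}"
    then have "Gam_coset br l -` A \<inter> Gam_domain l \<in> sets borel" using dom by blast
    then show "Gam_coset br l -` A \<inter> space (restrict_space lborel (Gam_domain l)) \<in> sets (restrict_space lborel (Gam_domain l))"
      using dom by (subst sets_restrict_space_iff) (auto simp: space_restrict_space)
  qed (auto simp: space_restrict_space)
  from AE_distrD[OF this] assms(2)
  have "AE g in restrict_space lborel (Gam_domain l). \<forall>g'\<in>Gam_coset br l g. Iint br \<nu> l f g' = 0"
    unfolding I_zero_def G_quot_def by blast
  then have "AE g in lborel. g \<in> Gam_domain l \<longrightarrow> (\<forall>g'\<in>Gam_coset br l g. Iint br \<nu> l f g' = 0)"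
    using dom by (simp add: AE_restrict_space_iff)
  moreover have "g \<in> Gam_coset br l g" for g
  proof -
    have "(0, 0) \<in> (Gam_lattice l :: ('v \<times> 'z) set)"
      unfolding Gam_lattice_def by (auto intro: exI[of _ 0])
    moreover have "gmult br g (0, 0) = g" by (simp add: gmult_def zero_right)
    ultimately show ?thesis unfolding Gam_coset_def by (metis image_eqI)
  qed
  ultimately show ?thesis by (auto elim!: eventually_mono)
qed

lemma continuous_on_jplane [continuous_intros]:
  "continuous_on S f \<Longrightarrow> continuous_on S (\<lambda>x. jplane br l y (f x))"
  by (rule continuous_on_compose2[OF linear_continuous_on[OF linear_jplane[THEN linear_conv_bounded_linear[THEN iffD1]], of UNIV]]) auto

lemma jplane_measurable [measurable]:
  assumes "f \<in> borel_measurable M"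
  shows "(\<lambda>x. jplane br l y (f x)) \<in> borel_measurable M"
  by (rule borel_measurable_continuous_on[OF _ assms]) (intro continuous_intros)

lemma fst_snd_borel_measurable [measurable]:
  "(fst :: 'a::euclidean_space \<times> 'b::euclidean_space \<Rightarrow> 'a) \<in> borel_measurable borel"
  "(snd :: 'a \<times> 'b \<Rightarrow> 'b) \<in> borel_measurable borel"
  by (intro borel_measurable_continuous_onI continuous_intros)+

lemma cis_measurable [measurable]:
  "f \<in> borel_measurable M \<Longrightarrow> (\<lambda>x. cis (f x)) \<in> borel_measurable M"
  by (erule borel_measurable_continuous_on[rotated]) (intro continuous_intros)

section \<open>The circle equations for \<open>f\<^sup>\<mu>\<close>\<close>

lemma Gam_domain_measurable [measurable]:
  "(Gam_domain l :: ('v::euclidean_space \<times> 'z::euclidean_space) set) \<in> sets borel"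
proof -
  have "Gam_domain l = {p::'v \<times> 'z. 0 \<le> snd p \<bullet> sgn l \<and> snd p \<bullet> sgn l < pi / (norm l)\<^sup>2}"
    by (auto simp: Gam_domain_def)
  also have "\<dots> \<in> sets borel" by measurable
  finally show ?thesis .
qed

text \<open>The equation is integrated against a character cut off to the fundamental domain, and a
  right translation moves the curve from f to the test function. For fixed g the cut-off selects a
  set of times meeting each class modulo 2 pi once, and the integrand is 2 pi periodic because k is
  an integer, so the integral is one over a full circle. What is left depends on u only through the
  character, and the u-integral produces \<open>central_ft f \<mu>\<close>.\<close>

lemma I_zero_test:
  fixes br :: "'v::euclidean_space \<times> 'z::euclidean_space \<Rightarrow> 'v \<times> 'z \<Rightarrow> 'v \<times> 'z" and f :: "'v \<times> 'z \<Rightarrow> complex"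
  assumes h: "h_type br" and f: "integrable lborel f" and l: "l \<noteq> 0" and I: "I_zero br \<nu> l f"
    and k: "\<mu> \<bullet> sgn l = 2 * of_int k * (norm l)\<^sup>2"
    and \<psi> [measurable]: "\<psi> \<in> borel_measurable borel" and b: "\<And>x. norm (\<psi> x) \<le> C"
  shows "(LINT w|lborel. central_ft f \<mu> w * (LINT t|lborel. indicator {0..<2*pi} t *\<^sub>R
      (\<psi> (w - jplane br l \<nu> (cis t)) * cis (of_int k * t + \<mu> \<bullet> vbr br w (jplane br l \<nu> (cis t)) / 2)))) = 0"
proof -
  interpret V: bounded_bilinear "vbr br" by (rule vbr_bounded_bilinear[OF h])
  define L where "L = norm l"
  have L: "L > 0" using l by (simp add: L_def)
  define c where "c t = jplane br l \<nu> (cis t)" for t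
  have c_m [measurable]: "c \<in> borel_measurable borel" unfolding c_def by measurable
  \<comment> \<open>The curve at time t / |l|, so that its plane part has period 2 pi in t;
    \<open>\<delta>\<close> is its pointwise inverse in the group.\<close>
  define \<gamma> where "\<gamma> t = (c t, (t / (2 * L\<^sup>2)) *\<^sub>R sgn l)" for t
  define \<delta> where "\<delta> t = (- c t, - (t / (2 * L\<^sup>2)) *\<^sub>R sgn l)" for t
  have inv: "gmult br (gmult br g (\<gamma> t)) (\<delta> t) = g" for g t
    by (simp add: gmult_def \<gamma>_def \<delta>_def V.add_left V.minus_right vbr_self[OF h] algebra_simps)
  have [measurable]: "\<gamma> \<in> borel_measurable borel" "\<delta> \<in> borel_measurable borel"
    unfolding \<gamma>_def \<delta>_def by measurable
  have f_m [measurable]: "f \<in> borel_measurable borel" using f by auto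
  define K where "K g = indicator (Gam_domain l) g *\<^sub>R (\<psi> (fst g) * cis (- (\<mu> \<bullet> snd g)))" for g
  have K_m [measurable]: "K \<in> borel_measurable borel" unfolding K_def by measurable
  \<comment> \<open>The coordinate of \<open>gmult br g (\<delta> t)\<close> along
    \<open>sgn l\<close> is (\<rho> g t - t) / (2 L^2). The bracket makes \<rho> depend on t, but
    only periodically, so the set \<open>S g\<close> of admissible times need not be an
    interval.\<close>
  define \<rho> where "\<rho> g t = 2 * L\<^sup>2 * ((snd g - (1/2) *\<^sub>R vbr br (fst g) (c t)) \<bullet> sgn l)" for g :: "'v \<times> 'z" and t
  define S where "S g = {t. 0 \<le> \<rho> g t - t \<and> \<rho> g t - t < 2 * pi}" for g
  define P where "P g t = cis (- (\<mu> \<bullet> snd g)) * (\<psi> (fst g - c t) * cis (of_int k * t + \<mu> \<bullet> vbr br (fst g) (c t) / 2))" for g t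
  have [measurable]: "\<rho> g \<in> borel_measurable borel" "P g \<in> borel_measurable borel" for g
  proof -
    have [measurable]: "(\<lambda>t. vbr br (fst g) (c t)) \<in> borel_measurable borel"
      by (rule vbr_measurable[OF h]) auto
    show "\<rho> g \<in> borel_measurable borel" "P g \<in> borel_measurable borel" unfolding \<rho>_def P_def by measurable
  qed
  have C: "0 \<le> C" using b[of 0] norm_ge_zero order_trans by blast
  have bP: "norm (P g t) \<le> C" for g t by (simp add: P_def norm_mult b)
  have b\<rho>: "\<exists>B. \<forall>t. \<bar>\<rho> g t\<bar> \<le> B" for g
  proof -
    have "bounded (range c)"
    proof -
      have "range c \<subseteq> jplane br l \<nu> ` sphere 0 1" by (auto simp: c_def)
      moreover have "compact (jplane br l \<nu> ` sphere 0 1)"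
        by (intro compact_continuous_image continuous_intros) auto
      ultimately show ?thesis using bounded_subset compact_imp_bounded by blast
    qed
    then obtain c0 where c0: "norm (c t) \<le> c0" for t by (auto simp: bounded_iff)
    obtain v0 where v0: "0 \<le> v0" "norm (vbr br x y) \<le> norm x * norm y * v0" for x y
      using V.nonneg_bounded by blast
    have "\<bar>\<rho> g t\<bar> \<le> 2 * L\<^sup>2 * (norm (snd g) + norm (fst g) * c0 * v0 )" for t
    proof -
      have "\<bar>(snd g - (1/2) *\<^sub>R vbr br (fst g) (c t)) \<bullet> sgn l\<bar> \<le> norm (snd g - (1/2) *\<^sub>R vbr br (fst g) (c t)) * norm (sgn l)"
        by (rule Cauchy_Schwarz_ineq2)
      also have "\<dots> \<le> norm (snd g) + norm ((1/2) *\<^sub>R vbr br (fst g) (c t))"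
        using l by (simp add: norm_sgn norm_triangle_ineq4 del: norm_scaleR)
      also have "norm ((1/2) *\<^sub>R vbr br (fst g) (c t)) \<le> norm (fst g) * norm (c t) * v0"
        using v0(2)[of "fst g" "c t"] norm_ge_zero[of "vbr br (fst g) (c t)"] by (simp only: norm_scaleR)
      also have "\<dots> \<le> norm (fst g) * c0 * v0"
        by (intro mult_right_mono mult_left_mono c0 v0 norm_ge_zero)
      finally show ?thesis using L by (simp add: \<rho>_def abs_mult)
    qed
    then show ?thesis by blast
  qed
  have c_per: "c (t + 2 * pi) = c t" for t by (simp add: c_def cis.ctr)
  have \<rho>_per: "\<rho> g (t + 2 * pi) = \<rho> g t" for g t by (simp add: \<rho>_def c_per)
  have P_per: "P g (t + 2 * pi) = P g t" for g t
  proof -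
    have "cis (of_int k * (t + 2 * pi) + x) = cis (of_int k * t + x)" for x
    proof -
      have "cis (of_int k * (t + 2 * pi) + x) = cis (of_int k * t + x) * cis (2 * pi * of_int k)"
        by (simp add: cis_mult algebra_simps)
      then show ?thesis by (simp add: cis_multiple_2pi)
    qed
    then show ?thesis by (simp add: P_def c_per)
  qed
  have K\<delta>: "K (gmult br g (\<delta> t)) = indicator (S g) t *\<^sub>R P g t" for g t
  proof -
    obtain x u where g: "g = (x, u)" by force
    have 1: "gmult br g (\<delta> t) = (x - c t, u - (t / (2 * L\<^sup>2)) *\<^sub>R sgn l - (1/2) *\<^sub>R vbr br x (c t))"
      by (simp add: gmult_def g \<delta>_def V.minus_right)
    have s: "sgn l \<bullet> sgn l = 1" using l by (simp add: dot_square_norm norm_sgn)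
    have 2: "(u - (t / (2 * L\<^sup>2)) *\<^sub>R sgn l - (1/2) *\<^sub>R vbr br x (c t)) \<bullet> sgn l = (\<rho> g t - t) / (2 * L\<^sup>2)"
      using L by (simp add: \<rho>_def g inner_diff_left s) (simp add: field_simps)
    have pi': "x / (2 * L\<^sup>2) < pi / L\<^sup>2 \<longleftrightarrow> x < 2 * pi" for x
      using L by (simp add: divide_simps mult.commute)
    have 3: "gmult br g (\<delta> t) \<in> Gam_domain l \<longleftrightarrow> t \<in> S g"
      unfolding 1 Gam_domain_def S_def mem_Collect_eq split 2 L_def[symmetric]
      unfolding pi' using L by (simp add: zero_le_divide_iff)
    have "\<mu> \<bullet> (u - (t / (2 * L\<^sup>2)) *\<^sub>R sgn l - (1/2) *\<^sub>R vbr br x (c t)) = \<mu> \<bullet> u - of_int k * t - \<mu> \<bullet> vbr br x (c t) / 2"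
      using L by (simp add: inner_diff_right k L_def[symmetric]) (simp add: field_simps)?
    then have "cis (- (\<mu> \<bullet> snd (gmult br g (\<delta> t)))) = cis (- (\<mu> \<bullet> u)) * cis (of_int k * t + \<mu> \<bullet> vbr br x (c t) / 2)"
      unfolding 1 by (simp add: cis_mult algebra_simps)
    then show ?thesis
      using 3 by (simp add: K_def P_def g 1[unfolded g] indicator_def)
  qed
  have int_K: "(LINT t|lborel. K (gmult br g (\<delta> t))) = (LINT t|lborel. indicator {0..<2*pi} t *\<^sub>R P g t)" for g
  proof -
    obtain B where "\<And>t. \<bar>\<rho> g t\<bar> \<le> B" using b\<rho> by blast
    from periodic_cross_section_integral(2)[of "P g" "\<rho> g" C B, OF _ _ bP this P_per \<rho>_per]
    show ?thesis unfolding K\<delta> S_def by simp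
  qed
  \<comment> \<open>The same telescoping with the constant C in place of \<open>P g\<close> bounds
    the absolute integral uniformly in g; this is the integrability that Fubini asks for.\<close>
  have nn_K: "(\<integral>\<^sup>+t. ennreal (norm (K (gmult br g (\<delta> t)))) \<partial>lborel) \<le> ennreal (2 * pi * C)" for g
  proof -
    obtain B where B: "\<And>t. \<bar>\<rho> g t\<bar> \<le> B" using b\<rho> by blast
    note p = periodic_cross_section_integral[of "\<lambda>_. C" "\<rho> g" C B, OF _ _ _ B _ \<rho>_per]
    have "(\<integral>\<^sup>+t. ennreal (norm (K (gmult br g (\<delta> t)))) \<partial>lborel) \<le> (\<integral>\<^sup>+t. ennreal (indicator (S g) t *\<^sub>R C) \<partial>lborel)"
      unfolding K\<delta> by (intro nn_integral_mono) (auto simp: indicator_def bP intro!: ennreal_leI)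
    also have "\<dots> = ennreal (LINT t|lborel. indicator (S g) t *\<^sub>R C)"
      unfolding S_def using C by (intro nn_integral_eq_integral p(1)) (auto simp: indicator_def)
    also have "(LINT t|lborel. indicator (S g) t *\<^sub>R C) = (LINT t|lborel. indicator {0..<2*pi} t *\<^sub>R C)"
      unfolding S_def using C by (intro p(2)) auto
    also have "\<dots> = 2 * pi * C" by simp
    finally show ?thesis .
  qed
  have gm [measurable]: "(\<lambda>p. gmult br (fst p) (\<delta> (snd p))) \<in> borel_measurable (lborel \<Otimes>\<^sub>M lborel)"
     "(\<lambda>p. gmult br (fst p) (\<gamma> (snd p))) \<in> borel_measurable (lborel \<Otimes>\<^sub>M lborel)"
     "(\<lambda>g. gmult br g (\<delta> t)) \<in> borel_measurable borel"
     "(\<lambda>t. gmult br g (\<delta> t)) \<in> borel_measurable borel" for t g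
    by (rule gmult_measurable[OF h]; measurable)+
  define \<Psi> where "\<Psi> p = K (gmult br (fst p) (\<delta> (snd p))) * f (fst p)" for p
  define \<Phi> where "\<Phi> p = K (fst p) * f (gmult br (fst p) (\<gamma> (snd p)))" for p
  have [measurable]: "\<Psi> \<in> borel_measurable (lborel \<Otimes>\<^sub>M lborel)" "\<Phi> \<in> borel_measurable (lborel \<Otimes>\<^sub>M lborel)"
    unfolding \<Psi>_def \<Phi>_def by measurable
  have \<Psi>\<Phi>: "\<Phi> (g, t) = \<Psi> (gmult br g (\<gamma> t), t)" for g t by (simp add: \<Psi>_def \<Phi>_def inv)
  have \<Psi>_m [measurable]: "(\<lambda>g. \<Psi> (g, t)) \<in> borel_measurable borel" for t
    unfolding \<Psi>_def by simp
  have fin: "(\<integral>\<^sup>+p. ennreal (norm (\<Psi> p)) \<partial>(lborel \<Otimes>\<^sub>M lborel)) < \<infinity>"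
  proof -
    have "(\<integral>\<^sup>+p. ennreal (norm (\<Psi> p)) \<partial>(lborel \<Otimes>\<^sub>M lborel)) = (\<integral>\<^sup>+g. \<integral>\<^sup>+t. ennreal (norm (\<Psi> (g, t))) \<partial>lborel \<partial>lborel)"
      by (subst lborel.nn_integral_fst) auto
    also have "\<dots> = (\<integral>\<^sup>+g. (\<integral>\<^sup>+t. ennreal (norm (K (gmult br g (\<delta> t)))) \<partial>lborel) * ennreal (norm (f g)) \<partial>lborel)"
      by (simp add: \<Psi>_def norm_mult ennreal_mult nn_integral_multc)
    also have "\<dots> \<le> (\<integral>\<^sup>+g. ennreal (2 * pi * C) * ennreal (norm (f g)) \<partial>lborel)"
      by (intro nn_integral_mono mult_right_mono nn_K) simp
    also have "\<dots> = ennreal (2 * pi * C) * (\<integral>\<^sup>+g. ennreal (norm (f g)) \<partial>lborel)"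
      by (rule nn_integral_cmult) simp
    also have "\<dots> < \<infinity>" using f by (simp add: integrable_iff_bounded ennreal_mult_less_top)
    finally show ?thesis .
  qed
  then have int\<Psi>: "integrable (lborel \<Otimes>\<^sub>M lborel) \<Psi>" by (simp add: integrable_iff_bounded)
  have int\<Phi>: "integrable (lborel \<Otimes>\<^sub>M lborel) \<Phi>"
  proof -
    have "(\<integral>\<^sup>+p. ennreal (norm (\<Phi> p)) \<partial>(lborel \<Otimes>\<^sub>M lborel)) = (\<integral>\<^sup>+t. \<integral>\<^sup>+g. ennreal (norm (\<Psi> (gmult br g (\<gamma> t), t))) \<partial>lborel \<partial>lborel)"
      by (subst lborel_pair.nn_integral_snd[symmetric]) (auto simp: \<Psi>\<Phi>)
    also have "\<dots> = (\<integral>\<^sup>+t. \<integral>\<^sup>+g. ennreal (norm (\<Psi> (g, t))) \<partial>lborel \<partial>lborel)"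
      by (subst nn_integral_gmult_right[OF h, where F = "\<lambda>g. ennreal (norm (\<Psi> (g, _)))"]) auto
    also have "\<dots> = (\<integral>\<^sup>+p. ennreal (norm (\<Psi> p)) \<partial>(lborel \<Otimes>\<^sub>M lborel))"
      by (subst lborel_pair.nn_integral_snd) auto
    finally show ?thesis using fin by (simp add: integrable_iff_bounded)
  qed
  \<comment> \<open>\<open>K\<close> vanishes off the fundamental domain, so the equation on the
    domain is all that enters.\<close>
  have "AE g in lborel. K g * (LINT t|lborel. f (gmult br g (\<gamma> t))) = 0"
    using I_zero_AE[OF h I]
  proof eventually_elim
    fix g assume g: "g \<in> Gam_domain l \<longrightarrow> Iint br \<nu> l f g = 0"
    have "gam br \<nu> l s = \<gamma> (0 + L * s)" for s
      using L by (simp add: gam_eq[OF h l] \<gamma>_def c_def L_def power2_eq_square mult.commute)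
    then have "(LINT t|lborel. f (gmult br g (\<gamma> t))) = L *\<^sub>R Iint br \<nu> l f g"
      unfolding Iint_def using L lborel_integral_real_affine[of L "\<lambda>t. f (gmult br g (\<gamma> t))" 0] by simp
    then show "K g * (LINT t|lborel. f (gmult br g (\<gamma> t))) = 0"
      using g by (auto simp: K_def indicator_def)
  qed
  then have "0 = (LINT g|lborel. K g * (LINT t|lborel. f (gmult br g (\<gamma> t))))"
    by (subst integral_cong_AE[where g = "\<lambda>_. 0"]) auto
  also have "\<dots> = (LINT g|lborel. LINT t|lborel. \<Phi> (g, t))" by (simp add: \<Phi>_def)
  also have "\<dots> = (LINT t|lborel. LINT g|lborel. \<Phi> (g, t))"
    using lborel_pair.Fubini_integral[of "\<lambda>g t. \<Phi> (g, t)"] int\<Phi> by simp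
  also have "\<dots> = (LINT t|lborel. LINT g|lborel. \<Psi> (g, t))"
    unfolding \<Psi>\<Phi> by (subst integral_gmult_right[OF h, where F = "\<lambda>g. \<Psi> (g, _)"]) auto
  also have "\<dots> = (LINT g|lborel. LINT t|lborel. \<Psi> (g, t))"
    using lborel_pair.Fubini_integral[of "\<lambda>g t. \<Psi> (g, t)"] int\<Psi> by simp
  also have "\<dots> = (LINT g|lborel. f g * (LINT t|lborel. indicator {0..<2*pi} t *\<^sub>R P g t))"
    by (simp add: \<Psi>_def int_K mult.commute)
  finally have main: "0 = (LINT g|lborel. f g * (LINT t|lborel. indicator {0..<2*pi} t *\<^sub>R P g t))" .
  \<comment> \<open>\<open>P g\<close> is the character in u times a function of x and t; Q is the
    integral of the latter over the circle.\<close>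
  define Q where "Q x = (LINT t|lborel. indicator {0..<2*pi} t *\<^sub>R
      (\<psi> (x - c t) * cis (of_int k * t + \<mu> \<bullet> vbr br x (c t) / 2)))" for x
  have [measurable]: "(\<lambda>p. vbr br (fst p) (c (snd p))) \<in> borel_measurable (borel \<Otimes>\<^sub>M borel)"
    by (rule vbr_measurable[OF h]) measurable
  have Q_m [measurable]: "Q \<in> borel_measurable borel"
  proof -
    have "(\<lambda>x. LINT t|lborel. (\<lambda>p. indicator {0..<2*pi} (snd p) *\<^sub>R
      (\<psi> (fst p - c (snd p)) * cis (of_int k * (snd p) + \<mu> \<bullet> vbr br (fst p) (c (snd p)) / 2))) (x, t)) \<in> borel_measurable borel"
      by (intro lborel.borel_measurable_lebesgue_integral) simp
    then show ?thesis by (simp add: Q_def[abs_def])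
  qed
  have bQ: "norm (Q x) \<le> 2 * pi * C" for x
  proof -
    have "norm (Q x) \<le> (LINT t|lborel. indicator {0..<2*pi} t *\<^sub>R C)"
      unfolding Q_def
    proof (rule order_trans[OF integral_norm_bound integral_mono])
      have [measurable]: "(\<lambda>t. vbr br x (c t)) \<in> borel_measurable borel"
        by (rule vbr_measurable[OF h]) auto
      show iC: "integrable lborel (\<lambda>t. indicator {0..<2*pi} t *\<^sub>R C)"
        by (intro integrable_scaleR_left integrable_real_indicator) auto
      show "integrable lborel (\<lambda>t. norm (indicator {0..<2*pi} t *\<^sub>R (\<psi> (x - c t) * cis (of_int k * t + \<mu> \<bullet> vbr br x (c t) / 2))))"
        by (rule Bochner_Integration.integrable_bound[OF iC])
           (auto simp: norm_mult indicator_def b C intro!: AE_I2 intro: order_trans[OF b])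
    qed (auto simp: norm_mult indicator_def b)
    then show ?thesis by simp
  qed
  have iQ: "integrable (lborel \<Otimes>\<^sub>M lborel) (\<lambda>p. f p * (cis (- (\<mu> \<bullet> snd p)) * Q (fst p)))"
    unfolding lborel_prod
  proof (rule Bochner_Integration.integrable_bound)
    show "integrable lborel (\<lambda>g. f g * of_real (2 * pi * C))" using f by simp
    have m: "norm (f g) * norm (Q (fst g)) \<le> norm (f g) * (2 * pi * C)" for g by (intro mult_left_mono bQ) simp
    then show "AE g in lborel. norm (f g * (cis (- (\<mu> \<bullet> snd g)) * Q (fst g))) \<le> norm (f g * of_real (2 * pi * C))"
      using C by (simp add: norm_mult)
  qed measurable
  have "(LINT g|lborel. f g * (LINT t|lborel. indicator {0..<2*pi} t *\<^sub>R P g t)) = (LINT g|lborel. f g * (cis (- (\<mu> \<bullet> snd g)) * Q (fst g)))"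
    by (simp add: P_def Q_def mult.commute[of "indicator _ _"] mult_scaleR_right[symmetric] del: mult_scaleR_right)
  also have "\<dots> = (LINT x|lborel. LINT u|lborel. f (x, u) * (cis (- (\<mu> \<bullet> u)) * Q x))"
    using lborel_pair.integral_fst'[OF iQ] by (simp add: lborel_prod)
  also have "\<dots> = (LINT x|lborel. central_ft f \<mu> x * Q x)"
    by (simp add: central_ft_def cis_conv_exp mult.assoc[symmetric])
  finally show ?thesis using main by (simp add: Q_def c_def)
qed

section \<open>Gaussian integrals and uniqueness of Fourier transforms\<close>

lemma integrable_pair_mult:
  fixes f :: "'a::euclidean_space \<Rightarrow> complex" and g :: "'b::euclidean_space \<Rightarrow> complex"
  assumes f: "integrable lborel f" and g: "integrable lborel g"
  shows "integrable (lborel \<Otimes>\<^sub>M lborel) (\<lambda>p. f (fst p) * g (snd p))"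
proof (rule lborel_pair.Fubini_integrable)
  have [measurable]: "f \<in> borel_measurable borel" "g \<in> borel_measurable borel" using f g by auto
  show "(\<lambda>p. f (fst p) * g (snd p)) \<in> borel_measurable (lborel \<Otimes>\<^sub>M lborel)" by measurable
  show "integrable lborel (\<lambda>x. LINT y|lborel. norm (f (fst (x, y)) * g (snd (x, y))))"
    using f by (simp add: norm_mult)
  show "AE x in lborel. integrable lborel (\<lambda>y. f (fst (x, y)) * g (snd (x, y)))"
    using g by simp
qed

lemma
  fixes F :: "'a::euclidean_space \<Rightarrow> real \<Rightarrow> complex"
  assumes F: "\<And>b. b \<in> Basis \<Longrightarrow> integrable lborel (F b)"
  shows integrable_lborel_prod: "integrable lborel (\<lambda>x::'a. \<Prod>b\<in>Basis. F b (x \<bullet> b))"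
    and integral_lborel_prod: "(LINT x|lborel. (\<Prod>b\<in>Basis. F b (x \<bullet> b))) = (\<Prod>b\<in>Basis. (LINT t|lborel. F b t))"
proof -
  interpret product_sigma_finite "\<lambda>_::'a. lborel :: real measure" ..
  have m: "F b \<in> borel_measurable borel" if "b \<in> Basis" for b using F[OF that] by auto
  have [measurable]: "(\<lambda>x::'a. \<Prod>b\<in>Basis. F b (x \<bullet> b)) \<in> borel_measurable borel"
    by (intro borel_measurable_prod measurable_compose[OF _ m]) auto
  have T: "(\<lambda>f. \<Sum>b\<in>Basis. f b *\<^sub>R b) \<in> measurable (\<Pi>\<^sub>M b\<in>(Basis::'a set). lborel) borel" by measurable
  have c: "(\<Sum>b\<in>Basis. f b *\<^sub>R b) \<bullet> b' = f b'" if "b' \<in> Basis" for f :: "'a \<Rightarrow> real" and b'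
    using that by (simp add: inner_sum_left inner_Basis if_distrib cong: if_cong)
  have e: "(\<Prod>b\<in>Basis. F b ((\<Sum>b\<in>Basis. f b *\<^sub>R b) \<bullet> b)) = (\<Prod>b\<in>Basis. F b (f b))" for f :: "'a \<Rightarrow> real"
    by (intro prod.cong refl) (simp add: c)
  show "integrable lborel (\<lambda>x::'a. \<Prod>b\<in>Basis. F b (x \<bullet> b))"
    by (subst lborel_eq, subst integrable_distr_eq[OF T]) (auto simp: e intro!: product_integrable_prod F)
  show "(LINT x|lborel. (\<Prod>b\<in>Basis. F b (x \<bullet> b))) = (\<Prod>b\<in>Basis. (LINT t|lborel. F b t))"
    by (subst lborel_eq, subst integral_distr[OF T]) (auto simp: e intro!: product_integral_prod F)
qed

text \<open>The characteristic function of the standard normal distribution, with x rescaled by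
  \<open>sqrt (2 * s)\<close>.\<close>

lemma
  assumes s: "s > 0"
  shows integrable_gaussian_real: "integrable lborel (\<lambda>x::real. cis (a * x) * of_real (exp (- s * x\<^sup>2)))"
    and integral_gaussian_real:
      "(LINT x|lborel. cis (a * x) * of_real (exp (- s * x\<^sup>2))) = of_real (sqrt (pi / s) * exp (- (a\<^sup>2) / (4 * s)))"
proof -
  define t where "t = a / sqrt (2 * s)"
  have t: "t * sqrt (2 * s) = a" using s by (simp add: t_def)
  define F where "F x = cis (t * x) * of_real (std_normal_density x)" for x
  have [measurable]: "F \<in> borel_measurable borel" unfolding F_def by measurable
  have iF: "integrable lborel F"
  proof (rule Bochner_Integration.integrable_bound)
    show "integrable lborel std_normal_density" by (rule integrable_normal_density) simp
  qed (auto simp: F_def norm_mult)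
  have "char std_normal_distribution t = (LINT x|lborel. F x)"
    unfolding char_def F_def
    by (subst integral_density) (auto simp: cis_conv_exp scaleR_conv_of_real mult.commute)
  then have int: "(LINT x|lborel. F x) = of_real (exp (- (t\<^sup>2) / 2))"
    by (simp add: char_std_normal_distribution)
  have e: "F (sqrt (2 * s) * x) = of_real (1 / sqrt (2 * pi)) * (cis (a * x) * of_real (exp (- s * x\<^sup>2)))" for x
  proof -
    have 1: "t * (sqrt (2 * s) * x) = a * x" "(sqrt (2 * s) * x)\<^sup>2 = 2 * (s * x\<^sup>2)"
      using s by (simp_all add: t[symmetric] power_mult_distrib)
    show ?thesis unfolding F_def std_normal_density_def 1 by simp
  qed
  have "integrable lborel (\<lambda>x. F (0 + sqrt (2 * s) * x))"
    using iF s by (intro lborel_integrable_real_affine) auto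
  then have "integrable lborel (\<lambda>x. of_real (sqrt (2 * pi)) *
      (of_real (1 / sqrt (2 * pi)) * (cis (a * x) * of_real (exp (- s * x\<^sup>2)))) :: complex)"
    unfolding add_0_left e by (rule integrable_mult_right)
  then show "integrable lborel (\<lambda>x::real. cis (a * x) * of_real (exp (- s * x\<^sup>2)))"
    by simp
  have "(LINT x|lborel. F x) = sqrt (2 * s) *\<^sub>R (LINT x|lborel. F (0 + sqrt (2 * s) * x))"
    using s lborel_integral_real_affine[of "sqrt (2 * s)" F 0] by simp
  also have "\<dots> = of_real (sqrt (2 * s) / sqrt (2 * pi)) * (LINT x|lborel. cis (a * x) * of_real (exp (- s * x\<^sup>2)))"
    unfolding add_0_left e by (simp add: scaleR_conv_of_real)
  also have "sqrt (2 * s) / sqrt (2 * pi) = sqrt (s / pi)" by (simp add: real_sqrt_divide real_sqrt_mult)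
  finally have "of_real (sqrt (pi / s)) * (LINT x|lborel. F x) =
      of_real (sqrt (pi / s)) * of_real (sqrt (s / pi)) * (LINT x|lborel. cis (a * x) * of_real (exp (- s * x\<^sup>2)))"
    by (simp add: mult.assoc)
  also have "of_real (sqrt (pi / s)) * of_real (sqrt (s / pi)) = (1 :: complex)"
    using s by (simp flip: of_real_mult real_sqrt_mult)
  also have "t\<^sup>2 / 2 = a\<^sup>2 / (4 * s)" using s by (simp add: t_def power_divide)
  then have "(LINT x|lborel. F x) = of_real (exp (- (a\<^sup>2) / (4 * s)))" by (simp add: int)
  finally show "(LINT x|lborel. cis (a * x) * of_real (exp (- s * x\<^sup>2))) = of_real (sqrt (pi / s) * exp (- (a\<^sup>2) / (4 * s)))"
    by simp
qed

lemma
  fixes q :: "'a::euclidean_space"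
  assumes s: "s > 0"
  shows integrable_gaussian_cis: "integrable lborel (\<lambda>x::'a. cis (q \<bullet> x) * of_real (exp (- s * (x \<bullet> x))))"
    and integral_gaussian_cis: "(LINT x|lborel. cis (q \<bullet> x) * of_real (exp (- s * (x \<bullet> x)))) =
      of_real (sqrt (pi / s) ^ DIM('a) * exp (- (q \<bullet> q) / (4 * s)))"
proof -
  have e: "cis (q \<bullet> x) * of_real (exp (- s * (x \<bullet> x))) =
      (\<Prod>b\<in>Basis. cis ((q \<bullet> b) * (x \<bullet> b)) * of_real (exp (- s * (x \<bullet> b)\<^sup>2)))" for x :: 'a
  proof -
    have cs: "cis (sum f A) = (\<Prod>b\<in>A. cis (f b))" if "finite A" for f :: "'a \<Rightarrow> real" and A
      using that by induction (auto simp: cis_mult[symmetric])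
    have "cis (q \<bullet> x) = (\<Prod>b\<in>Basis. cis ((q \<bullet> b) * (x \<bullet> b)))"
      by (subst euclidean_inner) (simp add: cs)
    moreover have "exp (- s * (x \<bullet> x)) = (\<Prod>b\<in>Basis. exp (- s * (x \<bullet> b)\<^sup>2))"
      by (subst euclidean_inner) (simp add: exp_sum[symmetric] sum_distrib_left power2_eq_square sum_negf[symmetric])
    ultimately show ?thesis by (simp add: prod.distrib)
  qed
  show "integrable lborel (\<lambda>x::'a. cis (q \<bullet> x) * of_real (exp (- s * (x \<bullet> x))))"
    unfolding e by (intro integrable_lborel_prod integrable_gaussian_real s)
  have "(LINT x|lborel. cis (q \<bullet> x) * of_real (exp (- s * (x \<bullet> x)))) =
    (\<Prod>b\<in>(Basis::'a set). of_real (sqrt (pi / s) * exp (- ((q \<bullet> b)\<^sup>2) / (4 * s))))"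
    unfolding e by (subst integral_lborel_prod[OF integrable_gaussian_real[OF s]]) (simp only: integral_gaussian_real[OF s])
  also have "\<dots> = of_real (\<Prod>b\<in>(Basis::'a set). sqrt (pi / s) * exp (- ((q \<bullet> b)\<^sup>2) / (4 * s)))"
    by (rule of_real_prod[symmetric])
  also have "(\<Prod>b\<in>(Basis::'a set). sqrt (pi / s) * exp (- ((q \<bullet> b)\<^sup>2) / (4 * s))) =
      sqrt (pi / s) ^ DIM('a) * exp (\<Sum>b\<in>(Basis::'a set). - ((q \<bullet> b)\<^sup>2) / (4 * s))"
    by (simp add: prod.distrib exp_sum)
  also have "(\<Sum>b\<in>(Basis::'a set). - ((q \<bullet> b)\<^sup>2) / (4 * s)) = - (q \<bullet> q) / (4 * s)"
    by (subst euclidean_inner[of q q]) (simp add: sum_negf sum_divide_distrib power2_eq_square)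
  finally show "(LINT x|lborel. cis (q \<bullet> x) * of_real (exp (- s * (x \<bullet> x)))) =
      of_real (sqrt (pi / s) ^ DIM('a) * exp (- (q \<bullet> q) / (4 * s)))" .
qed

text \<open>Completing the square only in the real part costs a real translation, so the oscillating
  factor is left to the Fourier transform and no contour is shifted. The exponent on the right is
  the bilinear (not Hermitian) square of p + i q over 4 s.\<close>

lemma integral_gaussian_exp:
  fixes p q :: "'a::euclidean_space"
  assumes s: "s > 0"
  shows "(LINT x|lborel. exp (of_real (p \<bullet> x) + \<i> * of_real (q \<bullet> x) - of_real (s * (x \<bullet> x)))) =
      of_real (sqrt (pi / s) ^ DIM('a)) * exp ((of_real (p \<bullet> p) - of_real (q \<bullet> q) + 2 * \<i> * of_real (p \<bullet> q)) / of_real (4 * s))"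
proof -
  let ?G = "\<lambda>x::'a. cis (q \<bullet> x) * of_real (exp (- s * (x \<bullet> x)))"
  define c :: complex where "c = exp (of_real (p \<bullet> p / (4 * s)) + \<i> * of_real (p \<bullet> q / (2 * s)))"
  define v where "v = - (1 / (2 * s)) *\<^sub>R p"
  have e: "exp (of_real (p \<bullet> x) + \<i> * of_real (q \<bullet> x) - of_real (s * (x \<bullet> x))) = c * ?G (x + v)" for x
  proof -
    have h1: "c * ?G (x + v) = exp (of_real (p \<bullet> p / (4 * s) - s * ((x + v) \<bullet> (x + v))) + \<i> * of_real (p \<bullet> q / (2 * s) + q \<bullet> (x + v)))"
      by (simp add: c_def cis_conv_exp exp_of_real[symmetric] exp_add[symmetric] algebra_simps)
    have h2: "p \<bullet> p / (4 * s) - s * ((x + v) \<bullet> (x + v)) = p \<bullet> x - s * (x \<bullet> x)"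
      using s by (simp add: v_def inner_diff_left inner_diff_right inner_commute field_simps power2_eq_square)
    have h3: "p \<bullet> q / (2 * s) + q \<bullet> (x + v) = q \<bullet> x"
      by (simp add: v_def inner_diff_right inner_commute)
    show ?thesis unfolding h1[unfolded h2 h3] by (simp add: algebra_simps)
  qed
  have "(LINT x|lborel. exp (of_real (p \<bullet> x) + \<i> * of_real (q \<bullet> x) - of_real (s * (x \<bullet> x)))) = c * (LINT x|lborel. ?G x)"
    unfolding e using integral_lborel_shift[of ?G v] by simp
  also have "\<dots> = of_real (sqrt (pi / s) ^ DIM('a)) * (c * exp (of_real (- (q \<bullet> q) / (4 * s))))"
    by (simp only: integral_gaussian_cis[OF s] of_real_mult exp_of_real mult_ac)
  also have "c * exp (of_real (- (q \<bullet> q) / (4 * s))) = exp ((of_real (p \<bullet> p) - of_real (q \<bullet> q) + 2 * \<i> * of_real (p \<bullet> q)) / of_real (4 * s))"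
    unfolding c_def exp_add[symmetric] by (simp add: add_divide_distrib diff_divide_distrib algebra_simps)
  finally show "(LINT x|lborel. exp (of_real (p \<bullet> x) + \<i> * of_real (q \<bullet> x) - of_real (s * (x \<bullet> x)))) =
      of_real (sqrt (pi / s) ^ DIM('a)) * exp ((of_real (p \<bullet> p) - of_real (q \<bullet> q) + 2 * \<i> * of_real (p \<bullet> q)) / of_real (4 * s))" .
qed

text \<open>The closed sets are an intersection-stable generator of the Borel sets, so the vanishing
  extends to all Borel sets; real and imaginary parts are then compared with 0 as densities.\<close>

lemma AE_zero_if_closed_integrals_zero:
  fixes g :: "'a::euclidean_space \<Rightarrow> complex"
  assumes g: "integrable lborel g"
    and F: "\<And>S. closed S \<Longrightarrow> (LINT x|lborel. indicator S x *\<^sub>R g x) = 0"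
  shows "AE x in lborel. g x = 0"
proof -
  have i: "integrable lborel (\<lambda>x. indicator A x *\<^sub>R g x)" if "A \<in> sets borel" for A
    using that by (intro integrable_mult_indicator g) auto
  have "(LINT x|lborel. indicator A x *\<^sub>R g x) = 0" if "A \<in> sets borel" for A
  proof -
    have "Int_stable (Collect closed :: 'a set set)" "Collect closed \<subseteq> Pow (UNIV :: 'a set)"
      by (auto simp: Int_stable_def)
    moreover have "A \<in> sigma_sets UNIV (Collect closed)" using that by (simp add: borel_eq_closed)
    ultimately show ?thesis
    proof (induction rule: sigma_sets_induct_disjoint)
      case (compl A)
      then have A: "A \<in> sets borel" by (simp add: borel_eq_closed)
      have "indicator (UNIV - A) x *\<^sub>R g x = indicator UNIV x *\<^sub>R g x - indicator A x *\<^sub>R g x" for x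
        by (auto simp: indicator_def)
      then have "(LINT x|lborel. indicator (UNIV - A) x *\<^sub>R g x) =
        (LINT x|lborel. indicator UNIV x *\<^sub>R g x) - (LINT x|lborel. indicator A x *\<^sub>R g x)"
        by (simp only:) (rule Bochner_Integration.integral_diff; rule i; use A in simp)
      then show ?case using compl F[of UNIV] by simp
    next
      case (union A)
      then have A: "A i \<in> sets lborel" for i by (auto simp: borel_eq_closed)
      have "set_integrable lborel (\<Union>i. A i) g"
        unfolding set_integrable_def using A by (intro i) auto
      then have "(LINT x:(\<Union>i. A i)|lborel. g x) = (\<Sum>i. (LINT x:(A i)|lborel. g x))"
        using union(1) A by (intro lebesgue_integral_countable_add) (auto simp: disjoint_family_on_def)
      then show ?case using union by (simp add: set_lebesgue_integral_def)
    qed (auto simp: F)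
  qed
  then have z: "(LINT x:A|lborel. g x) = 0" if "A \<in> sets lborel" for A
    using that by (simp add: set_lebesgue_integral_def)
  have "AE x in lborel. Re (g x) = 0"
  proof (rule density_unique_real)
    fix A :: "'a set" assume A: "A \<in> sets lborel"
    have "Re (LINT x:A|lborel. g x) = (LINT x:A|lborel. Re (g x))"
      unfolding set_lebesgue_integral_def using i A by (simp flip: integral_Re)
    then show "(LINT x:A|lborel. Re (g x)) = (LINT x:A|lborel. 0)"
      using z[OF A] by (simp add: set_lebesgue_integral_def)
  qed (use g in auto)
  moreover have "AE x in lborel. Im (g x) = 0"
  proof (rule density_unique_real)
    fix A :: "'a set" assume A: "A \<in> sets lborel"
    have "Im (LINT x:A|lborel. g x) = (LINT x:A|lborel. Im (g x))"
      unfolding set_lebesgue_integral_def using i A by (simp flip: integral_Im)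
    then show "(LINT x:A|lborel. Im (g x)) = (LINT x:A|lborel. 0)"
      using z[OF A] by (simp add: set_lebesgue_integral_def)
  qed (use g in auto)
  ultimately show ?thesis by eventually_elim (simp add: complex_eq_iff)
qed

text \<open>Indicators of closed sets are pointwise limits of the tent functions
  \<open>max 0 (1 - real n * infdist x S)\<close>, which have values in [0, 1].\<close>

lemma AE_zero_if_continuous_integrals_zero:
  fixes g :: "'a::euclidean_space \<Rightarrow> complex"
  assumes g: "integrable lborel g"
    and F: "\<And>\<phi> :: 'a \<Rightarrow> real. continuous_on UNIV \<phi> \<Longrightarrow> (\<And>x. \<bar>\<phi> x\<bar> \<le> 1) \<Longrightarrow> (LINT x|lborel. \<phi> x *\<^sub>R g x) = 0"
  shows "AE x in lborel. g x = 0"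
proof (rule AE_zero_if_closed_integrals_zero[OF g])
  fix S :: "'a set" assume S: "closed S"
  show "(LINT x|lborel. indicator S x *\<^sub>R g x) = 0"
  \<comment> \<open>For the empty set \<open>infdist\<close> is 0 by convention, and the tents would
    be constantly 1.\<close>
  proof (cases "S = {}")
    case False
    have [measurable]: "g \<in> borel_measurable borel" using g by auto
    define \<phi> where "\<phi> n x = max 0 (1 - real n * infdist x S)" for n x
    have c: "continuous_on UNIV (\<phi> n)" for n unfolding \<phi>_def by (intro continuous_intros)
    then have [measurable]: "\<phi> n \<in> borel_measurable borel" for n by (rule borel_measurable_continuous_onI)
    have b: "\<bar>\<phi> n x\<bar> \<le> 1" for n x by (simp add: \<phi>_def infdist_nonneg)
    have lim: "(\<lambda>n. \<phi> n x) \<longlonglongrightarrow> indicator S x" for x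
    proof (cases "x \<in> S")
      case True then show ?thesis by (simp add: \<phi>_def)
    next
      case x: False
      then have d: "infdist x S > 0" using S False
        by (metis in_closed_iff_infdist_zero infdist_nonneg less_eq_real_def)
      obtain N :: nat where N: "1 / infdist x S < real N" using reals_Archimedean2 by blast
      have "\<phi> n x = 0" if "n \<ge> N" for n
      proof -
        have "1 < real N * infdist x S" using N d by (simp add: field_simps)
        also have "\<dots> \<le> real n * infdist x S" using that d by (intro mult_right_mono) auto
        finally show ?thesis by (simp add: \<phi>_def)
      qed
      then have "eventually (\<lambda>n. \<phi> n x = indicator S x) sequentially"
        using x unfolding eventually_sequentially by auto
      then show ?thesis by (rule tendsto_eventually)
    qed
    have [measurable]: "S \<in> sets borel" using S by simp
    have "(\<lambda>n. LINT x|lborel. \<phi> n x *\<^sub>R g x) \<longlonglongrightarrow> (LINT x|lborel. indicator S x *\<^sub>R g x)"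
    proof (rule integral_dominated_convergence)
      show "integrable lborel (\<lambda>x. norm (g x))" using g by simp
      show "AE x in lborel. (\<lambda>n. \<phi> n x *\<^sub>R g x) \<longlonglongrightarrow> indicator S x *\<^sub>R g x"
        by (intro AE_I2 tendsto_scaleR lim tendsto_const)
      show "AE x in lborel. norm (\<phi> n x *\<^sub>R g x) \<le> norm (g x)" for n
        using b[of n] by (intro AE_I2) (auto intro!: mult_left_le_one_le)
    qed measurable
    then show ?thesis using F[OF c b] by (simp add: LIMSEQ_const_iff)
  qed simp
qed

text \<open>A Gaussian is the Fourier transform of a Gaussian: with r = 1 / (4 s) the transform has
  exponent s, and Fubini turns the integral into a superposition of the vanishing ones.\<close>

lemma gaussian_integral_zero:
  fixes g :: "'a::euclidean_space \<Rightarrow> complex"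
  assumes g: "integrable lborel g" and z: "\<And>\<xi>. (LINT x|lborel. g x * cis (\<xi> \<bullet> x)) = 0" and s: "s > 0"
  shows "(LINT x|lborel. g x * of_real (exp (- s * ((x - y) \<bullet> (x - y))))) = 0"
proof -
  have [measurable]: "g \<in> borel_measurable borel" using g by auto
  define r where "r = 1 / (4 * s)"
  have r: "r > 0" "1 / (4 * r) = s" using s by (simp_all add: r_def)
  define E :: "'a \<Rightarrow> complex" where "E u = of_real (exp (- r * (u \<bullet> u)))" for u
  have E: "integrable lborel E"
    using integrable_gaussian_cis[OF r(1), of "0::'a"] by (simp add: E_def[abs_def])
  define \<Phi> where "\<Phi> p = g (fst p) * E (snd p) * cis ((fst p - y) \<bullet> snd p)" for p
  have [measurable]: "E \<in> borel_measurable borel" using E by auto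
  have [measurable]: "\<Phi> \<in> borel_measurable (lborel \<Otimes>\<^sub>M lborel)" unfolding \<Phi>_def by measurable
  have "integrable (lborel \<Otimes>\<^sub>M lborel) \<Phi>"
    by (rule Bochner_Integration.integrable_bound[OF integrable_pair_mult[OF g E]])
       (auto simp: \<Phi>_def norm_mult)
  then have sw: "(LINT x|lborel. LINT u|lborel. \<Phi> (x, u)) = (LINT u|lborel. LINT x|lborel. \<Phi> (x, u))"
    using lborel_pair.Fubini_integral[of "\<lambda>x u. \<Phi> (x, u)"] by simp
  have "(LINT u|lborel. \<Phi> (x, u)) = of_real (sqrt (pi / r) ^ DIM('a)) * (g x * of_real (exp (- s * ((x - y) \<bullet> (x - y)))))" for x
  proof -
    have "(LINT u|lborel. \<Phi> (x, u)) = g x * (LINT u|lborel. cis ((x - y) \<bullet> u) * of_real (exp (- r * (u \<bullet> u))))"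
      by (subst integral_mult_right_zero[symmetric]) (simp add: \<Phi>_def E_def mult_ac)
    also have "(x - y) \<bullet> (x - y) / (4 * r) = s * ((x - y) \<bullet> (x - y))"
      using r(2) by (metis mult.commute times_divide_eq_right mult.right_neutral)
    then have "(LINT u|lborel. cis ((x - y) \<bullet> u) * of_real (exp (- r * (u \<bullet> u)))) =
       of_real (sqrt (pi / r) ^ DIM('a) * exp (- s * ((x - y) \<bullet> (x - y))))"
      by (subst integral_gaussian_cis[OF r(1)]) simp
    finally show ?thesis by simp
  qed
  then have "(LINT x|lborel. LINT u|lborel. \<Phi> (x, u)) =
    of_real (sqrt (pi / r) ^ DIM('a)) * (LINT x|lborel. g x * of_real (exp (- s * ((x - y) \<bullet> (x - y)))))"
    by simp
  moreover have "(LINT x|lborel. \<Phi> (x, u)) = 0" for u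
  proof -
    have "\<Phi> (x, u) = (E u * cis (- (y \<bullet> u))) * (g x * cis (u \<bullet> x))" for x
      by (simp add: \<Phi>_def inner_diff_left inner_commute[of u] mult_ac)
         (simp add: mult.assoc[symmetric] cis_mult add.commute)
    then show ?thesis by (simp add: z)
  qed
  ultimately show ?thesis using sw r by simp
qed

text \<open>Gaussian means of \<open>g\<close> vanish, and so do its integrals against Gaussian means of continuous
  functions, which approximate the functions themselves.\<close>
lemma fourier_uniqueness:
  fixes g :: "'a::euclidean_space \<Rightarrow> complex"
  assumes g: "integrable lborel g" and z: "\<And>\<xi>. (LINT x|lborel. g x * cis (\<xi> \<bullet> x)) = 0"
  shows "AE x in lborel. g x = 0"
proof (rule AE_zero_if_continuous_integrals_zero[OF g])
  fix \<phi> :: "'a \<Rightarrow> real" assume c: "continuous_on UNIV \<phi>" and b: "\<And>x. \<bar>\<phi> x\<bar> \<le> 1"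
  have [measurable]: "\<phi> \<in> borel_measurable borel" using c by (rule borel_measurable_continuous_onI)
  have [measurable]: "g \<in> borel_measurable borel" using g by auto
  define E :: "'a \<Rightarrow> complex" where "E u = of_real (exp (- 1 * (u \<bullet> u)))" for u
  have E: "integrable lborel E"
    using integrable_gaussian_cis[of 1 "0::'a"] by (simp add: E_def[abs_def])
  have [measurable]: "E \<in> borel_measurable borel" using E by auto
  have EI: "(LINT u|lborel. E u) = of_real (sqrt pi ^ DIM('a))"
    using integral_gaussian_cis[of 1 "0::'a"] by (simp add: E_def[abs_def])
  \<comment> \<open>With y = x + r u this is, up to a power of r, the integral of g x against
    \<open>H (y - x) * \<phi> y\<close>. For r > 0 it vanishes by Fubini, and for r = 0 it is the
    wanted integral times the total mass of E.\<close>
  define \<Phi> where "\<Phi> r p = g (fst p) * E (snd p) * of_real (\<phi> (fst p + r *\<^sub>R snd p))" for r p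
  have m [measurable]: "\<Phi> r \<in> borel_measurable (lborel \<Otimes>\<^sub>M lborel)" for r unfolding \<Phi>_def by measurable
  have bd: "norm (\<Phi> r p) \<le> norm (g (fst p) * E (snd p))" for r p
    using b[of "fst p + r *\<^sub>R snd p"] by (simp add: \<Phi>_def norm_mult mult_left_le)
  have i: "integrable (lborel \<Otimes>\<^sub>M lborel) (\<Phi> r)" for r
    by (rule Bochner_Integration.integrable_bound[OF integrable_pair_mult[OF g E]]) (auto simp: bd)
  have zero: "(LINT p|(lborel \<Otimes>\<^sub>M lborel). \<Phi> r p) = 0" if r: "r > 0" for r
  proof -
    define H :: "'a \<Rightarrow> complex" where "H v = of_real (exp (- (1 / r\<^sup>2) * (v \<bullet> v)))" for v
    have r2: "1 / r\<^sup>2 > 0" using r by simp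
    have H: "integrable lborel H" using integrable_gaussian_cis[OF r2, of "0::'a"] by (simp add: H_def[abs_def])
    have [measurable]: "H \<in> borel_measurable borel" using H by auto
    have Hs: "integrable lborel (\<lambda>y. H (y - x))" for x
      using integrable_lborel_shift[OF H, of "- x"] by simp
    define \<Psi> where "\<Psi> p = g (fst p) * (H (snd p - fst p) * of_real (\<phi> (snd p)))" for p
    have [measurable]: "\<Psi> \<in> borel_measurable (lborel \<Otimes>\<^sub>M lborel)" unfolding \<Psi>_def by measurable
    have H\<phi>: "integrable lborel (\<lambda>y. H (y - x) * of_real (\<phi> y))" for x
      by (rule Bochner_Integration.integrable_bound[OF Hs[of x]])
        (auto simp: norm_mult b mult_left_le)
    have i\<Psi>: "integrable (lborel \<Otimes>\<^sub>M lborel) \<Psi>"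
    proof (rule lborel_pair.Fubini_integrable)
      show "integrable lborel (\<lambda>x. LINT y|lborel. norm (\<Psi> (x, y)))"
      proof (rule Bochner_Integration.integrable_bound)
        show "integrable lborel (\<lambda>x. norm (g x) * (LINT v|lborel. norm (H v)))" using g by simp
        show "AE x in lborel. norm (LINT y|lborel. norm (\<Psi> (x, y))) \<le> norm (norm (g x) * (LINT v|lborel. norm (H v)))"
        proof (rule AE_I2)
          fix x
          have "(LINT y|lborel. norm (H (y - x) * of_real (\<phi> y))) \<le> (LINT y|lborel. norm (H (y - x)))"
            using integrable_norm[OF H\<phi>[of x]] integrable_norm[OF Hs[of x]] by (intro integral_mono) (auto simp: norm_mult b mult_left_le)
          also have "\<dots> = (LINT v|lborel. norm (H v))"
            using integral_lborel_shift[of "\<lambda>v. norm (H v)" "- x"] by simp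
          finally have "norm (g x) * (LINT y|lborel. norm (H (y - x) * of_real (\<phi> y))) \<le> norm (g x) * (LINT v|lborel. norm (H v))"
            by (intro mult_left_mono) auto
          then show "norm (LINT y|lborel. norm (\<Psi> (x, y))) \<le> norm (norm (g x) * (LINT v|lborel. norm (H v)))"
            by (simp add: \<Psi>_def norm_mult abs_mult)
        qed
      qed measurable
      show "AE x in lborel. integrable lborel (\<lambda>y. \<Psi> (x, y))" using H\<phi> by (simp add: \<Psi>_def)
    qed measurable
    have \<Psi>\<Phi>: "\<Psi> (x, r *\<^sub>R u + x) = \<Phi> r (x, u)" for x u
      using r by (simp add: \<Psi>_def \<Phi>_def H_def E_def power2_eq_square add.commute)
    have sub: "(LINT y|lborel. \<Psi> (x, y)) = of_real (\<bar>r\<bar> ^ DIM('a)) * (LINT u|lborel. \<Phi> r (x, u))" for x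
    proof -
      have "(LINT y|lborel. \<Psi> (x, y)) = (LINT v|lborel. \<Psi> (x, v + x))"
        by (rule integral_lborel_shift[symmetric]) measurable
      also have "\<dots> = \<bar>r\<bar> ^ DIM('a) *\<^sub>R (LINT u|lborel. \<Psi> (x, r *\<^sub>R u + x))"
        using r by (intro integral_lborel_scaleR) auto
      finally show ?thesis by (simp add: \<Psi>\<Phi> scaleR_conv_of_real)
    qed
    have z0: "(LINT x|lborel. \<Psi> (x, y)) = 0" for y
    proof -
      have e: "(y - x) \<bullet> (y - x) = (x - y) \<bullet> (x - y)" for x
        by (metis inner_minus_left inner_minus_right minus_diff_eq minus_minus)
      have "(LINT x|lborel. \<Psi> (x, y)) = (LINT x|lborel. of_real (\<phi> y) * (g x * of_real (exp (- (1 / r\<^sup>2) * ((x - y) \<bullet> (x - y))))))"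
        by (simp add: \<Psi>_def H_def e mult_ac)
      also have "\<dots> = of_real (\<phi> y) * (LINT x|lborel. g x * of_real (exp (- (1 / r\<^sup>2) * ((x - y) \<bullet> (x - y)))))"
        by (rule integral_mult_right_zero)
      also have "\<dots> = 0" by (simp only: gaussian_integral_zero[OF g z r2]) simp
      finally show ?thesis .
    qed
    have "of_real (\<bar>r\<bar> ^ DIM('a)) * (LINT p|(lborel \<Otimes>\<^sub>M lborel). \<Phi> r p) = (LINT x|lborel. LINT y|lborel. \<Psi> (x, y))"
      unfolding sub using lborel_pair.integral_fst'[OF i, of r] by simp
    also have "\<dots> = (LINT y|lborel. LINT x|lborel. \<Psi> (x, y))"
      using lborel_pair.Fubini_integral[of "\<lambda>x u. \<Psi> (x, u)"] i\<Psi> by simp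
    finally have "of_real (\<bar>r\<bar> ^ DIM('a)) * (LINT p|(lborel \<Otimes>\<^sub>M lborel). \<Phi> r p) = 0" by (simp add: z0)
    then show ?thesis using r by simp
  qed
  have "(\<lambda>n. LINT p|(lborel \<Otimes>\<^sub>M lborel). \<Phi> (inverse (real (Suc n))) p) \<longlonglongrightarrow> (LINT p|(lborel \<Otimes>\<^sub>M lborel). \<Phi> 0 p)"
  proof (rule integral_dominated_convergence)
    show "integrable (lborel \<Otimes>\<^sub>M lborel) (\<lambda>p. norm (g (fst p) * E (snd p)))"
      using integrable_pair_mult[OF g E] by simp
    show "AE p in lborel \<Otimes>\<^sub>M lborel. (\<lambda>n. \<Phi> (inverse (real (Suc n))) p) \<longlonglongrightarrow> \<Phi> 0 p"
    proof (rule AE_I2)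
      fix p
      have "(\<lambda>n. \<phi> (fst p + inverse (real (Suc n)) *\<^sub>R snd p)) \<longlonglongrightarrow> \<phi> (fst p + 0 *\<^sub>R snd p)"
        using c by (intro isCont_tendsto_compose[of _ \<phi>] tendsto_intros LIMSEQ_inverse_real_of_nat)
          (simp add: continuous_on_eq_continuous_at)
      then show "(\<lambda>n. \<Phi> (inverse (real (Suc n))) p) \<longlonglongrightarrow> \<Phi> 0 p"
        unfolding \<Phi>_def by (intro tendsto_intros)
    qed
  qed (use bd in auto)
  then have "(LINT p|(lborel \<Otimes>\<^sub>M lborel). \<Phi> 0 p) = 0"
    by (simp add: zero LIMSEQ_const_iff)
  moreover have "(LINT p|(lborel \<Otimes>\<^sub>M lborel). \<Phi> 0 p) = (LINT x|lborel. LINT u|lborel. \<Phi> 0 (x, u))"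
    using lborel_pair.integral_fst'[OF i] by simp
  moreover have "\<dots> = of_real (sqrt pi ^ DIM('a)) * (LINT x|lborel. \<phi> x *\<^sub>R g x)"
  proof -
    have "(LINT u|lborel. \<Phi> 0 (x, u)) = of_real (sqrt pi ^ DIM('a)) * (\<phi> x *\<^sub>R g x)" for x
    proof -
      have "(LINT u|lborel. \<Phi> 0 (x, u)) = (g x * of_real (\<phi> x)) * (LINT u|lborel. E u)"
        by (subst integral_mult_right_zero[symmetric]) (simp add: \<Phi>_def mult_ac)
      then show ?thesis by (simp add: EI scaleR_conv_of_real)
    qed
    then show ?thesis by (simp only: integral_mult_right_zero)
  qed
  ultimately show "(LINT x|lborel. \<phi> x *\<^sub>R g x) = 0" by simp
qed

section \<open>Moments as Taylor coefficients of exponential integrals\<close>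

lemma exp_moment_sums:
  fixes W B :: "'a \<Rightarrow> complex"
  assumes [measurable]: "W \<in> borel_measurable M" "B \<in> borel_measurable M"
    and dom: "integrable M (\<lambda>w. norm (W w) * exp (norm (x * B w)))"
  shows "(\<lambda>j. x ^ j / fact j * (LINT w|M. W w * B w ^ j)) sums (LINT w|M. W w * exp (x * B w))"
proof -
  let ?f = "\<lambda>j w. W w * ((x * B w) ^ j /\<^sub>R fact j)"
  have part: "norm (\<Sum>j<n. ?f j w) \<le> norm (W w) * exp (norm (x * B w))" for n w
  proof -
    have "norm (\<Sum>j<n. ?f j w) \<le> (\<Sum>j<n. norm (?f j w))" by (rule norm_sum)
    also have "\<dots> = norm (W w) * (\<Sum>j<n. norm (x * B w) ^ j /\<^sub>R fact j)"
      by (simp add: sum_distrib_left norm_mult norm_power norm_divide divide_inverse mult_ac power_mult_distrib)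
    also have "(\<Sum>j<n. norm (x * B w) ^ j /\<^sub>R fact j) \<le> exp (norm (x * B w))"
      unfolding exp_def by (intro sum_le_suminf summable_exp_generic) auto
    finally show ?thesis by (simp add: mult_left_mono)
  qed
  have term1: "norm (?f j w) \<le> norm (W w) * exp (norm (x * B w))" for j w
  proof -
    have "(\<Sum>i\<in>{j}. norm (x * B w) ^ i /\<^sub>R fact i) \<le> exp (norm (x * B w))"
      unfolding exp_def by (intro sum_le_suminf summable_exp_generic) auto
    then have "norm (W w) * (norm (x * B w) ^ j /\<^sub>R fact j) \<le> norm (W w) * exp (norm (x * B w))"
      by (intro mult_left_mono) auto
    then show ?thesis by (simp only: norm_mult norm_scaleR norm_power) simp
  qed
  have int: "integrable M (?f j)" for j
    by (rule Bochner_Integration.integrable_bound[OF dom]) (use term1 in auto)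
  have "(\<lambda>n. LINT w|M. (\<Sum>j<n. ?f j w)) \<longlonglongrightarrow> (LINT w|M. W w * exp (x * B w))"
  proof (rule integral_dominated_convergence[OF _ _ dom])
    show "AE w in M. (\<lambda>n. \<Sum>j<n. ?f j w) \<longlonglongrightarrow> W w * exp (x * B w)"
      unfolding sum_distrib_left[symmetric]
      by (intro AE_I2 tendsto_mult tendsto_const) (rule exp_converges[unfolded sums_def])
    show "AE w in M. norm (\<Sum>j<n. ?f j w) \<le> norm (W w) * exp (norm (x * B w))" for n
      using part by simp
  qed measurable
  moreover have "(LINT w|M. (\<Sum>j<n. ?f j w)) = (\<Sum>j<n. x ^ j / fact j * (LINT w|M. W w * B w ^ j))" for n
  proof -
    have "(LINT w|M. (\<Sum>j<n. ?f j w)) = (\<Sum>j<n. LINT w|M. ?f j w)"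
      by (rule Bochner_Integration.integral_sum) (rule int)
    also have "\<dots> = (\<Sum>j<n. LINT w|M. x ^ j / fact j * (W w * B w ^ j))"
      by (intro sum.cong Bochner_Integration.integral_cong refl)
        (simp add: power_mult_distrib scaleR_conv_of_real divide_inverse)
    also have "\<dots> = (\<Sum>j<n. x ^ j / fact j * (LINT w|M. W w * B w ^ j))"
      by (simp only: integral_mult_right_zero)
    finally show ?thesis .
  qed
  ultimately show ?thesis by (simp add: sums_def)
qed

text \<open>As a function of x the integral is an entire power series whose coefficients are these
  moments, up to factorials; being identically 0, it has no nonzero coefficient.\<close>

lemma exp_moments_zero:
  fixes W B :: "'a \<Rightarrow> complex"
  assumes m: "W \<in> borel_measurable M" "B \<in> borel_measurable M"
    and dom: "\<And>x. integrable M (\<lambda>w. norm (W w) * exp (norm ((x::complex) * B w)))"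
    and z: "\<And>x. (LINT w|M. W w * exp (x * B w)) = 0"
  shows "(LINT w|M. W w * B w ^ j) = 0"
proof -
  define c where "c j = (LINT w|M. W w * B w ^ j) / fact j" for j
  have s: "(\<lambda>j. c j * x ^ j) sums 0" for x
    using exp_moment_sums[OF m dom, of x] z[of x] by (simp add: c_def mult_ac)
  have "Abs_fps c = 0"
  proof (rule eval_fps_eqD)
    have "summable (\<lambda>j. c j * x ^ j)" for x using s by (rule sums_summable)
    then show "fps_conv_radius (Abs_fps c) > 0"
      by (simp add: fps_conv_radius_def conv_radius_inftyI'')
    show "eventually (\<lambda>z. eval_fps (Abs_fps c) z = eval_fps 0 z) (nhds 0)"
      using s by (simp add: eval_fps_def sums_iff)
  qed simp
  then have "c j = 0" by (metis fps_nth_Abs_fps fps_zero_nth)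
  then show ?thesis by (simp add: c_def)
qed

section \<open>Circle integrals and Laguerre coefficients\<close>

definition circle_int :: "(complex \<Rightarrow> complex) \<Rightarrow> complex" where
  "circle_int f = (LINT t|lborel. indicator {0..<2*pi} t *\<^sub>R f (cis t))"

lemma circle_integrable:
  fixes f :: "complex \<Rightarrow> complex"
  assumes "continuous_on (sphere 0 1) f"
  shows "integrable lborel (\<lambda>t. indicator {0..<2*pi} t *\<^sub>R f (cis t))"
proof -
  have c: "continuous_on UNIV (\<lambda>t. f (cis t))"
    by (rule continuous_on_compose2[OF assms]) (auto intro!: continuous_intros)
  then have [measurable]: "(\<lambda>t. f (cis t)) \<in> borel_measurable borel" by (rule borel_measurable_continuous_onI)
  obtain C where C: "\<And>z. z \<in> sphere 0 1 \<Longrightarrow> norm (f z) \<le> C"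
    using compact_imp_bounded[OF compact_continuous_image[OF assms compact_sphere]] unfolding bounded_iff by blast
  show ?thesis
  proof (rule Bochner_Integration.integrable_bound)
    show "integrable lborel (\<lambda>t. indicator {0..<2*pi} t *\<^sub>R C)"
      by (intro integrable_scaleR_left integrable_real_indicator) auto
    show "AE t in lborel. norm (indicator {0..<2*pi} t *\<^sub>R f (cis t)) \<le> norm (indicator {0..<2*pi} t *\<^sub>R C)"
      using C by (intro AE_I2) (auto simp: indicator_def intro: order_trans[OF C])
  qed measurable
qed

lemma circle_int_sum:
  assumes "\<And>i. i \<in> A \<Longrightarrow> continuous_on (sphere 0 1) (f i)"
  shows "circle_int (\<lambda>z. \<Sum>i\<in>A. f i z) = (\<Sum>i\<in>A. circle_int (f i))"
  unfolding circle_int_def scaleR_sum_right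
  by (rule Bochner_Integration.integral_sum) (intro circle_integrable assms)

lemma circle_int_mult_left: "circle_int (\<lambda>z. c * f z) = c * circle_int f"
  unfolding circle_int_def by (subst integral_mult_right_zero[symmetric]) (simp add: mult_ac)

lemma circle_int_cong: "(\<And>z. norm z = 1 \<Longrightarrow> f z = g z) \<Longrightarrow> circle_int f = circle_int g"
  unfolding circle_int_def by (intro Bochner_Integration.integral_cong) auto

lemma circle_int_has_integral:
  assumes "continuous_on (sphere 0 1) f"
  shows "((\<lambda>t. f (cis t)) has_integral circle_int f) {0..2*pi}"
proof -
  let ?g = "\<lambda>t. f (cis t)"
  have c: "continuous_on {0..2*pi} ?g"
    by (rule continuous_on_compose2[OF assms]) (auto intro!: continuous_intros)
  have "circle_int f = (LINT t:{0..2*pi}|lborel. ?g t)"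
    unfolding circle_int_def set_lebesgue_integral_def
  proof (rule integral_cong_AE)
    have "continuous_on UNIV ?g"
      by (rule continuous_on_compose2[OF assms]) (auto intro!: continuous_intros)
    then have [measurable]: "?g \<in> borel_measurable borel" by (rule borel_measurable_continuous_onI)
    show "(\<lambda>t. indicator {0..<2*pi} t *\<^sub>R ?g t) \<in> borel_measurable lborel"
      "(\<lambda>t. indicator {0..2*pi} t *\<^sub>R ?g t) \<in> borel_measurable lborel" by measurable
    show "AE t in lborel. indicator {0..<2*pi} t *\<^sub>R ?g t = indicator {0..2*pi} t *\<^sub>R ?g t"
      using AE_lborel_singleton[of "2*pi"] by eventually_elim (auto simp: indicator_def)
  qed
  also have "\<dots> = integral {0..2*pi} ?g"
    by (rule set_borel_integral_eq_integral) (rule borel_integrable_atLeastAtMost', rule c)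
  finally show ?thesis
    using integrable_continuous_real[OF c] by (simp add: has_integral_iff)
qed

text \<open>On the unit circle dz / z = i dt, which opens the way to Cauchy's theorem.\<close>

lemma circle_int_contour:
  assumes "continuous_on (sphere 0 1) f"
  shows "((\<lambda>z. f z / z) has_contour_integral (\<i> * circle_int f)) (circlepath 0 1)"
proof -
  let ?g = "\<lambda>t. f (cis t)"
  have "(?g has_integral circle_int f) (cbox 0 (2 * pi))" using circle_int_has_integral[OF assms] by simp
  from has_integral_affinity'[OF this, of "2 * pi" 0]
  have "((\<lambda>t. ?g (2 * pi * t)) has_integral inverse (2 * pi) *\<^sub>R circle_int f) {0..1}" by simp
  then have "((\<lambda>t. (2 * pi * \<i>) * ?g (2 * pi * t)) has_integral (2 * pi * \<i>) * (inverse (2 * pi) *\<^sub>R circle_int f)) {0..1}"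
    by (rule has_integral_mult_right)
  moreover have "(2 * pi * \<i>) * (inverse (2 * pi) *\<^sub>R circle_int f) = \<i> * circle_int f"
    by (simp add: scaleR_conv_of_real)
  moreover have "(2 * pi * \<i>) * ?g (2 * pi * t) =
      f (circlepath 0 1 t) / circlepath 0 1 t * vector_derivative (circlepath 0 1) (at t)" for t
  proof -
    have 1: "cis (2 * pi * t) = exp (2 * of_real pi * \<i> * t)" by (simp add: cis_conv_exp mult_ac)
    have "circlepath 0 1 t = exp (2 * of_real pi * \<i> * t)" by (simp add: circlepath)
    then show ?thesis unfolding vector_derivative_circlepath 1 by simp
  qed
  ultimately show ?thesis unfolding has_contour_integral by simp
qed

text \<open>Cauchy's formula for the n-th derivative of \<open>exp (x * w)\<close> at 0.\<close>

lemma circle_moment_neg: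
  fixes x :: complex
  shows "circle_int (\<lambda>z. inverse z ^ n * exp (x * z)) = 2 * pi * x ^ n / fact n"
proof -
  have d: "(deriv ^^ n) (\<lambda>w. exp (x * w)) = (\<lambda>w. x ^ n * exp (x * w))"
  proof (induction n)
    case (Suc n)
    have "deriv (\<lambda>w. x ^ n * exp (x * w)) w = x ^ Suc n * exp (x * w)" for w
      by (rule DERIV_imp_deriv) (auto intro!: derivative_eq_intros)
    then show ?case by (intro ext) (simp add: Suc)
  qed simp
  have "((\<lambda>u. exp (x * u) / (u - 0) ^ Suc n) has_contour_integral (2 * pi * \<i>) / fact n * (deriv ^^ n) (\<lambda>w. exp (x * w)) 0)
      (circlepath 0 1)"
    by (rule Cauchy_has_contour_integral_higher_derivative_circlepath)
       (auto intro!: continuous_intros holomorphic_intros)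
  moreover have "((\<lambda>z. (inverse z ^ n * exp (x * z)) / z) has_contour_integral
      (\<i> * circle_int (\<lambda>z. inverse z ^ n * exp (x * z)))) (circlepath 0 1)"
    by (rule circle_int_contour) (auto intro!: continuous_intros)
  then have "((\<lambda>u. exp (x * u) / (u - 0) ^ Suc n) has_contour_integral
      (\<i> * circle_int (\<lambda>z. inverse z ^ n * exp (x * z)))) (circlepath 0 1)"
    by (rule has_contour_integral_eq) (auto simp: divide_inverse power_inverse mult_ac)
  ultimately have "\<i> * circle_int (\<lambda>z. inverse z ^ n * exp (x * z)) = (2 * pi * \<i>) / fact n * x ^ n"
    by (simp add: d has_contour_integral_unique)
  then have "\<i> * circle_int (\<lambda>z. inverse z ^ n * exp (x * z)) = \<i> * (2 * pi * x ^ n / fact n)"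
    by (simp add: field_simps)
  then show ?thesis by (metis complex_i_not_zero mult_cancel_left)
qed

lemma circle_moment_pos:
  fixes x :: complex
  shows "circle_int (\<lambda>z. z ^ Suc n * exp (x * z)) = 0"
proof -
  have "((\<lambda>z. (z ^ Suc n * exp (x * z)) / z) has_contour_integral
      (\<i> * circle_int (\<lambda>z. z ^ Suc n * exp (x * z)))) (circlepath 0 1)"
    by (rule circle_int_contour) (auto intro!: continuous_intros)
  then have "((\<lambda>z. z ^ n * exp (x * z)) has_contour_integral
      (\<i> * circle_int (\<lambda>z. z ^ Suc n * exp (x * z)))) (circlepath 0 1)"
    by (rule has_contour_integral_eq) auto
  moreover have "((\<lambda>z. z ^ n * exp (x * z)) has_contour_integral 0) (circlepath 0 1)"
    by (rule Cauchy_theorem_convex_simple[of _ UNIV]) (auto intro!: holomorphic_intros)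
  ultimately show ?thesis by (metis complex_i_not_zero has_contour_integral_unique mult_eq_0_iff)
qed

text \<open>For p \<le> b this is 2 pi (-1)^p L_d^(p)(k) with d = b - p, a generalized Laguerre
  polynomial at the integer k. For p > b the sum is empty and the value 0, which makes the truncated
  exponent \<open>b - p\<close> in \<open>circle_laguerre\<close> harmless.\<close>

definition laguerre_coef :: "nat \<Rightarrow> nat \<Rightarrow> nat \<Rightarrow> complex" where
  "laguerre_coef k p b = 2 * pi * (\<Sum>j=p..b. of_nat (b choose j) * (-1) ^ j * of_nat k ^ (j - p) / fact (j - p))"

text \<open>After expansion of the b-th power, the term with z^(p - j) has integral 0 if p > j and
  otherwise picks one Taylor coefficient of the exponential.\<close>

lemma circle_laguerre:
  "circle_int (\<lambda>z. z ^ p * (X - inverse z) ^ b * exp (of_nat k * X * z)) = laguerre_coef k p b * X ^ (b - p)"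
proof -
  let ?c = "of_nat k :: complex"
  have "circle_int (\<lambda>z. z ^ p * (X - inverse z) ^ b * exp (?c * X * z)) =
    circle_int (\<lambda>z. \<Sum>j\<le>b. (of_nat (b choose j) * (-1) ^ j * X ^ (b - j)) * (z ^ p * inverse z ^ j * exp (?c * X * z)))"
  proof (rule circle_int_cong)
    fix z
    have "(X - inverse z) ^ b = (- inverse z + X) ^ b" by simp
    also have "\<dots> = (\<Sum>j\<le>b. of_nat (b choose j) * (- inverse z) ^ j * X ^ (b - j))" by (rule binomial_ring)
    also have "\<dots> = (\<Sum>j\<le>b. of_nat (b choose j) * ((-1) ^ j * inverse z ^ j) * X ^ (b - j))"
      by (simp add: power_minus[of "inverse z"])
    finally show "z ^ p * (X - inverse z) ^ b * exp (?c * X * z) =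
      (\<Sum>j\<le>b. (of_nat (b choose j) * (-1) ^ j * X ^ (b - j)) * (z ^ p * inverse z ^ j * exp (?c * X * z)))"
      by (simp add: sum_distrib_left sum_distrib_right mult_ac)
  qed
  also have "\<dots> = (\<Sum>j\<le>b. circle_int (\<lambda>z. (of_nat (b choose j) * (-1) ^ j * X ^ (b - j)) * (z ^ p * inverse z ^ j * exp (?c * X * z))))"
    by (rule circle_int_sum) (auto intro!: continuous_intros)
  also have "\<dots> = (\<Sum>j\<le>b. (of_nat (b choose j) * (-1) ^ j * X ^ (b - j)) * circle_int (\<lambda>z. z ^ p * inverse z ^ j * exp (?c * X * z)))"
    by (simp only: circle_int_mult_left)
  also have "\<dots> = (\<Sum>j\<le>b. if j \<in> {p..b} then 2 * pi * (of_nat (b choose j) * (-1) ^ j * ?c ^ (j - p) / fact (j - p)) * X ^ (b - p) else 0)"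
  proof (rule sum.cong[OF refl])
    fix j assume j: "j \<in> {..b}"
    show "(of_nat (b choose j) * (-1) ^ j * X ^ (b - j)) * circle_int (\<lambda>z. z ^ p * inverse z ^ j * exp (?c * X * z)) =
      (if j \<in> {p..b} then 2 * pi * (of_nat (b choose j) * (-1) ^ j * ?c ^ (j - p) / fact (j - p)) * X ^ (b - p) else 0)"
    proof (cases "p \<le> j")
      case True
      have "circle_int (\<lambda>z. z ^ p * inverse z ^ j * exp (?c * X * z)) = circle_int (\<lambda>z. inverse z ^ (j - p) * exp (?c * X * z))"
      proof (rule circle_int_cong)
        fix z :: complex assume "norm z = 1"
        then have "z \<noteq> 0" by auto
        moreover have "inverse z ^ j = inverse z ^ p * inverse z ^ (j - p)" using True by (simp flip: power_add)
        ultimately show "z ^ p * inverse z ^ j * exp (?c * X * z) = inverse z ^ (j - p) * exp (?c * X * z)"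
          by (simp add: power_mult_distrib[symmetric] mult.assoc[symmetric])
      qed
      also have "\<dots> = 2 * pi * (?c * X) ^ (j - p) / fact (j - p)" by (rule circle_moment_neg)
      finally have "X ^ (b - j) * circle_int (\<lambda>z. z ^ p * inverse z ^ j * exp (?c * X * z)) =
        2 * pi * (X ^ (b - j) * X ^ (j - p)) * ?c ^ (j - p) / fact (j - p)"
        by (simp add: power_mult_distrib)
      also have "X ^ (b - j) * X ^ (j - p) = X ^ (b - p)" using True j by (simp flip: power_add)
      finally show ?thesis using True j by (simp add: mult_ac)
    next
      case False
      then obtain i where i: "p = j + Suc i" by (metis add_Suc_right less_imp_Suc_add not_le)
      have "circle_int (\<lambda>z. z ^ p * inverse z ^ j * exp (?c * X * z)) = circle_int (\<lambda>z. z ^ Suc i * exp (?c * X * z))"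
      proof (rule circle_int_cong)
        fix z :: complex assume "norm z = 1"
        then have "z \<noteq> 0" by auto
        then show "z ^ p * inverse z ^ j * exp (?c * X * z) = z ^ Suc i * exp (?c * X * z)"
          unfolding i by (simp add: power_add power_inverse)
      qed
      then show ?thesis using False by (simp add: circle_moment_pos del: power_Suc)
    qed
  qed
  also have "\<dots> = (\<Sum>j\<in>{..b} \<inter> {p..b}. 2 * pi * (of_nat (b choose j) * (-1) ^ j * ?c ^ (j - p) / fact (j - p)) * X ^ (b - p))"
    by (rule sum.inter_restrict[symmetric]) simp
  also have "{..b} \<inter> {p..b} = {p..b}" by auto
  finally show ?thesis by (simp add: laguerre_coef_def sum_distrib_left sum_distrib_right)
qed

text \<open>Laguerre degree 0: a single term, nonzero whatever the parity of k.
  \<open>circle_null_plane_gaussian\<close> rests on this.\<close>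

lemma laguerre_coef_self: "laguerre_coef k k k \<noteq> 0"
  by (simp add: laguerre_coef_def)

text \<open>Up to the factor \<open>\<plusminus>2\<pi>/j!\<close>, the coefficient is the integer \<open>j! L\<^sub>j\<^sup>(\<^sup>k\<^sup>)(k)\<close>, which is odd for odd \<open>k\<close>: the
  terms below the leading one contain \<open>j (j + k)\<close> or a product of two consecutive integers.\<close>
lemma laguerre_coef_odd:
  assumes k: "odd k"
  shows "laguerre_coef k k (j + k) \<noteq> 0"
proof -
  define N :: "nat \<Rightarrow> nat" where "N l = fact (j + k) div fact (k + l)" for l
  define T :: int where "T = (\<Sum>l\<le>j. int ((j choose l) * N l) * (-1) ^ (k + l) * int k ^ l)"
  have ev: "even ((j choose l) * N l)" if l: "l < j" for l
  \<comment> \<open>In the first case the coefficient is \<open>j * (j + k)\<close>; as k is odd,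
    one of the two factors is even.\<close>
  proof (cases "Suc l = j")
    case True
    have "fact (j + k) = (j + k) * fact (k + l)" using True by (metis add.commute add_Suc fact_Suc of_nat_id)
    then have "N l = j + k" by (simp add: N_def)
    moreover have "j choose l = j" using True by (metis binomial_Suc_n)
    ultimately show ?thesis using k by auto
  next
    case False
    then obtain i where i: "j = Suc (Suc (l + i))" using l by (metis Suc_lessI less_imp_Suc_add add_Suc add_Suc_right)
    have "(fact (k + l) :: nat) dvd fact (k + l + i)" by (intro fact_dvd) simp
    then obtain M where M: "fact (k + l + i) = fact (k + l) * (M :: nat)" by (elim dvdE)
    have "fact (j + k) = Suc (Suc (k + l + i)) * (Suc (k + l + i) * (fact (k + l + i) :: nat))"
      unfolding i by (metis add.assoc add.commute add_Suc fact_Suc of_nat_id)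
    then have "fact (j + k) = fact (k + l) * ((Suc (Suc (k + l + i)) * Suc (k + l + i)) * M)"
      by (simp only: M mult_ac)
    then have "N l = (Suc (Suc (k + l + i)) * Suc (k + l + i)) * M"
      unfolding N_def by (simp only: nonzero_mult_div_cancel_left[OF fact_nonzero])
    then show ?thesis by simp
  qed
  \<comment> \<open>The coefficient at l = j is 1, so T has the parity of a power of k.\<close>
  have "T = (\<Sum>l<j. int ((j choose l) * N l) * (-1) ^ (k + l) * int k ^ l) + (-1) ^ (k + j) * int k ^ j"
    unfolding T_def by (simp add: lessThan_Suc_atMost[symmetric] N_def add.commute)
  moreover have "even (\<Sum>l<j. int ((j choose l) * N l) * (-1) ^ (k + l) * int k ^ l)"
    using ev by (intro dvd_sum dvd_mult2) (simp only: even_of_nat lessThan_iff)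
  ultimately have "odd T" using k by simp
  then have T: "T \<noteq> 0" by auto
  have term1: "fact j * (of_nat (j + k choose (l + k)) / fact l) = (of_nat ((j choose l) * N l) :: complex)" if "l \<le> j" for l
  proof -
    have "(fact (k + l) :: nat) dvd fact (j + k)" using that by (intro fact_dvd) simp
    then have "(fact (j + k) :: nat) = fact (k + l) * N l" by (simp add: N_def)
    then have "(of_nat (fact (j + k)) :: complex) = of_nat (fact (k + l) * N l)" by (simp only:)
    then have "of_nat (N l) = (fact (j + k) / fact (k + l) :: complex)"
      by (simp add: field_simps)
    then show ?thesis
      using that by (simp add: binomial_fact add.commute field_simps)
  qed
  have "fact j * (\<Sum>i=k..j+k. of_nat (j + k choose i) * (-1) ^ i * of_nat k ^ (i - k) / fact (i - k)) =
    (\<Sum>l\<le>j. (fact j * (of_nat (j + k choose (l + k)) / fact l)) * (-1) ^ (l + k) * of_nat k ^ l :: complex)"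
  proof -
    have "(\<Sum>i=0+k..j+k. of_nat (j + k choose i) * (-1) ^ i * of_nat k ^ (i - k) / fact (i - k) :: complex) =
      (\<Sum>l=0..j. of_nat (j + k choose (l + k)) * (-1) ^ (l + k) * of_nat k ^ l / fact l)"
      by (subst sum.shift_bounds_cl_nat_ivl) simp
    then show ?thesis by (simp add: sum_distrib_left atLeast0AtMost mult_ac)
  qed
  also have "\<dots> = of_int T"
    unfolding T_def of_int_sum by (intro sum.cong refl) (subst term1; simp add: add.commute)
  finally show ?thesis using T by (auto simp: laguerre_coef_def)
qed

section \<open>A single direction\<close>

text \<open>The twisted convolution of \<open>g\<close> with the measure \<open>z\<^sup>k\<close> on the circle \<open>E z\<close>, \<open>|z| = 1\<close>, vanishes; the phase
  of the twist is \<open>\<theta>\<close>.\<close>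
definition circle_null :: "('v::euclidean_space \<Rightarrow> complex) \<Rightarrow> (complex \<Rightarrow> 'v) \<Rightarrow> ('v \<Rightarrow> complex \<Rightarrow> real) \<Rightarrow> nat \<Rightarrow> bool" where
  "circle_null g E \<theta> k \<longleftrightarrow> (\<forall>\<psi> C. \<psi> \<in> borel_measurable borel \<longrightarrow> (\<forall>x. norm (\<psi> x) \<le> C) \<longrightarrow>
     (LINT w|lborel. g w * circle_int (\<lambda>z. \<psi> (w - E z) * (z ^ k * cis (\<theta> w z)))) = 0)"

lemma circle_nullD:
  assumes "circle_null g E \<theta> k" "\<psi> \<in> borel_measurable borel" "\<And>x. norm (\<psi> x) \<le> C"
  shows "(LINT w|lborel. g w * circle_int (\<lambda>z. \<psi> (w - E z) * (z ^ k * cis (\<theta> w z)))) = 0"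
  using assms unfolding circle_null_def by blast

section \<open>Bounds for powers and exponentials times Gaussians\<close>

lemma cnj_measurable [measurable]:
  "f \<in> borel_measurable M \<Longrightarrow> (\<lambda>x. cnj (f x)) \<in> borel_measurable M"
  by (erule borel_measurable_continuous_on[rotated]) (intro continuous_intros)

lemma power_le_fact_exp:
  fixes r :: real
  assumes "0 \<le> r"
  shows "r ^ n \<le> fact n * exp r"
proof -
  have "(\<Sum>i\<in>{n}. r ^ i /\<^sub>R fact i) \<le> exp r"
    unfolding exp_def using assms by (intro sum_le_suminf summable_exp_generic) auto
  then show ?thesis by (simp add: field_simps)
qed

lemma exp_linear_gaussian_le:
  fixes c :: real
  assumes "c > 0"
  shows "exp (A * r) * exp (- c * r\<^sup>2) \<le> exp (A\<^sup>2 / (4 * c))"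
proof -
  have "0 \<le> c * (r - A / (2 * c))\<^sup>2" using assms by simp
  also have "\<dots> = c * r\<^sup>2 - A * r + A\<^sup>2 / (4 * c)" using assms by (simp add: power2_eq_square field_simps)
  finally show ?thesis by (simp flip: exp_add)
qed

lemma power_gaussian_le:
  fixes c :: real
  assumes "c > 0" "0 \<le> r"
  shows "r ^ n * exp (A * r) * exp (- c * r\<^sup>2) \<le> fact n * exp ((A + 1)\<^sup>2 / (4 * c))"
proof -
  have "r ^ n * exp (A * r) * exp (- c * r\<^sup>2) \<le> (fact n * exp r) * exp (A * r) * exp (- c * r\<^sup>2)"
    by (intro mult_right_mono power_le_fact_exp assms) auto
  also have "\<dots> = fact n * (exp ((A + 1) * r) * exp (- c * r\<^sup>2))" by (simp add: algebra_simps exp_add)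
  also have "\<dots> \<le> fact n * exp ((A + 1)\<^sup>2 / (4 * c))"
    by (intro mult_left_mono exp_linear_gaussian_le assms) auto
  finally show ?thesis .
qed

text \<open>On the unit circle |\<zeta> - z|^2 = |\<zeta>|^2 + 1 - 2 Re (cnj \<zeta> z). With
  exponent k/2 the Gaussian contributes the real part and the twist the imaginary part of k cnj
  \<zeta> z, so together they are holomorphic in z. This ties the width of the Gaussian in the plane
  to the frequency k and makes residues applicable.\<close>

lemma gaussian_circle_shift:
  assumes "norm z = 1"
  shows "of_real (exp (- (real k / 2) * (norm (\<zeta> - z))\<^sup>2)) * cis (real k * Im (cnj \<zeta> * z)) =
    of_real (exp (- (real k / 2)) * exp (- (real k / 2) * (norm \<zeta>)\<^sup>2)) * exp (of_nat k * cnj \<zeta> * z)"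
proof -
  have n: "(norm (\<zeta> - z))\<^sup>2 = (norm \<zeta>)\<^sup>2 + 1 - 2 * Re (cnj \<zeta> * z)"
  proof -
    have "(norm (\<zeta> - z))\<^sup>2 = (norm \<zeta>)\<^sup>2 + (norm z)\<^sup>2 - 2 * Re (cnj \<zeta> * z)"
      unfolding cmod_power2 by (simp add: power2_eq_square algebra_simps)
    then show ?thesis using assms by simp
  qed
  have "exp (of_nat k * cnj \<zeta> * z) = of_real (exp (real k * Re (cnj \<zeta> * z))) * cis (real k * Im (cnj \<zeta> * z))"
    by (subst exp_eq_polar) (simp add: mult.assoc)
  moreover have "exp (- (real k / 2) * (norm (\<zeta> - z))\<^sup>2) =
      exp (- (real k / 2)) * exp (- (real k / 2) * (norm \<zeta>)\<^sup>2) * exp (real k * Re (cnj \<zeta> * z))"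
    unfolding n by (simp add: algebra_simps flip: exp_add)
  ultimately show ?thesis by simp
qed

lemma integrable_bounded_mult:
  fixes g F :: "'v::euclidean_space \<Rightarrow> complex"
  assumes g: "integrable lborel g" and F: "F \<in> borel_measurable borel" "\<And>x. norm (F x) \<le> C"
  shows "integrable lborel (\<lambda>x. g x * F x)"
proof (rule Bochner_Integration.integrable_bound)
  show "integrable lborel (\<lambda>x. g x * of_real C)" using g by simp
  have "0 \<le> C" using F(2)[of 0] norm_ge_zero order_trans by blast
  then show "AE x in lborel. norm (g x * F x) \<le> norm (g x * of_real C)"
    using F(2) by (intro AE_I2) (auto simp: norm_mult intro!: mult_left_mono)
  show "(\<lambda>x. g x * F x) \<in> borel_measurable lborel" using g F(1) by simp
qed

text \<open>Testing with \<open>U \<xi> a (k + j)\<close> gives one linear relation between the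
  moments \<open>M \<xi> (a - i) (j - i)\<close>. The unknown with i = 0 carries a Laguerre value
  that is nonzero for odd k, all others have smaller a, so induction on a kills every moment. The
  moments determine the Fourier transform of g times a Gaussian in the plane.\<close>

lemma circle_null_odd:
  fixes g :: "'v::euclidean_space \<Rightarrow> complex" and \<zeta> :: "'v \<Rightarrow> complex"
  assumes g: "integrable lborel g" and lz: "linear \<zeta>" and lE: "linear E" and \<zeta>E: "\<And>z. \<zeta> (E z) = z"
    and \<theta>: "\<And>w z. \<theta> w z = real k * Im (cnj (\<zeta> w) * z)" and k: "odd k" and null: "circle_null g E \<theta> k"
  shows "AE x in lborel. g x = 0"
proof -
  interpret z: linear \<zeta> by fact
  interpret E: linear E by fact
  have k0: "real k / 2 > 0" using k by (auto intro: odd_pos)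
  have [continuous_intros]: "continuous_on S f \<Longrightarrow> continuous_on S (\<lambda>x. \<zeta> (f x))" for S and f :: "'v \<Rightarrow> 'v"
    by (rule linear_continuous_on_compose[OF _ lz])
  have [continuous_intros]: "continuous_on S f \<Longrightarrow> continuous_on S (\<lambda>x. E (f x))" for S and f :: "'v \<Rightarrow> complex"
    by (rule linear_continuous_on_compose[OF _ lE])
  define G :: "'v \<Rightarrow> complex" where "G w = of_real (exp (- (real k / 2) * (norm (\<zeta> w))\<^sup>2))" for w
  \<comment> \<open>\<open>w - E (\<zeta> w)\<close> lies in the kernel of \<zeta>, so this
    character does not see translations along the plane; it carries the remaining directions through
    the argument.\<close>
  define Q where "Q \<xi> w = cis (\<xi> \<bullet> (w - E (\<zeta> w)))" for \<xi> w
  define U where "U \<xi> a j w = \<zeta> w ^ a * cnj (\<zeta> w) ^ j * (G w * Q \<xi> w)" for \<xi> a j w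
  have m\<zeta> [measurable]: "\<zeta> \<in> borel_measurable borel"
    by (intro borel_measurable_continuous_onI continuous_intros)
  have mQ [measurable]: "Q \<xi> \<in> borel_measurable borel" for \<xi>
    unfolding Q_def by (intro borel_measurable_continuous_onI continuous_intros)
  have mG [measurable]: "G \<in> borel_measurable borel" unfolding G_def by measurable
  have mU [measurable]: "U \<xi> a j \<in> borel_measurable borel" for \<xi> a j
    unfolding U_def G_def Q_def by (intro borel_measurable_continuous_onI continuous_intros)
  have nU: "norm (U \<xi> a j w) \<le> fact (a + j) * exp (1 / (4 * (real k / 2)))" for \<xi> a j w
  proof -
    have "norm (U \<xi> a j w) = norm (\<zeta> w) ^ (a + j) * exp (0 * norm (\<zeta> w)) * exp (- (real k / 2) * (norm (\<zeta> w))\<^sup>2)"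
      by (simp add: U_def G_def Q_def norm_mult norm_power power_add)
    also have "\<dots> \<le> fact (a + j) * exp ((0 + 1)\<^sup>2 / (4 * (real k / 2)))"
      by (rule power_gaussian_le[OF k0]) simp
    finally show ?thesis by simp
  qed
  have iU: "integrable lborel (\<lambda>w. g w * U \<xi> a j w)" for \<xi> a j
    by (rule integrable_bounded_mult[OF g mU nU])
  define M where "M \<xi> a j = (LINT w|lborel. g w * U \<xi> a j w)" for \<xi> a j
  \<comment> \<open>The degree \<open>k + j\<close> in \<open>cnj (\<zeta> w)\<close> supplies the k
    factors \<open>inverse z\<close> that absorb \<open>z ^ k\<close>. For i > j the truncated index
    \<open>j - i\<close> comes with a zero coefficient.\<close>
  have rec: "(\<Sum>i\<le>a. (of_nat (a choose i) * (-1) ^ i * laguerre_coef k (k + i) (k + j)) * M \<xi> (a - i) (j - i)) = 0" for \<xi> a j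
  proof -
    have "circle_int (\<lambda>z. U \<xi> a (k + j) (w - E z) * (z ^ k * cis (\<theta> w z))) =
      of_real (exp (- (real k / 2))) * (\<Sum>i\<le>a. (of_nat (a choose i) * (-1) ^ i * laguerre_coef k (k + i) (k + j)) * U \<xi> (a - i) (j - i) w)" for w
    proof -
      let ?X = "cnj (\<zeta> w)"
      have "circle_int (\<lambda>z. U \<xi> a (k + j) (w - E z) * (z ^ k * cis (\<theta> w z))) =
        circle_int (\<lambda>z. \<Sum>i\<le>a. (of_real (exp (- (real k / 2))) * G w * Q \<xi> w * of_nat (a choose i) * (-1) ^ i * \<zeta> w ^ (a - i)) *
          (z ^ (k + i) * (?X - inverse z) ^ (k + j) * exp (of_nat k * ?X * z)))"
      proof (rule circle_int_cong)
        fix z :: complex assume z: "norm z = 1"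
        have Qw: "Q \<xi> (w - E z) = Q \<xi> w"
          by (simp add: Q_def z.diff \<zeta>E E.diff)
        have Gw: "G (w - E z) * cis (\<theta> w z) = of_real (exp (- (real k / 2))) * G w * exp (of_nat k * ?X * z)"
          using gaussian_circle_shift[OF z, of k "\<zeta> w"] by (simp add: G_def z.diff \<zeta>E \<theta>)
        have zi: "cnj z = inverse z" 
          by (intro inverse_unique[symmetric]) (use z in \<open>simp add: complex_norm_square[symmetric]\<close>)
        have "(\<zeta> w - z) ^ a = (- z + \<zeta> w) ^ a" by simp
        also have "\<dots> = (\<Sum>i\<le>a. of_nat (a choose i) * (- z) ^ i * \<zeta> w ^ (a - i))" by (rule binomial_ring)
        also have "\<dots> = (\<Sum>i\<le>a. of_nat (a choose i) * ((-1) ^ i * z ^ i) * \<zeta> w ^ (a - i))"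
          by (simp add: power_minus[of z])
        finally have b: "(\<zeta> w - z) ^ a = (\<Sum>i\<le>a. of_nat (a choose i) * ((-1) ^ i * z ^ i) * \<zeta> w ^ (a - i))" .
        have "U \<xi> a (k + j) (w - E z) * (z ^ k * cis (\<theta> w z)) =
          (\<zeta> w - z) ^ a * ((?X - inverse z) ^ (k + j) * Q \<xi> w * z ^ k * (G (w - E z) * cis (\<theta> w z)))"
          by (simp add: U_def z.diff \<zeta>E Qw zi mult_ac)
        also have "\<dots> = (\<Sum>i\<le>a. (of_real (exp (- (real k / 2))) * G w * Q \<xi> w * of_nat (a choose i) * (-1) ^ i * \<zeta> w ^ (a - i)) *
          (z ^ (k + i) * (?X - inverse z) ^ (k + j) * exp (of_nat k * ?X * z)))"
          unfolding b Gw sum_distrib_right by (intro sum.cong refl) (simp add: power_add mult_ac)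
        finally show "U \<xi> a (k + j) (w - E z) * (z ^ k * cis (\<theta> w z)) =
          (\<Sum>i\<le>a. (of_real (exp (- (real k / 2))) * G w * Q \<xi> w * of_nat (a choose i) * (-1) ^ i * \<zeta> w ^ (a - i)) *
          (z ^ (k + i) * (?X - inverse z) ^ (k + j) * exp (of_nat k * ?X * z)))" .
      qed
      also have "\<dots> = (\<Sum>i\<le>a. (of_real (exp (- (real k / 2))) * G w * Q \<xi> w * of_nat (a choose i) * (-1) ^ i * \<zeta> w ^ (a - i)) *
          (laguerre_coef k (k + i) (k + j) * ?X ^ (j - i)))"
        by (subst circle_int_sum) (auto simp: circle_int_mult_left circle_laguerre intro!: continuous_intros)
      also have "\<dots> = of_real (exp (- (real k / 2))) * (\<Sum>i\<le>a. (of_nat (a choose i) * (-1) ^ i * laguerre_coef k (k + i) (k + j)) * U \<xi> (a - i) (j - i) w)"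
        unfolding sum_distrib_left U_def by (intro sum.cong refl) (simp add: mult_ac)
      finally show ?thesis .
    qed
    moreover have "(LINT w|lborel. g w * circle_int (\<lambda>z. U \<xi> a (k + j) (w - E z) * (z ^ k * cis (\<theta> w z)))) = 0"
      by (rule circle_nullD[OF null mU nU])
    ultimately have "0 = (LINT w|lborel. g w * (of_real (exp (- (real k / 2))) *
        (\<Sum>i\<le>a. (of_nat (a choose i) * (-1) ^ i * laguerre_coef k (k + i) (k + j)) * U \<xi> (a - i) (j - i) w)))"
      by (simp only:)
    also have "\<dots> = (LINT w|lborel. of_real (exp (- (real k / 2))) *
        (\<Sum>i\<le>a. (of_nat (a choose i) * (-1) ^ i * laguerre_coef k (k + i) (k + j)) * (g w * U \<xi> (a - i) (j - i) w)))"
      by (simp add: sum_distrib_left mult_ac)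
    also have "\<dots> = of_real (exp (- (real k / 2))) *
        (\<Sum>i\<le>a. (of_nat (a choose i) * (-1) ^ i * laguerre_coef k (k + i) (k + j)) * M \<xi> (a - i) (j - i))"
      unfolding M_def integral_mult_right_zero
      by (subst Bochner_Integration.integral_sum) (auto intro!: integrable_mult_right iU)
    finally show ?thesis by simp
  qed
  have M0: "M \<xi> a j = 0" for \<xi> a j
  proof (induction a arbitrary: j rule: less_induct)
    case (less a)
    have "(\<Sum>i\<le>a. (of_nat (a choose i) * (-1) ^ i * laguerre_coef k (k + i) (k + j)) * M \<xi> (a - i) (j - i)) =
      laguerre_coef k k (k + j) * M \<xi> a j"
      by (subst sum.remove[of _ 0]) (auto intro!: sum.neutral less)
    then show ?case using rec[of a j \<xi>] laguerre_coef_odd[OF k, of j] by (simp add: add.commute)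
  qed
  have "AE w in lborel. g w * G w = 0"
  proof (rule fourier_uniqueness)
    have "norm (G w) \<le> 1" for w by (simp add: G_def)
    then show "integrable lborel (\<lambda>w. g w * G w)" by (rule integrable_bounded_mult[OF g mG])
    fix \<xi> :: 'v
    define \<beta> where "\<beta> = Complex (\<xi> \<bullet> E 1) (\<xi> \<bullet> E \<i>)"
    have \<xi>E: "\<xi> \<bullet> E z = Re (cnj \<beta> * z)" for z
    proof -
      have "E z = E (Re z *\<^sub>R 1 + Im z *\<^sub>R \<i>)" by (simp add: scaleR_conv_of_real complex_eq[symmetric] mult.commute)
      then show ?thesis by (simp add: E.add E.scaleR \<beta>_def inner_add_right mult.commute)
    qed
    \<comment> \<open>The part of \<open>\<xi> \<bullet> w\<close> along the plane, written in
      \<zeta> and its conjugate so that its powers are combinations of the monomials in U.\<close>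
    define B where "B w = (cnj \<beta> * \<zeta> w + \<beta> * cnj (\<zeta> w)) / 2" for w
    have Bre: "B w = of_real (\<xi> \<bullet> E (\<zeta> w))" for w
      unfolding \<xi>E B_def by (simp add: complex_eq_iff)
    have [measurable]: "B \<in> borel_measurable borel"
      unfolding B_def by (intro borel_measurable_continuous_onI continuous_intros) auto
    have [measurable]: "g \<in> borel_measurable borel" using g by auto
    have mom: "(LINT w|lborel. (g w * U \<xi> 0 0 w) * B w ^ j) = 0" for j
    proof -
      have "(g w * U \<xi> 0 0 w) * B w ^ j = (\<Sum>i\<le>j. (of_nat (j choose i) * cnj \<beta> ^ i * \<beta> ^ (j - i) / 2 ^ j) * (g w * U \<xi> i (j - i) w))" for w
        unfolding B_def power_divide binomial_ring
        by (simp add: U_def sum_distrib_left sum_divide_distrib power_mult_distrib mult_ac)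
      then have "(LINT w|lborel. (g w * U \<xi> 0 0 w) * B w ^ j) =
        (\<Sum>i\<le>j. (of_nat (j choose i) * cnj \<beta> ^ i * \<beta> ^ (j - i) / 2 ^ j) * M \<xi> i (j - i))"
        by (simp only: M_def) (subst Bochner_Integration.integral_sum; auto intro!: integrable_mult_right iU)
      then show ?thesis by (simp add: M0)
    qed
    have "(\<lambda>j. \<i> ^ j / fact j * (LINT w|lborel. (g w * U \<xi> 0 0 w) * B w ^ j)) sums (LINT w|lborel. (g w * U \<xi> 0 0 w) * exp (\<i> * B w))"
    proof (rule exp_moment_sums)
      have "integrable lborel (\<lambda>w. g w * (U \<xi> 0 0 w * of_real (exp (norm (\<i> * B w)))))"
      proof (rule integrable_bounded_mult[OF g])
        fix w
        have "norm (B w) \<le> norm \<beta> * norm (\<zeta> w)"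
          unfolding Bre \<xi>E norm_of_real by (metis abs_Re_le_cmod complex_mod_cnj norm_mult)
        then have "norm (U \<xi> 0 0 w * of_real (exp (norm (\<i> * B w)))) \<le> norm (\<zeta> w) ^ 0 * exp (norm \<beta> * norm (\<zeta> w)) * exp (- (real k / 2) * (norm (\<zeta> w))\<^sup>2)"
          by (simp add: U_def G_def Q_def norm_mult)
        also have "\<dots> \<le> fact 0 * exp ((norm \<beta> + 1)\<^sup>2 / (4 * (real k / 2)))"
          by (rule power_gaussian_le[OF k0]) simp
        finally show "norm (U \<xi> 0 0 w * of_real (exp (norm (\<i> * B w)))) \<le> fact 0 * exp ((norm \<beta> + 1)\<^sup>2 / (4 * (real k / 2)))" .
      qed measurable
      then have "integrable lborel (\<lambda>w. norm (g w * (U \<xi> 0 0 w * of_real (exp (norm (\<i> * B w))))))" by (rule integrable_norm)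
      then show "integrable lborel (\<lambda>w. norm (g w * U \<xi> 0 0 w) * exp (norm (\<i> * B w)))"
        by (simp add: norm_mult mult_ac)
    qed measurable
    then have "(LINT w|lborel. (g w * U \<xi> 0 0 w) * exp (\<i> * B w)) = 0"
      by (simp add: mom sums_iff)
    moreover have "(g w * U \<xi> 0 0 w) * exp (\<i> * B w) = g w * G w * cis (\<xi> \<bullet> w)" for w
    proof -
      have "exp (\<i> * B w) = cis (\<xi> \<bullet> E (\<zeta> w))" by (simp add: Bre cis_conv_exp)
      then show ?thesis by (simp add: U_def Q_def mult.assoc cis_mult flip: inner_add_right)
    qed
    ultimately show "(LINT w|lborel. g w * G w * cis (\<xi> \<bullet> w)) = 0" by simp
  qed
  then show ?thesis by (simp add: G_def)
qed

text \<open>This is 2 pi J_0(|u|) for the Bessel function J_0.\<close>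

definition bessel_circle :: "complex \<Rightarrow> complex" where
  "bessel_circle u = circle_int (\<lambda>z. cis (Re (cnj u * z)))"

lemma bessel_circle_measurable [measurable]: "bessel_circle \<in> borel_measurable borel"
proof -
  have "(\<lambda>u. LINT t|lborel. (\<lambda>p. indicator {0..<2*pi} (snd p) *\<^sub>R cis (Re (cnj (fst p) * cis (snd p)))) (u, t)) \<in> borel_measurable borel"
    by (intro lborel.borel_measurable_lebesgue_integral) measurable
  then show ?thesis by (simp add: bessel_circle_def[abs_def] circle_int_def)
qed

text \<open>The integral extends to an entire function of a complex variable in place of t, which is
  not identically zero, so its zeros are countable.\<close>

lemma bessel_circle_zeros_countable: "countable {t::real. bessel_circle (u + of_real t) = 0}"
proof -
  define h where "h \<tau> z = exp (\<i> * ((of_real (Re u) + \<tau>) * of_real (Re z) + of_real (Im u * Im z)))" for \<tau> z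
  define F where "F \<tau> = circle_int (h \<tau>)" for \<tau>
  have c: "continuous_on UNIV (\<lambda>t. h \<tau> (cis t))" for \<tau>
    unfolding h_def by (intro continuous_intros)
  have F: "F \<tau> = integral {0..2*pi} (\<lambda>t. h \<tau> (cis t))" for \<tau>
  proof -
    have "continuous_on (sphere 0 1) (h \<tau>)" unfolding h_def by (intro continuous_intros)
    from circle_int_has_integral[OF this] show ?thesis by (simp add: F_def integral_unique)
  qed
  have hol: "F holomorphic_on UNIV"
    unfolding F
  proof (subst interval_cbox, rule leibniz_rule_holomorphic)
    fix \<tau> :: complex and t :: real
    show "((\<lambda>\<tau>. h \<tau> (cis t)) has_field_derivative (\<i> * of_real (Re (cis t))) * h \<tau> (cis t)) (at \<tau> within UNIV)"
      unfolding h_def by (auto intro!: derivative_eq_intros)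
  next
    fix \<tau> :: complex
    show "(\<lambda>t. h \<tau> (cis t)) integrable_on cbox 0 (2*pi)"
      by (intro integrable_continuous continuous_on_subset[OF c]) auto
  next
    show "continuous_on (UNIV \<times> cbox 0 (2*pi)) (\<lambda>(\<tau>, t). (\<i> * of_real (Re (cis t))) * h \<tau> (cis t))"
      unfolding h_def case_prod_unfold by (intro continuous_intros)
  qed auto
  \<comment> \<open>At this point i (Re u + \<tau>) equals Im u, so the exponent becomes
    \<open>Im u * z\<close>, holomorphic in z, and the mean value property gives 2 pi.\<close>
  define \<tau>0 where "\<tau>0 = - of_real (Re u) - \<i> * of_real (Im u)"
  have "F \<tau>0 = circle_int (\<lambda>z. inverse z ^ 0 * exp (of_real (Im u) * z))"
    unfolding F_def
  proof (rule circle_int_cong)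
    fix z
    have "\<i> * ((of_real (Re u) + \<tau>0) * of_real (Re z) + of_real (Im u * Im z)) = of_real (Im u) * z"
      by (simp add: \<tau>0_def complex_eq_iff)
    then show "h \<tau>0 z = inverse z ^ 0 * exp (of_real (Im u) * z)" by (simp add: h_def)
  qed
  also have "\<dots> = 2 * pi" by (subst circle_moment_neg) simp
  finally have nz: "F \<tau>0 \<noteq> 0" by simp
  have "countable {\<tau>\<in>UNIV. F \<tau> = 0}"
  proof (cases "F constant_on UNIV")
    case True
    then have "F \<tau> \<noteq> 0" for \<tau> using nz by (auto simp: constant_on_def)
    then show ?thesis by simp
  next
    case False
    have "fsigma (UNIV :: complex set)" by simp
    with hol False show ?thesis by (intro holomorphic_countable_zeros) auto
  qed
  moreover have "bessel_circle (u + of_real t) = F (of_real t)" for t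
    unfolding bessel_circle_def F_def
    by (intro circle_int_cong) (simp add: h_def cis_conv_exp algebra_simps)
  then have "of_real ` {t::real. bessel_circle (u + of_real t) = 0} \<subseteq> {\<tau>\<in>UNIV. F \<tau> = 0}" by auto
  ultimately have "countable ((of_real :: real \<Rightarrow> complex) ` {t::real. bessel_circle (u + of_real t) = 0})"
    by (rule countable_subset[rotated])
  then show ?thesis by (rule countable_image_inj_on) (auto intro: inj_onI)
qed

text \<open>Averaging the translates of the zero set along \<open>d\<close> over a unit interval preserves its measure,
  while every line in the direction \<open>d\<close> meets it in a countable set.\<close>
lemma bessel_circle_AE_nonzero:
  fixes \<rho> :: "'v::euclidean_space \<Rightarrow> complex"
  assumes l: "linear \<rho>" and d: "\<rho> d = 1"
  shows "AE w in lborel. bessel_circle (\<rho> w - b) \<noteq> 0"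
proof -
  interpret linear \<rho> by fact
  have [measurable]: "\<rho> \<in> borel_measurable borel"
    by (intro borel_measurable_continuous_onI linear_continuous_on_compose[OF continuous_on_id l])
  define N where "N = {w. bessel_circle (\<rho> w - b) = 0}"
  have N [measurable]: "N \<in> sets borel" unfolding N_def by measurable
  have "emeasure lborel N = (\<integral>\<^sup>+t. indicator {0..1::real} t * emeasure lborel N \<partial>lborel)"
    by (subst nn_integral_multc) auto
  also have "\<dots> = (\<integral>\<^sup>+t. (\<integral>\<^sup>+w. indicator {0..1::real} t * indicator N (w + t *\<^sub>R d) \<partial>lborel) \<partial>lborel)"
  proof (rule nn_integral_cong)
    fix t :: real
    have "(\<integral>\<^sup>+w. indicator N (w + t *\<^sub>R d) \<partial>lborel) = emeasure lborel N"
      by (subst nn_integral_lborel_shift[of "indicator N"]) auto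
    then show "indicator {0..1} t * emeasure lborel N = (\<integral>\<^sup>+w. indicator {0..1} t * indicator N (w + t *\<^sub>R d) \<partial>lborel)"
      by (subst nn_integral_cmult) auto
  qed
  also have "\<dots> = (\<integral>\<^sup>+w. (\<integral>\<^sup>+t. indicator {0..1::real} t * indicator N (w + t *\<^sub>R d) \<partial>lborel) \<partial>lborel)"
    by (rule lborel_pair.Fubini'[symmetric]) measurable
  also have "\<dots> = (\<integral>\<^sup>+(w::'v). 0 \<partial>lborel)"
  proof (rule nn_integral_cong)
    fix w :: 'v
    have "{t. w + t *\<^sub>R d \<in> N} = {t. bessel_circle ((\<rho> w - b) + of_real t) = 0}"
      by (simp add: N_def add scaleR d scaleR_conv_of_real algebra_simps)
    then have "{t. w + t *\<^sub>R d \<in> N} \<in> null_sets lborel"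
      using bessel_circle_zeros_countable[of "\<rho> w - b"] by (simp add: countable_imp_null_set_lborel)
    then have "AE t in lborel. t \<notin> {t. w + t *\<^sub>R d \<in> N}" by (rule AE_not_in)
    then have "AE t in lborel. indicator {0..1::real} t * indicator N (w + t *\<^sub>R d) = (0 :: ennreal)"
      by eventually_elim auto
    then show "(\<integral>\<^sup>+t. indicator {0..1::real} t * indicator N (w + t *\<^sub>R d) \<partial>lborel) = 0"
      by (subst nn_integral_cong_AE[where v = "\<lambda>_. 0"]) auto
  qed
  finally have "N \<in> null_sets lborel" by (simp add: null_sets_def)
  then show ?thesis using AE_not_in[of N lborel] by (simp add: N_def)
qed

text \<open>As \<rho> vanishes on the plane, the phase does not change under translations along it,
  and the operator acts on a character \<open>cis (\<xi> \<bullet> w)\<close> as multiplication by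
  \<open>J w\<close>, itself constant along the plane. Division by J therefore passes through the
  circle integral and recovers the Fourier transform of g.\<close>

lemma circle_null_zero:
  fixes g :: "'v::euclidean_space \<Rightarrow> complex" and \<rho> :: "'v \<Rightarrow> complex"
  assumes g: "integrable lborel g" and l: "linear \<rho>" and lE: "linear E" and \<rho>E: "\<And>z. \<rho> (E z) = 0" and d: "\<rho> d = 1"
    and \<theta>: "\<And>w z. \<theta> w z = Re (cnj (\<rho> w) * z)" and null: "circle_null g E \<theta> 0"
  shows "AE x in lborel. g x = 0"
proof (rule fourier_uniqueness[OF g])
  fix \<xi> :: 'v
  interpret \<rho>: linear \<rho> by fact
  interpret E: linear E by fact
  have [measurable]: "\<rho> \<in> borel_measurable borel"
    by (intro borel_measurable_continuous_onI linear_continuous_on_compose[OF continuous_on_id l])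
  have gm [measurable]: "g \<in> borel_measurable borel" using g by auto
  define b where "b = Complex (\<xi> \<bullet> E 1) (\<xi> \<bullet> E \<i>)"
  have \<xi>E: "\<xi> \<bullet> E z = Re (cnj b * z)" for z
  proof -
    have "E z = E (Re z *\<^sub>R 1 + Im z *\<^sub>R \<i>)" by (simp add: scaleR_conv_of_real complex_eq[symmetric] mult.commute)
    then show ?thesis by (simp add: E.add E.scaleR b_def inner_add_right mult.commute)
  qed
  define J where "J w = bessel_circle (\<rho> w - b)" for w
  have [measurable]: "J \<in> borel_measurable borel" unfolding J_def by measurable
  \<comment> \<open>Division by J stays bounded only where |J| is bounded below; the sets
    \<open>S n\<close> exhaust the complement of the null set of zeros.\<close>
  define S where "S n = {w. norm (J w) > inverse (real (Suc n))}" for n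
  have [measurable]: "S n \<in> sets borel" for n unfolding S_def by measurable
  define \<psi> where "\<psi> n w = cis (\<xi> \<bullet> w) * (indicator (S n) w * inverse (J w))" for n w
  have [measurable]: "\<psi> n \<in> borel_measurable borel" for n unfolding \<psi>_def by measurable
  have b\<psi>: "norm (\<psi> n w) \<le> real (Suc n)" for n w
  proof (cases "w \<in> S n")
    case True
    then have "inverse (norm (J w)) \<le> inverse (inverse (real (Suc n)))"
      unfolding S_def by (intro le_imp_inverse_le) auto
    then show ?thesis using True by (simp add: \<psi>_def norm_mult norm_inverse)
  qed (simp add: \<psi>_def)
  have "circle_int (\<lambda>z. \<psi> n (w - E z) * (z ^ 0 * cis (\<theta> w z))) = indicator (S n) w * cis (\<xi> \<bullet> w)" for n w
  proof -
    have JE: "J (w - E z) = J w" for z by (simp add: J_def \<rho>.diff \<rho>E)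
    then have SE: "w - E z \<in> S n \<longleftrightarrow> w \<in> S n" for z by (simp add: S_def)
    have "circle_int (\<lambda>z. \<psi> n (w - E z) * (z ^ 0 * cis (\<theta> w z))) =
      circle_int (\<lambda>z. \<psi> n w * cis (Re (cnj (\<rho> w - b) * z)))"
      by (intro circle_int_cong)
        (simp add: \<psi>_def JE SE indicator_def inner_diff_right \<xi>E \<theta> cis_mult left_diff_distrib algebra_simps)
    also have "\<dots> = \<psi> n w * J w" by (simp add: circle_int_mult_left J_def bessel_circle_def)
    also have "\<dots> = indicator (S n) w * cis (\<xi> \<bullet> w)"
    proof (cases "w \<in> S n")
      case True
      then have "0 < norm (J w)" unfolding S_def mem_Collect_eq by (rule le_less_trans[rotated]) simp
      then show ?thesis using True by (simp add: \<psi>_def)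
    qed (simp add: \<psi>_def)
    finally show ?thesis .
  qed
  moreover have "(LINT w|lborel. g w * circle_int (\<lambda>z. \<psi> n (w - E z) * (z ^ 0 * cis (\<theta> w z)))) = 0" for n
    by (rule circle_nullD[OF null _ b\<psi>]) measurable
  ultimately have z: "(LINT w|lborel. g w * (indicator (S n) w * cis (\<xi> \<bullet> w))) = 0" for n
    by (simp only:)
  have "(\<lambda>n. LINT w|lborel. g w * (indicator (S n) w * cis (\<xi> \<bullet> w))) \<longlonglongrightarrow> (LINT w|lborel. g w * cis (\<xi> \<bullet> w))"
  proof (rule integral_dominated_convergence)
    show "integrable lborel (\<lambda>w. norm (g w))" using g by simp
    show "AE w in lborel. norm (g w * (indicator (S n) w * cis (\<xi> \<bullet> w))) \<le> norm (g w)" for n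
      by (intro AE_I2) (auto simp: norm_mult indicator_def)
    show "AE w in lborel. (\<lambda>n. g w * (indicator (S n) w * cis (\<xi> \<bullet> w))) \<longlonglongrightarrow> g w * cis (\<xi> \<bullet> w)"
      using bessel_circle_AE_nonzero[OF l d, of b]
    proof eventually_elim
      fix w assume "bessel_circle (\<rho> w - b) \<noteq> 0"
      then have "eventually (\<lambda>n. inverse (real (Suc n)) < norm (J w)) sequentially"
        using LIMSEQ_inverse_real_of_nat by (intro order_tendstoD(2)) (auto simp: J_def)
      then have "eventually (\<lambda>n. g w * (indicator (S n) w * cis (\<xi> \<bullet> w)) = g w * cis (\<xi> \<bullet> w)) sequentially"
        by eventually_elim (simp add: S_def)
      then show "(\<lambda>n. g w * (indicator (S n) w * cis (\<xi> \<bullet> w))) \<longlonglongrightarrow> g w * cis (\<xi> \<bullet> w)"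
        by (rule tendsto_eventually)
    qed
  qed measurable
  then show "(LINT w|lborel. g w * cis (\<xi> \<bullet> w)) = 0" by (simp add: z LIMSEQ_const_iff)
qed

section \<open>All directions\<close>

text \<open>The disc |z|^2 \<le> r has area pi r, so the squared norm, unlike the norm, has constant
  density on the half line.\<close>

lemma distr_norm_square_complex:
  "distr lborel borel (\<lambda>z::complex. (norm z)\<^sup>2) = density lborel (\<lambda>r. ennreal pi * indicator {0..} r)"
proof (rule measure_eqI_generator_eq[where E = "range (atMost :: real \<Rightarrow> real set)" and A = "\<lambda>i. {..real i}" and \<Omega> = UNIV])
  show "Int_stable (range (atMost :: real \<Rightarrow> real set))"
    by (auto simp: Int_stable_def)
  show "sets (distr lborel borel (\<lambda>z::complex. (norm z)\<^sup>2)) = sigma_sets UNIV (range atMost)"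
    "sets (density lborel (\<lambda>r::real. ennreal pi * indicator {0..} r)) = sigma_sets UNIV (range atMost)"
    by (simp_all add: borel_eq_atMost)
  have eq: "emeasure (distr lborel borel (\<lambda>z::complex. (norm z)\<^sup>2)) {..a} = ennreal (pi * max 0 a)"
    "emeasure (density lborel (\<lambda>r. ennreal pi * indicator {0..} r)) {..a} = ennreal (pi * max 0 a)" for a :: real
  proof -
    have "(\<lambda>z::complex. (norm z)\<^sup>2) -` {..a} = (if 0 \<le> a then cball 0 (sqrt a) else {})"
    proof (cases "0 \<le> a")
      case True
      have "(norm z)\<^sup>2 \<le> a \<longleftrightarrow> norm z \<le> sqrt a" for z :: complex
        by (metis abs_norm_cancel real_sqrt_abs real_sqrt_le_iff)
      then show ?thesis using True by (simp add: vimage_def cball_def)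
    next
      case False
      then show ?thesis by (auto, smt (verit) zero_le_power2)
    qed
    then show "emeasure (distr lborel borel (\<lambda>z::complex. (norm z)\<^sup>2)) {..a} = ennreal (pi * max 0 a)"
      by (simp add: emeasure_distr emeasure_cball unit_ball_vol_2 max_def)
    have "emeasure (density lborel (\<lambda>r. ennreal pi * indicator {0..} r)) {..a} = (\<integral>\<^sup>+r. ennreal pi * indicator {0..a} r \<partial>lborel)"
      by (subst emeasure_density) (auto intro!: nn_integral_cong simp: indicator_def)
    also have "\<dots> = ennreal pi * emeasure lborel {0..a}" by (rule nn_integral_cmult_indicator) simp
    also have "\<dots> = ennreal (pi * max 0 a)"
      by (simp add: emeasure_lborel_Icc_eq max_def ennreal_mult)
    finally show "emeasure (density lborel (\<lambda>r. ennreal pi * indicator {0..} r)) {..a} = ennreal (pi * max 0 a)" .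
  qed
  show "emeasure (distr lborel borel (\<lambda>z::complex. (norm z)\<^sup>2)) X = emeasure (density lborel (\<lambda>r. ennreal pi * indicator {0..} r)) X"
    if "X \<in> range atMost" for X
    using that eq by auto
  show "emeasure (distr lborel borel (\<lambda>z::complex. (norm z)\<^sup>2)) {..real i} \<noteq> \<infinity>" for i
    unfolding eq by simp
  show "(\<Union>i. {..real i}) = UNIV" using real_arch_simple by auto
qed auto

lemma nn_integral_radial:
  fixes h :: "real \<Rightarrow> real"
  assumes [measurable]: "h \<in> borel_measurable borel"
  shows "(\<integral>\<^sup>+z. ennreal (h ((norm (z::complex))\<^sup>2)) \<partial>lborel) = ennreal pi * (\<integral>\<^sup>+r. ennreal (h r) * indicator {0..} r \<partial>lborel)"
proof -
  have "(\<integral>\<^sup>+z. ennreal (h ((norm (z::complex))\<^sup>2)) \<partial>lborel) = (\<integral>\<^sup>+r. ennreal (h r) \<partial>distr lborel borel (\<lambda>z::complex. (norm z)\<^sup>2))"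
    by (subst nn_integral_distr) auto
  also have "\<dots> = (\<integral>\<^sup>+r. ennreal pi * (ennreal (h r) * indicator {0..} r) \<partial>lborel)"
    unfolding distr_norm_square_complex by (subst nn_integral_density) (auto simp: mult_ac)
  also have "\<dots> = ennreal pi * (\<integral>\<^sup>+r. ennreal (h r) * indicator {0..} r \<partial>lborel)"
    by (rule nn_integral_cmult) measurable
  finally show ?thesis .
qed

lemma has_bochner_integral_radial_FTC:
  fixes f F :: "real \<Rightarrow> real"
  assumes f [measurable]: "f \<in> borel_measurable borel"
    and F: "\<And>r. 0 \<le> r \<Longrightarrow> (F has_real_derivative f r) (at r)" and nn: "\<And>r. 0 \<le> r \<Longrightarrow> 0 \<le> f r"
    and T: "(F \<longlongrightarrow> T) at_top"
  shows "has_bochner_integral lborel (\<lambda>z::complex. f ((norm z)\<^sup>2)) (pi * (T - F 0))"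
proof -
  have *: "(\<integral>\<^sup>+r. ennreal (f r) * indicator {0..} r \<partial>lborel) = ennreal (T - F 0)"
    by (rule nn_integral_FTC_atLeast) (use assms in auto)
  have "F 0 \<le> T"
  proof (rule tendsto_lowerbound[OF T])
    show "eventually (\<lambda>r. F 0 \<le> F r) at_top"
      using eventually_ge_at_top[of 0]
    proof eventually_elim
      fix r :: real assume r: "0 \<le> r"
      show "F 0 \<le> F r"
        by (rule DERIV_nonneg_imp_nondecreasing[OF r]) (use F nn in blast)
    qed
  qed simp
  have "(\<integral>\<^sup>+z. ennreal (f ((norm (z::complex))\<^sup>2)) \<partial>lborel) = ennreal (pi * (T - F 0))"
    by (simp add: nn_integral_radial * ennreal_mult'[symmetric])
  then show ?thesis
    using \<open>F 0 \<le> T\<close> by (intro has_bochner_integral_nn_integral) (auto intro!: nn)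
qed

text \<open>In the variable V = q r / (1 + q r), with r = |z|^2, the weight
  \<open>(1 / S z)\<^sup>2\<close> is dV/dr up to the factor q, so the moments are elementary
  integrals over 0 \<le> V \<le> 1.\<close>

lemma
  fixes q \<theta> :: real
  assumes q: "q > 0" and \<theta>: "1 \<le> \<theta>" "\<theta> < 2"
  defines "S \<equiv> \<lambda>z::complex. 1 + q * (norm z)\<^sup>2"
  defines "v \<equiv> \<lambda>z. q * (norm z)\<^sup>2 / S z"
  shows radial_integrable2: "integrable lborel (\<lambda>z. (1 / S z)\<^sup>2)"
    and radial_moment2: "has_bochner_integral lborel (\<lambda>z. (1 / S z)\<^sup>2 * (1 - \<theta> * v z) ^ j)
      (pi * (1 - (1 - \<theta>) ^ Suc j) / (q * \<theta> * real (Suc j)))"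
proof -
  define V where "V r = q * r / (1 + q * r)" for r
  define D where "D r = (1 / (1 + q * r))\<^sup>2" for r :: real
  have pos: "1 + q * r > 0" if "0 \<le> r" for r using q that by (simp add: add_pos_nonneg)
  have V01: "0 \<le> V r" "V r \<le> 1" if "0 \<le> r" for r
    using pos[OF that] q that by (auto simp: V_def)
  have dV: "(V has_real_derivative q * D r) (at r)" if "0 \<le> r" for r
    unfolding V_def D_def using pos[OF that]
    by (auto intro!: derivative_eq_intros simp: power2_eq_square field_simps)
  have limV: "(V \<longlongrightarrow> 1) at_top" unfolding V_def using q by real_asymp
  have [measurable]: "V \<in> borel_measurable borel" "D \<in> borel_measurable borel" unfolding V_def D_def by measurable
  have 1: "has_bochner_integral lborel (\<lambda>z::complex. D ((norm z)\<^sup>2)) (pi * (1 / q - V 0 / q))"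
    by (rule has_bochner_integral_radial_FTC[where F = "\<lambda>r. V r / q"])
       (use q in \<open>auto intro!: derivative_eq_intros dV tendsto_divide limV tendsto_const simp: D_def\<close>)
  then show "integrable lborel (\<lambda>z. (1 / S z)\<^sup>2)"
    by (simp add: has_bochner_integral_iff D_def S_def)
  \<comment> \<open>The monomial may be negative where \<theta> V > 1, while the radial integral
    formula asks for a nonnegative integrand. As D dominates, it is added here and subtracted
    below.\<close>
  define F where "F r = V r / q - (1 - \<theta> * V r) ^ Suc j / (q * \<theta> * real (Suc j))" for r
  have 2: "has_bochner_integral lborel (\<lambda>z::complex. (\<lambda>r. D r + D r * (1 - \<theta> * V r) ^ j) ((norm z)\<^sup>2))
      (pi * ((1 / q - (1 - \<theta> * 1) ^ Suc j / (q * \<theta> * real (Suc j))) - F 0))"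
  proof (rule has_bochner_integral_radial_FTC)
    show "(F has_real_derivative D r + D r * (1 - \<theta> * V r) ^ j) (at r)" if "0 \<le> r" for r
      unfolding F_def using q \<theta>
      by (auto intro!: derivative_eq_intros dV[OF that] simp del: of_nat_Suc power_Suc simp: field_simps)
    show "(F \<longlongrightarrow> (1 / q - (1 - \<theta> * 1) ^ Suc j / (q * \<theta> * real (Suc j)))) at_top"
      unfolding F_def using q \<theta> by (intro tendsto_intros limV) auto
    show "0 \<le> D r + D r * (1 - \<theta> * V r) ^ j" if "0 \<le> r" for r
    proof -
      have "\<theta> * V r \<le> 2 * 1" using V01[OF that] \<theta> by (intro mult_mono) auto
      moreover have "0 \<le> \<theta> * V r" using V01[OF that] \<theta> by simp
      ultimately have "\<bar>1 - \<theta> * V r\<bar> \<le> 1" by (simp add: abs_le_iff)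
      then have "\<bar>(1 - \<theta> * V r) ^ j\<bar> \<le> 1" by (simp add: power_abs power_le_one)
      then have "0 \<le> 1 + (1 - \<theta> * V r) ^ j" by (simp add: abs_le_iff)
      then have "0 \<le> D r * (1 + (1 - \<theta> * V r) ^ j)" by (simp add: D_def)
      then show ?thesis by (simp add: algebra_simps)
    qed
  qed measurable
  have "has_bochner_integral lborel (\<lambda>z::complex. (D ((norm z)\<^sup>2) + D ((norm z)\<^sup>2) * (1 - \<theta> * V ((norm z)\<^sup>2)) ^ j) - D ((norm z)\<^sup>2))
      (pi * ((1 / q - (1 - \<theta> * 1) ^ Suc j / (q * \<theta> * real (Suc j))) - F 0) - pi * (1 / q - V 0 / q))"
    using has_bochner_integral_diff[OF 2 1] by simp
  moreover have "pi * ((1 / q - (1 - \<theta> * 1) ^ Suc j / (q * \<theta> * real (Suc j))) - F 0) - pi * (1 / q - V 0 / q) =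
      pi * (1 - (1 - \<theta>) ^ Suc j) / (q * \<theta> * real (Suc j))"
    by (simp add: F_def V_def diff_divide_distrib algebra_simps del: of_nat_Suc power_Suc)
  ultimately show "has_bochner_integral lborel (\<lambda>z. (1 / S z)\<^sup>2 * (1 - \<theta> * v z) ^ j)
      (pi * (1 - (1 - \<theta>) ^ Suc j) / (q * \<theta> * real (Suc j)))"
    by (simp add: D_def V_def S_def v_def del: of_nat_Suc power_Suc)
qed

text \<open>The value is explicit for exponent 2. For odd j the extra weight (1 - v)^m, decreasing
  in v, is compared with its value c at the sign change v = 1/\<theta>: it is at least c where the
  monomial is positive and at most c where it is negative, so the integral is at least c times the
  explicit one. For even j it is bounded below by the integral for j + 1.\<close>

lemma radial_moment_pos:
  fixes q \<theta> :: real
  assumes q: "q > 0" and \<theta>: "1 \<le> \<theta>" "\<theta> < 2" and n: "2 \<le> n"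
  defines "S \<equiv> \<lambda>z::complex. 1 + q * (norm z)\<^sup>2"
  defines "v \<equiv> \<lambda>z. q * (norm z)\<^sup>2 / S z"
  shows "(LINT z|lborel. (1 / S z) ^ n * (1 - \<theta> * v z) ^ j) > 0"
proof -
  obtain m where m: "n = m + 2" using n by (metis add.commute le_Suc_ex)
  have S: "S z \<ge> 1" for z using q by (simp add: S_def)
  have S0: "S z > 0" for z using S[of z] by linarith
  have v1: "1 - v z = 1 / S z" for z using S0[of z] by (simp add: v_def S_def field_simps)
  have v01: "0 \<le> v z" "v z \<le> 1" for z
    using S0[of z] q by (auto simp: v_def S_def divide_simps)
  have ab: "\<bar>1 - \<theta> * v z\<bar> \<le> 1" for z
  proof -
    have "\<theta> * v z \<le> 2 * 1" using v01 \<theta> by (intro mult_mono) auto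
    moreover have "0 \<le> \<theta> * v z" using v01 \<theta> by simp
    ultimately show ?thesis by (simp add: abs_le_iff)
  qed
  have [measurable]: "S \<in> borel_measurable borel" unfolding S_def by measurable
  have [measurable]: "v \<in> borel_measurable borel" unfolding v_def by measurable
  define I where "I N i = (LINT z|lborel. (1 / S z) ^ N * (1 - \<theta> * v z) ^ i)" for N i
  have int: "integrable lborel (\<lambda>z. (1 / S z) ^ (m + 2) * (1 - \<theta> * v z) ^ i)" for m i
  proof (rule Bochner_Integration.integrable_bound)
    show "integrable lborel (\<lambda>z. (1 / S z)\<^sup>2)" unfolding S_def by (rule radial_integrable2[OF q \<theta>])
    have "\<bar>(1 / S z) ^ m * (1 - \<theta> * v z) ^ i\<bar> \<le> 1" for z
      using S0[of z] S[of z] ab[of z]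
      by (auto simp: abs_mult power_abs intro!: mult_le_one power_le_one)
    then have "(1 / S z)\<^sup>2 * \<bar>(1 / S z) ^ m * (1 - \<theta> * v z) ^ i\<bar> \<le> (1 / S z)\<^sup>2" for z
      by (intro mult_left_le) auto
    then show "AE z in lborel. norm ((1 / S z) ^ (m + 2) * (1 - \<theta> * v z) ^ i) \<le> norm ((1 / S z)\<^sup>2)"
      by (simp add: power_add abs_mult power2_eq_square mult_ac)
  qed measurable
  have pos2: "I 2 i > 0" for i
  proof -
    have "\<bar>1 - \<theta>\<bar> * \<bar>1 - \<theta>\<bar> ^ i \<le> \<bar>1 - \<theta>\<bar>"
      using \<theta> by (intro mult_left_le power_le_one) auto
    then have "\<bar>(1 - \<theta>) ^ Suc i\<bar> < 1"
      unfolding power_Suc abs_mult power_abs using \<theta> by linarith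
    then have "(1 - \<theta>) ^ Suc i < 1" by linarith
    then show ?thesis
      using has_bochner_integral_integral_eq[OF radial_moment2[OF q \<theta>, of i]] q \<theta>
      by (simp add: I_def S_def v_def del: power_Suc)
  qed
  have odd: "I (m + 2) i > 0" if i: "odd i" for i
  \<comment> \<open>At \<theta> = 1 the constant c below degenerates; there 1 - \<theta> v = 1 / S,
    and the extra weight consists of further factors of the monomial.\<close>
  proof (cases "\<theta> = 1")
    case True
    have "I (m + 2) i = I 2 (m + i)"
      unfolding I_def by (simp add: True v1 power_add power2_eq_square mult_ac)
    then show ?thesis using pos2 by simp
  next
    case False
    define c where "c = (1 - 1 / \<theta>) ^ m"
    have c: "c > 0" using False \<theta> by (simp add: c_def)
    have "c * I 2 i = (LINT z|lborel. c * ((1 / S z)\<^sup>2 * (1 - \<theta> * v z) ^ i))" by (simp add: I_def)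
    also have "\<dots> \<le> I (m + 2) i"
      unfolding I_def
    proof (rule integral_mono)
      show "integrable lborel (\<lambda>z. c * ((1 / S z)\<^sup>2 * (1 - \<theta> * v z) ^ i))" by (intro integrable_mult_right) (use int[of 0 i] in \<open>simp only: add_0\<close>)
      show "integrable lborel (\<lambda>z. (1 / S z) ^ (m + 2) * (1 - \<theta> * v z) ^ i)" by (rule int)
      fix z
      have "c * (1 - \<theta> * v z) ^ i \<le> (1 - v z) ^ m * (1 - \<theta> * v z) ^ i"
      proof (cases "\<theta> * v z \<le> 1")
        case True
        then have "v z \<le> 1 / \<theta>" using \<theta> by (simp add: field_simps)
        then have "c \<le> (1 - v z) ^ m" unfolding c_def using \<theta> by (intro power_mono) auto
        then show ?thesis using True by (intro mult_right_mono) auto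
      next
        case False
        then have "1 / \<theta> \<le> v z" using \<theta> by (simp add: field_simps)
        then have "(1 - v z) ^ m \<le> c" unfolding c_def using v01[of z] by (intro power_mono) auto
        moreover have "(1 - \<theta> * v z) ^ i \<le> 0" using False i by (simp add: power_le_zero_eq odd_pos)
        ultimately show ?thesis by (intro mult_right_mono_neg)
      qed
      then have "(1 / S z)\<^sup>2 * (c * (1 - \<theta> * v z) ^ i) \<le> (1 / S z)\<^sup>2 * ((1 - v z) ^ m * (1 - \<theta> * v z) ^ i)"
        by (intro mult_left_mono) auto
      then show "c * ((1 / S z)\<^sup>2 * (1 - \<theta> * v z) ^ i) \<le> (1 / S z) ^ (m + 2) * (1 - \<theta> * v z) ^ i"
        by (simp add: v1 power_add power2_eq_square mult_ac)
    qed
    finally show ?thesis using c pos2[of i] by (smt (verit) mult_pos_pos)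
  qed
  have "I (m + 2) j > 0"
  proof (cases "odd j")
    case False
    have "I (m + 2) (Suc j) \<le> I (m + 2) j"
      unfolding I_def
    proof (rule integral_mono[OF int int])
      fix z
      have "(1 - \<theta> * v z) ^ Suc j \<le> (1 - \<theta> * v z) ^ j"
        using ab[of z] False mult_right_mono[of "1 - \<theta> * v z" 1 "(1 - \<theta> * v z) ^ j"]
        by (simp add: zero_le_even_power)
      then show "(1 / S z) ^ (m + 2) * (1 - \<theta> * v z) ^ Suc j \<le> (1 / S z) ^ (m + 2) * (1 - \<theta> * v z) ^ j"
        using S0[of z] by (intro mult_left_mono) auto
    qed
    moreover have "I (m + 2) (Suc j) > 0" using False by (intro odd) simp
    ultimately show ?thesis by linarith
  qed (rule odd)
  then show ?thesis by (simp add: I_def m)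
qed

lemma integrable_gaussian_complex:
  assumes "c > 0"
  shows "integrable lborel (\<lambda>z::complex. exp (- c * (norm z)\<^sup>2))"
proof -
  have "integrable lborel (\<lambda>z::complex. norm (cis (0 \<bullet> z) * of_real (exp (- c * (z \<bullet> z)))))"
    by (intro integrable_norm integrable_gaussian_cis assms)
  then show ?thesis by (simp add: norm_mult power2_norm_eq_inner)
qed

text \<open>The twisted convolution of the circle with the kernel \<open>p\<^sup>k\<close> (conjugated) times the Gaussian
  is a multiple of the Gaussian on the plane.\<close>
lemma circle_null_plane_gaussian:
  fixes g :: "'v::euclidean_space \<Rightarrow> complex" and \<zeta> :: "'v \<Rightarrow> complex" and \<phi> :: "'v \<Rightarrow> complex"
  assumes lz: "linear \<zeta>" and lE: "linear E" and \<zeta>E: "\<And>z. \<zeta> (E z) = z"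
    and \<theta>: "\<And>w z. \<theta> w z = real k * Im (cnj (\<zeta> w) * z)" and k: "k > 0" and null: "circle_null g E \<theta> k"
    and \<phi> [measurable]: "\<phi> \<in> borel_measurable borel" and b: "\<And>x. norm (\<phi> x) \<le> C"
  shows "(LINT w|lborel. g w * (LINT p|lborel. \<phi> (w - E p) *
     (cis (\<theta> w p) * of_real (exp (- (real k / 2) * (norm p)\<^sup>2))))) = 0"
proof -
  interpret z: linear \<zeta> by fact
  interpret E: linear E by fact
  have [measurable]: "\<zeta> \<in> borel_measurable borel" "E \<in> borel_measurable borel"
    by (intro borel_measurable_continuous_onI linear_continuous_on_compose[OF continuous_on_id] lz lE)+
  have C: "0 \<le> C" using b[of 0] norm_ge_zero order_trans by blast
  \<comment> \<open>The exponent k/2 matches the phase as in \<open>gaussian_circle_shift\<close>,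
    and \<open>cnj p ^ k\<close> has the lowest degree that integration against \<open>z ^ k\<close>
    does not annihilate.\<close>
  define \<eta> where "\<eta> p = cnj p ^ k * of_real (exp (- (real k / 2) * (norm p)\<^sup>2))" for p
  have [measurable]: "\<eta> \<in> borel_measurable borel"
    unfolding \<eta>_def by (intro borel_measurable_continuous_onI continuous_intros)
  have i\<eta>: "integrable lborel \<eta>"
  proof (rule Bochner_Integration.integrable_bound)
    have k4: "real k / 4 > 0" using k by simp
    show "integrable lborel (\<lambda>p::complex. fact k * exp ((0 + 1)\<^sup>2 / (4 * (real k / 4))) * exp (- (real k / 4) * (norm p)\<^sup>2))"
      by (intro integrable_mult_right integrable_gaussian_complex k4)
    have "norm (\<eta> p) \<le> fact k * exp ((0 + 1)\<^sup>2 / (4 * (real k / 4))) * exp (- (real k / 4) * (norm p)\<^sup>2)" for p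
    proof -
      have e: "exp (- (real k / 2) * (norm p)\<^sup>2) = exp (- (real k / 4) * (norm p)\<^sup>2) * exp (- (real k / 4) * (norm p)\<^sup>2)"
        by (subst exp_add[symmetric]) simp
      have "norm (\<eta> p) = (norm p ^ k * exp (0 * norm p) * exp (- (real k / 4) * (norm p)\<^sup>2)) * exp (- (real k / 4) * (norm p)\<^sup>2)"
        unfolding \<eta>_def e by (simp add: norm_mult norm_power)
      also have "\<dots> \<le> (fact k * exp ((0 + 1)\<^sup>2 / (4 * (real k / 4)))) * exp (- (real k / 4) * (norm p)\<^sup>2)"
        by (intro mult_right_mono power_gaussian_le[OF k4]) auto
      finally show ?thesis .
    qed
    then show "AE p in lborel. norm (\<eta> p) \<le> norm (fact k * exp ((0 + 1)\<^sup>2 / (4 * (real k / 4))) * exp (- (real k / 4) * (norm p)\<^sup>2))"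
      by simp
  qed measurable
  define K where "K = (LINT p|lborel. norm (\<eta> p))"
  have \<theta>m [measurable]: "(\<lambda>p. \<theta> (fst p) (snd p)) \<in> borel_measurable (borel \<Otimes>\<^sub>M borel)" "\<theta> w \<in> borel_measurable borel" for w
  proof -
    have "\<theta> w = (\<lambda>z. real k * Im (cnj (\<zeta> w) * z))" for w by (rule ext) (simp add: \<theta>)
    then show "(\<lambda>p. \<theta> (fst p) (snd p)) \<in> borel_measurable (borel \<Otimes>\<^sub>M borel)" "\<theta> w \<in> borel_measurable borel" for w
      by simp_all
  qed
  define \<psi> where "\<psi> x = (LINT p|lborel. \<phi> (x - E p) * (cis (\<theta> x p) * \<eta> p))" for x
  have [measurable]: "\<psi> \<in> borel_measurable borel"
  proof -
    have "(\<lambda>x. LINT p|lborel. (\<lambda>q. \<phi> (fst q - E (snd q)) * (cis (\<theta> (fst q) (snd q)) * \<eta> (snd q))) (x, p)) \<in> borel_measurable borel"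
      by (intro lborel.borel_measurable_lebesgue_integral) measurable
    then show ?thesis by (simp add: \<psi>_def[abs_def])
  qed
  have b\<psi>: "norm (\<psi> x) \<le> C * K" for x
  proof -
    have "norm (\<psi> x) \<le> (LINT p|lborel. C * norm (\<eta> p))"
      unfolding \<psi>_def
    proof (rule order_trans[OF integral_norm_bound integral_mono])
      have "integrable lborel (\<lambda>p. \<phi> (x - E p) * (cis (\<theta> x p) * \<eta> p))"
      proof (rule Bochner_Integration.integrable_bound)
        show "integrable lborel (\<lambda>p. C * norm (\<eta> p))" using i\<eta> by simp
      qed (use C b in \<open>auto simp: norm_mult intro!: mult_right_mono\<close>)
      then show "integrable lborel (\<lambda>p. norm (\<phi> (x - E p) * (cis (\<theta> x p) * \<eta> p)))" by simp
    qed (use i\<eta> b in \<open>auto simp: norm_mult intro!: mult_right_mono\<close>)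
    then show ?thesis by (simp add: K_def)
  qed
  have "circle_int (\<lambda>z. \<psi> (w - E z) * (z ^ k * cis (\<theta> w z))) =
    (of_real (exp (- (real k / 2))) * laguerre_coef k k k) *
      (LINT p|lborel. \<phi> (w - E p) * (cis (\<theta> w p) * of_real (exp (- (real k / 2) * (norm p)\<^sup>2))))" for w
  proof -
    define F where "F z p = \<phi> (w - E p) * cis (\<theta> w p) * (\<eta> (p - z) * z ^ k * cis (real k * Im (cnj p * z)))" for z p
    have \<psi>F: "\<psi> (w - E z) * (z ^ k * cis (\<theta> w z)) = (LINT p|lborel. F z p)" for z
    proof -
      have "\<psi> (w - E z) * (z ^ k * cis (\<theta> w z)) = (LINT p|lborel. (\<phi> ((w - E z) - E p) * (cis (\<theta> (w - E z) p) * \<eta> p)) * (z ^ k * cis (\<theta> w z)))"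
        unfolding \<psi>_def by (rule integral_mult_left_zero[symmetric])
      also have "\<dots> = (LINT p|lborel. F z (p + z))"
      proof (rule Bochner_Integration.integral_cong[OF refl])
        fix p
        have 1: "(w - E z) - E p = w - E (p + z)" by (simp add: E.add)
        \<comment> \<open>The cocycle identity that makes twisted convolution associative.\<close>
        have "\<theta> (w - E z) p + \<theta> w z = \<theta> w (p + z) + real k * Im (cnj (p + z) * z)"
          by (simp add: \<theta> z.diff \<zeta>E algebra_simps)
        then have 2: "cis (\<theta> (w - E z) p) * cis (\<theta> w z) = cis (\<theta> w (p + z)) * cis (real k * Im (cnj (p + z) * z))"
          by (simp add: cis_mult)
        show "(\<phi> ((w - E z) - E p) * (cis (\<theta> (w - E z) p) * \<eta> p)) * (z ^ k * cis (\<theta> w z)) = F z (p + z)"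
          using 2 unfolding F_def 1 by (simp add: mult_ac)
      qed
      also have "\<dots> = (LINT p|lborel. F z p)"
        by (rule integral_lborel_shift) (unfold F_def, measurable)
      finally show ?thesis .
    qed
    have [measurable]: "(\<lambda>q. F (cis (fst q)) (snd q)) \<in> borel_measurable (lborel \<Otimes>\<^sub>M lborel)"
    proof -
      have [measurable]: "(\<lambda>q. Im (cnj (snd q) * cis (fst q))) \<in> borel_measurable (borel \<Otimes>\<^sub>M borel)"
        unfolding borel_prod by (intro borel_measurable_continuous_onI continuous_intros)
      show ?thesis unfolding F_def by measurable
    qed
    have nF: "norm (F (cis t) p) \<le> C * norm (\<eta> (p - cis t))" for t p
      using b by (auto simp: F_def norm_mult norm_power intro!: mult_right_mono)
    have i\<eta>s: "integrable lborel (\<lambda>p. C * norm (\<eta> (p - z)))" for z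
      using integrable_lborel_shift[OF i\<eta>, of "- z"] by simp
    have iF: "integrable (lborel \<Otimes>\<^sub>M lborel) (\<lambda>q. indicator {0..<2*pi} (fst q) *\<^sub>R F (cis (fst q)) (snd q))"
    proof (rule lborel_pair.Fubini_integrable)
      have iFt: "integrable lborel (\<lambda>p. F (cis t) p)" for t
      proof (rule Bochner_Integration.integrable_bound[OF i\<eta>s[of "cis t"]])
        show "F (cis t) \<in> borel_measurable lborel"
          using measurable_compose[of "\<lambda>p. (t, p)" lborel "lborel \<Otimes>\<^sub>M lborel" "\<lambda>q. F (cis (fst q)) (snd q)" borel] by simp
        show "AE p in lborel. norm (F (cis t) p) \<le> norm (C * norm (\<eta> (p - cis t)))"
          using nF[of t] by (intro AE_I2) (auto intro: order_trans[OF nF abs_ge_self])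
      qed
      show "AE t in lborel. integrable lborel (\<lambda>p. indicator {0..<2*pi} (fst (t, p)) *\<^sub>R F (cis (fst (t, p))) (snd (t, p)))"
        using iFt by simp
      show "integrable lborel (\<lambda>t. LINT p|lborel. norm (indicator {0..<2*pi} (fst (t, p)) *\<^sub>R F (cis (fst (t, p))) (snd (t, p))))"
      proof (rule Bochner_Integration.integrable_bound)
        show "integrable lborel (\<lambda>t. indicator {0..<2*pi} t *\<^sub>R (C * K))"
          by (intro integrable_scaleR_left integrable_real_indicator) auto
        have "(LINT p|lborel. norm (F (cis t) p)) \<le> C * K" for t
        proof -
          have "(LINT p|lborel. norm (F (cis t) p)) \<le> (LINT p|lborel. C * norm (\<eta> (p - cis t)))"
            by (intro integral_mono nF i\<eta>s integrable_norm iFt)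
          also have "\<dots> = C * K"
            using integral_lborel_shift[of "\<lambda>p. norm (\<eta> p)" "- cis t"] by (simp add: K_def)
          finally show ?thesis .
        qed
        then show "AE t in lborel. norm (LINT p|lborel. norm (indicator {0..<2*pi} (fst (t, p)) *\<^sub>R F (cis (fst (t, p))) (snd (t, p)))) \<le>
          norm (indicator {0..<2*pi} t *\<^sub>R (C * K))"
          using C by (intro AE_I2) (auto simp: indicator_def intro: order_trans[OF _ abs_ge_self])
      qed measurable
    qed measurable
    have "circle_int (\<lambda>z. \<psi> (w - E z) * (z ^ k * cis (\<theta> w z))) = (LINT t|lborel. LINT p|lborel. indicator {0..<2*pi} t *\<^sub>R F (cis t) p)"
      unfolding \<psi>F circle_int_def by simp
    also have "\<dots> = (LINT p|lborel. LINT t|lborel. indicator {0..<2*pi} t *\<^sub>R F (cis t) p)"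
      using lborel_pair.Fubini_integral[of "\<lambda>t p. indicator {0..<2*pi} t *\<^sub>R F (cis t) p"] iF by (simp add: case_prod_unfold)
    also have "\<dots> = (LINT p|lborel. (of_real (exp (- (real k / 2))) * laguerre_coef k k k) *
      (\<phi> (w - E p) * (cis (\<theta> w p) * of_real (exp (- (real k / 2) * (norm p)\<^sup>2)))))"
    proof (rule Bochner_Integration.integral_cong[OF refl])
      fix p
      have "(LINT t|lborel. indicator {0..<2*pi} t *\<^sub>R F (cis t) p) = circle_int (\<lambda>z. F z p)"
        by (simp add: circle_int_def)
      also have "\<dots> = circle_int (\<lambda>z. (\<phi> (w - E p) * cis (\<theta> w p) * of_real (exp (- (real k / 2)) * exp (- (real k / 2) * (norm p)\<^sup>2))) *
         (z ^ k * (cnj p - inverse z) ^ k * exp (of_nat k * cnj p * z)))"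
      proof (rule circle_int_cong)
        fix z :: complex assume z: "norm z = 1"
        have zi: "cnj z = inverse z"
          by (intro inverse_unique[symmetric]) (use z in \<open>simp add: complex_norm_square[symmetric]\<close>)
        have "F z p = \<phi> (w - E p) * cis (\<theta> w p) * ((cnj p - inverse z) ^ k * z ^ k *
          (of_real (exp (- (real k / 2) * (norm (p - z))\<^sup>2)) * cis (real k * Im (cnj p * z))))"
          unfolding F_def \<eta>_def by (simp only: complex_cnj_diff zi mult_ac)
        then show "F z p = (\<phi> (w - E p) * cis (\<theta> w p) * of_real (exp (- (real k / 2)) * exp (- (real k / 2) * (norm p)\<^sup>2))) *
         (z ^ k * (cnj p - inverse z) ^ k * exp (of_nat k * cnj p * z))"
          unfolding gaussian_circle_shift[OF z] by (simp only: mult_ac)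
      qed
      \<comment> \<open>Both exponents in \<open>circle_laguerre\<close> equal k, so no power of
        \<open>cnj p\<close> survives and only the Gaussian remains.\<close>
      also have "\<dots> = (of_real (exp (- (real k / 2))) * laguerre_coef k k k) *
        (\<phi> (w - E p) * (cis (\<theta> w p) * of_real (exp (- (real k / 2) * (norm p)\<^sup>2))))"
        unfolding circle_int_mult_left circle_laguerre by (simp add: mult_ac)
      finally show "(LINT t|lborel. indicator {0..<2*pi} t *\<^sub>R F (cis t) p) = (of_real (exp (- (real k / 2))) * laguerre_coef k k k) *
        (\<phi> (w - E p) * (cis (\<theta> w p) * of_real (exp (- (real k / 2) * (norm p)\<^sup>2))))" .
    qed
    also have "\<dots> = (of_real (exp (- (real k / 2))) * laguerre_coef k k k) *
      (LINT p|lborel. \<phi> (w - E p) * (cis (\<theta> w p) * of_real (exp (- (real k / 2) * (norm p)\<^sup>2))))"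
      by (rule integral_mult_right_zero)
    finally show ?thesis .
  qed
  moreover have "(LINT w|lborel. g w * circle_int (\<lambda>z. \<psi> (w - E z) * (z ^ k * cis (\<theta> w z)))) = 0"
    by (rule circle_nullD[OF null _ b\<psi>]) measurable
  ultimately have "(LINT w|lborel. (of_real (exp (- (real k / 2))) * laguerre_coef k k k) * (g w *
      (LINT p|lborel. \<phi> (w - E p) * (cis (\<theta> w p) * of_real (exp (- (real k / 2) * (norm p)\<^sup>2)))))) = 0"
    by (simp only: mult_ac)
  then show ?thesis unfolding integral_mult_right_zero using laguerre_coef_self[of k] by simp
qed

section \<open>Coordinates, adjoints and norms for the planes\<close>

text \<open>If \<open>\<mu> \<cdot> \<lambda>/|\<lambda>| = 2 k |\<lambda>|\<^sup>2\<close>, this is a left inverse \<open>\<zeta>\<close> of \<^const>\<open>jplane\<close>, and the twist is \<open>k Im (cnj \<zeta> z)\<close>.\<close>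
definition jcoord :: "('v::euclidean_space \<times> 'z::euclidean_space \<Rightarrow> 'v \<times> 'z \<Rightarrow> 'v \<times> 'z) \<Rightarrow>
    'z \<Rightarrow> 'z \<Rightarrow> 'v \<Rightarrow> real \<Rightarrow> 'v \<Rightarrow> complex" where
  "jcoord br \<mu> l \<nu> k x = Complex (Jmap br \<mu> x \<bullet> \<nu> / (2 * k * norm l)) (Jmap br \<mu> x \<bullet> Jmap br l \<nu> / (2 * k * (norm l)\<^sup>2))"

lemma linear_jcoord:
  assumes h: "h_type br"
  shows "linear (jcoord br \<mu> l \<nu> k)"
proof -
  interpret J: linear "Jmap br \<mu>" by (rule linear_Jmap[OF h])
  show ?thesis
    by (rule linearI) (auto simp: jcoord_def J.add J.scaleR inner_add_left add_divide_distrib complex_eq_iff)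
qed

lemma jcoord_jplane:
  assumes h: "h_type br" and l: "l \<noteq> 0" and k: "k \<noteq> 0" and \<mu>: "\<mu> \<bullet> sgn l = 2 * k * (norm l)\<^sup>2" and \<nu>: "norm \<nu> = 1"
  shows "jcoord br \<mu> l \<nu> k (jplane br l \<nu> z) = z"
proof -
  interpret J: linear "Jmap br \<mu>" by (rule linear_Jmap[OF h])
  have \<nu>\<nu>: "\<nu> \<bullet> \<nu> = 1" using \<nu> by (simp add: dot_square_norm)
  have ml: "\<mu> \<bullet> l = 2 * k * (norm l) ^ 3"
    using \<mu> l by (simp add: sgn_div_norm field_simps power2_eq_square power3_eq_cube)
  have 1: "Jmap br \<mu> \<nu> \<bullet> Jmap br l \<nu> = 2 * k * (norm l) ^ 3"
    by (simp add: Jmap_inner_Jmap[OF h] \<nu>\<nu> ml)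
  have 2: "Jmap br \<mu> (Jmap br l \<nu>) \<bullet> \<nu> = - (2 * k * (norm l) ^ 3)"
    using 1 Jmap_skew[OF h, of \<mu> "Jmap br l \<nu>" \<nu>] by (simp add: inner_commute)
  show ?thesis
    using l k by (simp add: jcoord_def jplane_def J.scaleR J.diff inner_diff_left 1 2 Jmap_inner_self[OF h] complex_eq_iff
        power2_eq_square power3_eq_cube field_simps)
qed

lemma jplane_phase:
  assumes h: "h_type br" and l: "l \<noteq> 0" and k: "k \<noteq> 0"
  shows "\<mu> \<bullet> vbr br w (jplane br l \<nu> z) / 2 = k * Im (cnj (jcoord br \<mu> l \<nu> k w) * z)"
proof -
  have "\<mu> \<bullet> vbr br w (jplane br l \<nu> z) = Jmap br \<mu> w \<bullet> jplane br l \<nu> z"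
    by (simp add: Jmap_inner[OF h])
  also have "\<dots> = (1 / norm l) * (Im z * (Jmap br \<mu> w \<bullet> \<nu>) - Re z / norm l * (Jmap br \<mu> w \<bullet> Jmap br l \<nu>))"
    by (simp only: jplane_def inner_scaleR_right inner_diff_right)
  finally have 1: "\<mu> \<bullet> vbr br w (jplane br l \<nu> z) = \<dots>" .
  show ?thesis unfolding 1
    using l k by (simp add: jcoord_def power2_eq_square field_simps)
qed

text \<open>The right-hand side displays the adjoint of \<open>jplane br l y z\<close> as a map of
  y. By \<open>jplane_adjoint_inner\<close> it multiplies inner products by |z|^2 / |l|^2, which is
  what the Gaussian integral over y calls for.\<close>

lemma jplane_inner:
  assumes h: "h_type br"
  shows "u \<bullet> jplane br l y z = ((1 / norm l) *\<^sub>R (Im z *\<^sub>R u + (Re z / norm l) *\<^sub>R Jmap br l u)) \<bullet> y"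
  by (simp add: jplane_def inner_diff_right inner_add_left Jmap_skew[OF h] algebra_simps)

lemma jplane_adjoint_inner:
  assumes h: "h_type br" and l: "l \<noteq> 0"
  shows "((1 / norm l) *\<^sub>R (Im z *\<^sub>R u + (Re z / norm l) *\<^sub>R Jmap br l u)) \<bullet>
    ((1 / norm l) *\<^sub>R (Im z *\<^sub>R u' + (Re z / norm l) *\<^sub>R Jmap br l u')) = (norm z)\<^sup>2 / (norm l)\<^sup>2 * (u \<bullet> u')"
proof -
  have 1: "u \<bullet> Jmap br l u' + Jmap br l u \<bullet> u' = 0" by (simp add: Jmap_skew[OF h])
  have "(Im z *\<^sub>R u + (Re z / norm l) *\<^sub>R Jmap br l u) \<bullet> (Im z *\<^sub>R u' + (Re z / norm l) *\<^sub>R Jmap br l u') =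
    (Im z)\<^sup>2 * (u \<bullet> u') + Im z * (Re z / norm l) * (u \<bullet> Jmap br l u' + Jmap br l u \<bullet> u') + (Re z / norm l)\<^sup>2 * ((norm l)\<^sup>2 * (u \<bullet> u'))"
    by (simp add: inner_add_left inner_add_right Jmap_inner_same[OF h] power2_eq_square algebra_simps)
  also have "\<dots> = (norm z)\<^sup>2 * (u \<bullet> u')"
    using l unfolding 1 cmod_power2 by (simp add: power2_eq_square field_simps)
  finally show ?thesis by (simp add: power2_eq_square)
qed

lemma jplane_norm:
  assumes h: "h_type br" and l: "l \<noteq> 0"
  shows "jplane br l y z \<bullet> jplane br l y z = (norm z)\<^sup>2 / (norm l)\<^sup>2 * (y \<bullet> y)"
proof -
  have "(Im z *\<^sub>R y - (Re z / norm l) *\<^sub>R Jmap br l y) \<bullet> (Im z *\<^sub>R y - (Re z / norm l) *\<^sub>R Jmap br l y) =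
    (Im z)\<^sup>2 * (y \<bullet> y) - 2 * Im z * (Re z / norm l) * (Jmap br l y \<bullet> y) + (Re z / norm l)\<^sup>2 * ((norm l)\<^sup>2 * (y \<bullet> y))"
    by (simp add: inner_diff_left inner_diff_right Jmap_inner_same[OF h] inner_commute power2_eq_square algebra_simps)
  also have "\<dots> = (norm z)\<^sup>2 * (y \<bullet> y)"
    using l unfolding cmod_power2 by (simp add: Jmap_inner_self[OF h] power2_eq_square field_simps)
  finally show ?thesis by (simp add: jplane_def power2_eq_square)
qed

lemma integral_pair_mult:
  fixes f :: "'a::euclidean_space \<Rightarrow> complex" and g :: "'b::euclidean_space \<Rightarrow> complex"
  assumes f: "integrable lborel f" and g: "integrable lborel g"
  shows "(LINT p|(lborel \<Otimes>\<^sub>M lborel). f (fst p) * g (snd p)) = (LINT x|lborel. f x) * (LINT y|lborel. g y)"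
proof -
  have "(LINT p|(lborel \<Otimes>\<^sub>M lborel). f (fst p) * g (snd p)) = (LINT x|lborel. LINT y|lborel. f x * g y)"
    using lborel_pair.integral_fst'[OF integrable_pair_mult[OF f g]] by simp
  then show ?thesis by simp
qed

text \<open>Integration over y first leaves a multiple of (1 + c |z|^2)^(-n), which is integrable
  over the plane just when n > 1.\<close>

lemma integrable_plane_weight:
  fixes c :: real
  assumes c: "c > 0" and d: "DIM('v::euclidean_space) = 2 * n" and n: "2 \<le> n"
  shows "integrable (lborel \<Otimes>\<^sub>M lborel) (\<lambda>p. exp (- (1 + c * (norm (fst p :: complex))\<^sup>2) * (snd p \<bullet> (snd p :: 'v))))"
proof (rule lborel_pair.Fubini_integrable)
  have S: "1 + c * (norm z)\<^sup>2 > 0" for z :: complex using c by (simp add: add_pos_nonneg)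
  have i: "integrable lborel (\<lambda>y::'v. exp (- (1 + c * (norm z)\<^sup>2) * (y \<bullet> y)))" for z :: complex
    using integrable_norm[OF integrable_gaussian_cis[OF S[of z], of "0::'v"]] by (simp add: norm_mult)
  have e: "(LINT y::'v|lborel. exp (- (1 + c * (norm z)\<^sup>2) * (y \<bullet> y))) = (pi / (1 + c * (norm z)\<^sup>2)) ^ n" for z :: complex
  proof -
    have "of_real (LINT y::'v|lborel. exp (- (1 + c * (norm z)\<^sup>2) * (y \<bullet> y))) =
      (of_real (sqrt (pi / (1 + c * (norm z)\<^sup>2)) ^ DIM('v)) :: complex)"
      using integral_gaussian_cis[OF S[of z], of "0::'v"] by (simp flip: integral_complex_of_real)
    then have "(LINT y::'v|lborel. exp (- (1 + c * (norm z)\<^sup>2) * (y \<bullet> y))) = sqrt (pi / (1 + c * (norm z)\<^sup>2)) ^ DIM('v)"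
      by (simp only: of_real_eq_iff)
    moreover have "0 \<le> pi / (1 + c * (norm z)\<^sup>2)" using less_imp_le[OF S[of z]] by simp
    ultimately show ?thesis by (simp only: d power_mult real_sqrt_pow2)
  qed
  have "integrable lborel (\<lambda>z::complex. (pi / (1 + c * (norm z)\<^sup>2)) ^ n)"
  proof (rule Bochner_Integration.integrable_bound)
    show "integrable lborel (\<lambda>z::complex. pi ^ n * (1 / (1 + c * (norm z)\<^sup>2))\<^sup>2)"
      by (intro integrable_mult_right radial_integrable2[OF c, of 1]) auto
    have "(1 / (1 + c * (norm z)\<^sup>2)) ^ n \<le> (1 / (1 + c * (norm z)\<^sup>2))\<^sup>2" for z :: complex
      using c n by (intro power_decreasing) (auto simp: divide_simps add_pos_nonneg)
    then have "pi ^ n * (1 / (1 + c * (norm z)\<^sup>2)) ^ n \<le> pi ^ n * (1 / (1 + c * (norm z)\<^sup>2))\<^sup>2" for z :: complex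
      by (intro mult_left_mono) auto
    then show "AE z::complex in lborel. norm ((pi / (1 + c * (norm z)\<^sup>2)) ^ n) \<le> norm (pi ^ n * (1 / (1 + c * (norm z)\<^sup>2))\<^sup>2)"
      using less_imp_le[OF S] by (intro AE_I2) (simp add: power_divide)
  qed measurable
  then show "integrable lborel (\<lambda>z. LINT y|lborel. norm (exp (- (1 + c * (norm (fst (z, y) :: complex))\<^sup>2) * (snd (z, y) \<bullet> (snd (z, y) :: 'v)))))"
    by (simp only: fst_conv snd_conv real_norm_def abs_exp_cancel e)
  show "AE z in lborel. integrable lborel (\<lambda>y. exp (- (1 + c * (norm (fst (z, y) :: complex))\<^sup>2) * (snd (z, y) \<bullet> (snd (z, y) :: 'v))))"
    using i by (simp only: fst_conv snd_conv) simp
qed measurable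

text \<open>The bilinear square of \<open>\<kappa> (w + \<i> J w) - a\<close>, where \<open>a\<close> is the complex vector with
  \<open>a \<cdot> x = X A(x) + (\<i>/2) (conjugate of A(x))\<close> for \<open>A(x) = \<xi> \<cdot> x + \<i> \<xi> \<cdot> J x\<close>; the terms quadratic in \<open>w\<close> cancel.\<close>
lemma complex_structure_square:
  fixes J :: "'v::euclidean_space \<Rightarrow> 'v" and \<xi> w :: 'v and X :: complex and \<kappa> :: real
  assumes J1: "\<And>x y. J x \<bullet> y = - (x \<bullet> J y)" and J2: "\<And>x y. J x \<bullet> J y = x \<bullet> y"
  defines "p \<equiv> \<kappa> *\<^sub>R w - Re X *\<^sub>R \<xi> - (Im X - 1/2) *\<^sub>R J \<xi>"
    and "q \<equiv> \<kappa> *\<^sub>R J w - (Im X + 1/2) *\<^sub>R \<xi> + Re X *\<^sub>R J \<xi>"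
  shows "of_real (p \<bullet> p) - of_real (q \<bullet> q) + 2 * \<i> * of_real (p \<bullet> q) =
    4 * X * (\<i> / 2) * of_real (\<xi> \<bullet> \<xi>) - 4 * of_real \<kappa> * X * Complex (\<xi> \<bullet> w) (\<xi> \<bullet> J w)"
proof -
  have z: "x \<bullet> J x = 0" for x using J1[of x x] by (simp add: inner_commute)
  have c: "w \<bullet> J \<xi> = - (\<xi> \<bullet> J w)" using J1[of \<xi> w] by (simp add: inner_commute)
  have F: "w \<bullet> \<xi> = \<xi> \<bullet> w" "w \<bullet> J w = 0" "J w \<bullet> w = 0" "\<xi> \<bullet> J \<xi> = 0" "J \<xi> \<bullet> \<xi> = 0" "J w \<bullet> \<xi> = \<xi> \<bullet> J w"
    "w \<bullet> J \<xi> = - (\<xi> \<bullet> J w)" "J \<xi> \<bullet> w = - (\<xi> \<bullet> J w)" "J \<xi> \<bullet> J w = \<xi> \<bullet> w" "J w \<bullet> J \<xi> = \<xi> \<bullet> w"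
    "J w \<bullet> J w = w \<bullet> w" "J \<xi> \<bullet> J \<xi> = \<xi> \<bullet> \<xi>"
    using z[of w] z[of \<xi>] c J2[of w \<xi>] J2[of \<xi> w] J2[of w w] J2[of \<xi> \<xi>] J1[of \<xi> w]
    by (simp_all only: inner_commute[of w \<xi>] inner_commute[of "J w" w] inner_commute[of "J \<xi>" \<xi>] inner_commute[of "J w" \<xi>])
  note E = inner_diff_left inner_diff_right inner_add_left inner_add_right inner_scaleR_left inner_scaleR_right F
  have pp: "p \<bullet> p = \<kappa>\<^sup>2 * (w \<bullet> w) + (Re X)\<^sup>2 * (\<xi> \<bullet> \<xi>) + (Im X - 1/2)\<^sup>2 * (\<xi> \<bullet> \<xi>) - 2 * \<kappa> * Re X * (\<xi> \<bullet> w)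
      + 2 * \<kappa> * (Im X - 1/2) * (\<xi> \<bullet> J w)"
    unfolding p_def by (simp only: E) algebra
  have qq: "q \<bullet> q = \<kappa>\<^sup>2 * (w \<bullet> w) + (Im X + 1/2)\<^sup>2 * (\<xi> \<bullet> \<xi>) + (Re X)\<^sup>2 * (\<xi> \<bullet> \<xi>) - 2 * \<kappa> * (Im X + 1/2) * (\<xi> \<bullet> J w)
      + 2 * \<kappa> * Re X * (\<xi> \<bullet> w)"
    unfolding q_def by (simp only: E) algebra
  have pq: "p \<bullet> q = - 2 * Im X * \<kappa> * (\<xi> \<bullet> w) - 2 * Re X * \<kappa> * (\<xi> \<bullet> J w) + Re X * (\<xi> \<bullet> \<xi>)"
    unfolding p_def q_def by (simp only: E) algebra
  show ?thesis unfolding pp qq pq by (simp add: complex_eq_iff power2_eq_square algebra_simps)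
qed

text \<open>The substitution p = |y| z in the plane of y / |y| passes from a unit vector to an
  arbitrary y \<noteq> 0, so that an average over directions can be taken as a Gaussian integral
  over the whole space.\<close>

lemma circle_null_plane_scaled:
  fixes br :: "'v::euclidean_space \<times> 'z::euclidean_space \<Rightarrow> 'v \<times> 'z \<Rightarrow> 'v \<times> 'z" and g \<phi> :: "'v \<Rightarrow> complex"
  assumes h: "h_type br" and k: "k > 0" and l: "l \<noteq> 0" and \<mu>: "\<mu> \<bullet> sgn l = 2 * real k * (norm l)\<^sup>2"
    and null: "\<And>\<nu>. norm \<nu> = 1 \<Longrightarrow> circle_null g (jplane br l \<nu>) (\<lambda>w z. \<mu> \<bullet> vbr br w (jplane br l \<nu> z) / 2) k"
    and \<phi> [measurable]: "\<phi> \<in> borel_measurable borel" and b: "\<And>x. norm (\<phi> x) \<le> C" and y: "y \<noteq> 0"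
  shows "(LINT w|lborel. g w * (LINT z|lborel. \<phi> (w - jplane br l y z) *
     (cis (\<mu> \<bullet> vbr br w (jplane br l y z) / 2) * of_real (exp (- (real k / 2) * ((norm z)\<^sup>2 * (y \<bullet> y))))))) = 0"
proof -
  define \<nu> where "\<nu> = (1 / norm y) *\<^sub>R y"
  have \<nu>: "norm \<nu> = 1" using y by (simp add: \<nu>_def)
  have k': "real k \<noteq> 0" using k by simp
  have "(LINT p|lborel. \<phi> (w - jplane br l \<nu> p) *
     (cis (\<mu> \<bullet> vbr br w (jplane br l \<nu> p) / 2) * of_real (exp (- (real k / 2) * (norm p)\<^sup>2)))) =
    of_real ((norm y)\<^sup>2) * (LINT z|lborel. \<phi> (w - jplane br l y z) *
     (cis (\<mu> \<bullet> vbr br w (jplane br l y z) / 2) * of_real (exp (- (real k / 2) * ((norm z)\<^sup>2 * (y \<bullet> y))))))" for w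
  proof -
    have [measurable]: "(\<lambda>p. vbr br w (jplane br l \<nu> p)) \<in> borel_measurable borel"
      by (rule vbr_measurable[OF h]) auto
    interpret E: linear "jplane br l \<nu>" by (rule linear_jplane)
    have e: "jplane br l \<nu> (norm y *\<^sub>R z) = jplane br l y z" for z
    proof -
      have "y = norm y *\<^sub>R \<nu>" using y by (simp add: \<nu>_def)
      then show ?thesis by (metis E.scaleR jplane_scaleR[OF h])
    qed
    have n: "(norm (norm y *\<^sub>R z))\<^sup>2 = (norm z)\<^sup>2 * (y \<bullet> y)" for z :: complex
      by (simp add: power_mult_distrib power2_norm_eq_inner[of y])
    define F where "F p = \<phi> (w - jplane br l \<nu> p) *
     (cis (\<mu> \<bullet> vbr br w (jplane br l \<nu> p) / 2) * of_real (exp (- (real k / 2) * (norm p)\<^sup>2)))" for p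
    have "(LINT p|lborel. F p) = \<bar>norm y\<bar> ^ DIM(complex) *\<^sub>R (LINT z|lborel. F (norm y *\<^sub>R z))"
      using y by (intro integral_lborel_scaleR) (auto simp: F_def)
    then show ?thesis unfolding F_def e n by (simp add: scaleR_conv_of_real)
  qed
  moreover have "(LINT w|lborel. g w * (LINT p|lborel. \<phi> (w - jplane br l \<nu> p) *
     (cis (\<mu> \<bullet> vbr br w (jplane br l \<nu> p) / 2) * of_real (exp (- (real k / 2) * (norm p)\<^sup>2))))) = 0"
    by (rule circle_null_plane_gaussian[OF linear_jcoord[OF h, of \<mu> l \<nu> "real k"] linear_jplane
          jcoord_jplane[OF h l k' \<mu> \<nu>] jplane_phase[OF h l k'] k null[OF \<nu>] \<phi> b])
  ultimately have "(LINT w|lborel. of_real ((norm y)\<^sup>2) * (g w * (LINT z|lborel. \<phi> (w - jplane br l y z) *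
     (cis (\<mu> \<bullet> vbr br w (jplane br l y z) / 2) * of_real (exp (- (real k / 2) * ((norm z)\<^sup>2 * (y \<bullet> y)))))))) = 0"
    by (simp only: mult_ac)
  then show ?thesis unfolding integral_mult_right_zero using y by simp
qed

text \<open>The integral over \<open>y\<close> amounts to an average over all unit vectors \<open>y / |y|\<close>.\<close>
lemma circle_null_average:
  fixes br :: "'v::euclidean_space \<times> 'z::euclidean_space \<Rightarrow> 'v \<times> 'z \<Rightarrow> 'v \<times> 'z" and g \<phi> :: "'v \<Rightarrow> complex"
  assumes h: "h_type br" and d: "DIM('v) = 2 * n" and n: "2 \<le> n" and k: "k > 0" and l: "l \<noteq> 0"
    and \<mu>: "\<mu> \<bullet> sgn l = 2 * real k * (norm l)\<^sup>2" and g: "integrable lborel g"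
    and null: "\<And>\<nu>. norm \<nu> = 1 \<Longrightarrow> circle_null g (jplane br l \<nu>) (\<lambda>w z. \<mu> \<bullet> vbr br w (jplane br l \<nu> z) / 2) k"
    and \<phi> [measurable]: "\<phi> \<in> borel_measurable borel" and b: "\<And>x. norm (\<phi> x) \<le> C"
  shows "(LINT w|lborel. g w * (LINT z|lborel. LINT y|lborel. \<phi> (w - jplane br l y z) *
     (cis (\<mu> \<bullet> vbr br w (jplane br l y z) / 2) * of_real (exp (- (1 + real k / 2 * (norm z)\<^sup>2) * (y \<bullet> y)))))) = 0"
proof -
  have gm [measurable]: "g \<in> borel_measurable borel" using g by auto
  have C: "0 \<le> C" using b[of 0] norm_ge_zero order_trans by blast
  have k2: "real k / 2 > 0" using k by simp
  \<comment> \<open>The summand 1 is the Gaussian weight exp(- |y|^2) put on y; the other one is the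
    kernel of \<open>circle_null_plane_scaled\<close>.\<close>
  define H where "H p = exp (- (1 + real k / 2 * (norm (fst p))\<^sup>2) * (snd p \<bullet> snd p))" for p :: "complex \<times> 'v"
  have iH: "integrable (lborel \<Otimes>\<^sub>M lborel) H"
    unfolding H_def[abs_def] by (rule integrable_plane_weight[OF k2 d n])
  have Hm [measurable]: "H \<in> borel_measurable borel"
    using borel_measurable_integrable[OF iH] by (simp add: lborel_prod)
  have Jm: "(\<lambda>x. Jmap br l (f x)) \<in> borel_measurable M" if "f \<in> borel_measurable M" for f and M :: "'c measure"
    by (rule borel_measurable_continuous_on[OF _ that]) (intro linear_continuous_on_compose[OF continuous_on_id linear_Jmap[OF h]])
  define e where "e p = jplane br l (snd p) (fst p)" for p
  have em [measurable]: "e \<in> borel_measurable borel"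
  proof -
    have [measurable]: "(\<lambda>p::complex \<times> 'v. Jmap br l (snd p)) \<in> borel_measurable borel" by (rule Jm) measurable
    show ?thesis unfolding e_def jplane_def by measurable
  qed
  define R where "R w p = \<phi> (w - e p) * (cis (\<mu> \<bullet> vbr br w (e p) / 2) * of_real (H p))" for w p
  have Rm: "(\<lambda>q. R (fst q) (snd q)) \<in> borel_measurable (lborel \<Otimes>\<^sub>M lborel)"
  proof -
    have [measurable]: "(\<lambda>q. vbr br (fst q) (e (snd q))) \<in> borel_measurable (borel \<Otimes>\<^sub>M borel)"
      by (rule vbr_measurable[OF h]) measurable
    show ?thesis unfolding R_def by measurable
  qed
  have Rw [measurable]: "R w \<in> borel_measurable borel" for w
  proof -
    have [measurable]: "(\<lambda>p. vbr br w (e p)) \<in> borel_measurable borel"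
      by (rule vbr_measurable[OF h]) measurable
    show ?thesis unfolding R_def by measurable
  qed
  have Rp [measurable]: "(\<lambda>w. R w p) \<in> borel_measurable borel" for p
  proof -
    have [measurable]: "(\<lambda>w. vbr br w (e p)) \<in> borel_measurable borel"
      by (rule vbr_measurable[OF h]) measurable
    show ?thesis unfolding R_def by measurable
  qed
  have nR: "norm (R w p) \<le> C * H p" for w p
    using b by (auto simp: R_def norm_mult H_def intro!: mult_right_mono)
  have iH': "integrable lborel H" using iH by (simp add: lborel_prod)
  have iHc: "integrable lborel (\<lambda>p. of_real (C * H p) :: complex)"
    by (intro integrable_of_real integrable_mult_right iH')
  have iR: "integrable lborel (R w)" for w
    by (rule Bochner_Integration.integrable_bound[OF iHc])
       (simp, rule AE_I2, unfold norm_of_real, rule order_trans[OF nR abs_ge_self])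
  have gR: "norm (g w * R w p) \<le> norm (g w * of_real (C * H p))" for w p
    unfolding norm_mult norm_of_real[of "C * H p"] by (intro mult_left_mono order_trans[OF nR abs_ge_self] norm_ge_zero)
  have iF: "integrable (lborel \<Otimes>\<^sub>M lborel) (\<lambda>q. g (fst q) * R (fst q) (snd q))"
  proof (rule Bochner_Integration.integrable_bound)
    show "integrable (lborel \<Otimes>\<^sub>M lborel) (\<lambda>q. g (fst q) * of_real (C * H (snd q)))"
      by (rule integrable_pair_mult[OF g iHc])
    show "(\<lambda>q. g (fst q) * R (fst q) (snd q)) \<in> borel_measurable (lborel \<Otimes>\<^sub>M lborel)"
      using Rm by measurable
    show "AE q in lborel \<Otimes>\<^sub>M lborel. norm (g (fst q) * R (fst q) (snd q)) \<le> norm (g (fst q) * of_real (C * H (snd q)))"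
      by (rule AE_I2) (rule gR)
  qed
  have sw: "(LINT w|lborel. LINT p|lborel. g w * R w p) = (LINT p|lborel. LINT w|lborel. g w * R w p)"
    using lborel_pair.Fubini_integral[of "\<lambda>w p. g w * R w p"] iF by (simp add: case_prod_unfold)
  have ip: "integrable (lborel \<Otimes>\<^sub>M lborel) (\<lambda>p. LINT w|lborel. g w * R w p)"
  proof -
    have "integrable lborel (\<lambda>p. LINT w|lborel. g w * R w p)"
      using lborel_pair.integrable_snd[of "\<lambda>w p. g w * R w p"] iF by (simp add: case_prod_unfold)
    then show ?thesis by (simp add: lborel_prod)
  qed
  have "(LINT p|lborel. LINT w|lborel. g w * R w p) = (LINT p|(lborel \<Otimes>\<^sub>M lborel). LINT w|lborel. g w * R w p)"
    by (simp add: lborel_prod)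
  also have "\<dots> = (LINT y|lborel. LINT z|lborel. LINT w|lborel. g w * R w (z, y))"
    using lborel_pair.integral_snd[of "\<lambda>z y. LINT w|lborel. g w * R w (z, y)"] ip by (simp add: case_prod_unfold)
  also have "\<dots> = (LINT (y::'v)|lborel. 0)"
  proof (rule integral_cong_AE)
    show "(\<lambda>y. LINT z|lborel. LINT w|lborel. g w * R w (z, y)) \<in> borel_measurable lborel"
      using lborel_pair.integrable_snd[of "\<lambda>z y. LINT w|lborel. g w * R w (z, y)"] ip
      by (simp add: case_prod_unfold borel_measurable_integrable)
    show "AE y in lborel. (LINT z|lborel. LINT w|lborel. g w * R w (z, y)) = 0"
      \<comment> \<open>y = 0 has no direction, but is a null set.\<close>
      using AE_lborel_singleton[of "0::'v"]
    proof eventually_elim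
      fix y :: 'v assume y: "y \<noteq> 0"
      have y2: "real k / 2 * (y \<bullet> y) > 0" using y k by simp
      have Hs: "H (z, y) = exp (- (y \<bullet> y)) * exp (- (real k / 2 * (y \<bullet> y)) * (norm z)\<^sup>2)" for z
        unfolding H_def exp_add[symmetric] by (simp add: algebra_simps)
      have iz: "integrable lborel (\<lambda>z. of_real (C * H (z, y)) :: complex)"
        unfolding Hs by (intro integrable_of_real integrable_mult_right integrable_gaussian_complex[OF y2])
      have iy: "integrable (lborel \<Otimes>\<^sub>M lborel) (\<lambda>q. g (fst q) * R (fst q) (snd q, y))"
      proof (rule Bochner_Integration.integrable_bound)
        show "integrable (lborel \<Otimes>\<^sub>M lborel) (\<lambda>q. g (fst q) * of_real (C * H (snd q, y)))"
          by (rule integrable_pair_mult[OF g iz])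
        have "(\<lambda>q::'v \<times> complex. (\<lambda>q. R (fst q) (snd q)) (fst q, (snd q, y))) \<in> borel_measurable (lborel \<Otimes>\<^sub>M lborel)"
          by (rule measurable_compose[OF _ Rm]) (auto simp: lborel_prod[symmetric])
        then show "(\<lambda>q. g (fst q) * R (fst q) (snd q, y)) \<in> borel_measurable (lborel \<Otimes>\<^sub>M lborel)"
          by simp
        show "AE q in lborel \<Otimes>\<^sub>M lborel. norm (g (fst q) * R (fst q) (snd q, y)) \<le> norm (g (fst q) * of_real (C * H (snd q, y)))"
          by (rule AE_I2) (rule gR)
      qed
      have "(LINT z|lborel. LINT w|lborel. g w * R w (z, y)) = (LINT w|lborel. LINT z|lborel. g w * R w (z, y))"
        using lborel_pair.Fubini_integral[of "\<lambda>w z. g w * R w (z, y)"] iy by (simp add: case_prod_unfold)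
      also have "\<dots> = (LINT w|lborel. of_real (exp (- (y \<bullet> y))) * (g w * (LINT z|lborel. \<phi> (w - jplane br l y z) *
         (cis (\<mu> \<bullet> vbr br w (jplane br l y z) / 2) * of_real (exp (- (real k / 2) * ((norm z)\<^sup>2 * (y \<bullet> y))))))))"
      proof (rule Bochner_Integration.integral_cong[OF refl])
        fix w
        have "g w * R w (z, y) = (of_real (exp (- (y \<bullet> y))) * g w) * (\<phi> (w - jplane br l y z) *
         (cis (\<mu> \<bullet> vbr br w (jplane br l y z) / 2) * of_real (exp (- (real k / 2) * ((norm z)\<^sup>2 * (y \<bullet> y))))))" for z
          unfolding R_def e_def Hs fst_conv snd_conv of_real_mult by (simp add: mult_ac)
        then show "(LINT z|lborel. g w * R w (z, y)) = of_real (exp (- (y \<bullet> y))) * (g w * (LINT z|lborel. \<phi> (w - jplane br l y z) *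
         (cis (\<mu> \<bullet> vbr br w (jplane br l y z) / 2) * of_real (exp (- (real k / 2) * ((norm z)\<^sup>2 * (y \<bullet> y)))))))"
          by (simp only: integral_mult_right_zero mult.assoc)
      qed
      also have "\<dots> = of_real (exp (- (y \<bullet> y))) * (LINT w|lborel. g w * (LINT z|lborel. \<phi> (w - jplane br l y z) *
         (cis (\<mu> \<bullet> vbr br w (jplane br l y z) / 2) * of_real (exp (- (real k / 2) * ((norm z)\<^sup>2 * (y \<bullet> y)))))))"
        by (rule integral_mult_right_zero)
      also have "\<dots> = of_real (exp (- (y \<bullet> y))) * 0"
        by (rule arg_cong[where f = "(*) _"], rule circle_null_plane_scaled[OF h k l \<mu> _ \<phi> b y]) (rule null)
      also have "\<dots> = 0" by simp
      finally show "(LINT z|lborel. LINT w|lborel. g w * R w (z, y)) = 0" .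
    qed
  qed simp
  finally have "(LINT w|lborel. LINT p|lborel. g w * R w p) = 0" using sw by simp
  moreover have "(LINT p|lborel. g w * R w p) = g w * (LINT z|lborel. LINT y|lborel. R w (z, y))" for w
  proof -
    have "integrable (lborel \<Otimes>\<^sub>M lborel) (R w)" using iR[of w] by (simp add: lborel_prod)
    from lborel_pair.integral_fst'[OF this]
    have "(LINT p|lborel. R w p) = (LINT z|lborel. LINT y|lborel. R w (z, y))"
      by (simp add: lborel_prod)
    then show ?thesis by simp
  qed
  ultimately have "(LINT w|lborel. g w * (LINT z|lborel. LINT y|lborel. R w (z, y))) = 0" by (simp only:)
  then show ?thesis by (simp only: R_def e_def H_def fst_conv snd_conv)
qed

text \<open>Tested with the Gaussian exponentials \<open>\<phi>\<close>, the averaged equations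
  involve only Gaussian integrals over y and give \<open>U w * exp (X * B (w, z))\<close> with B
  affine in \<open>A w\<close>. The coefficient of X^j is a combination of the moments N 0, ..., N j
  whose top term has the factor \<open>e 0 j\<close>, a positive radial moment. Hence all moments
  vanish, and their exponential series is the Fourier transform of g times a Gaussian.\<close>

lemma circle_null_all_directions:
  fixes br :: "'v::euclidean_space \<times> 'z::euclidean_space \<Rightarrow> 'v \<times> 'z \<Rightarrow> 'v \<times> 'z" and g :: "'v \<Rightarrow> complex"
  assumes h: "h_type br" and d: "DIM('v) = 2 * n" and n: "2 \<le> n" and k: "k > 0" and l: "l \<noteq> 0"
    and \<mu>: "\<mu> \<bullet> sgn l = 2 * real k * (norm l)\<^sup>2" and g: "integrable lborel g"
    and null: "\<And>\<nu>. norm \<nu> = 1 \<Longrightarrow> circle_null g (jplane br l \<nu>) (\<lambda>w z. \<mu> \<bullet> vbr br w (jplane br l \<nu> z) / 2) k"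
  shows "AE w in lborel. g w = 0"
proof -
  interpret J\<mu>: linear "Jmap br \<mu>" by (rule linear_Jmap[OF h])
  have gm [measurable]: "g \<in> borel_measurable borel" using g by auto
  define L where "L = norm l"
  have L: "L > 0" using l by (simp add: L_def)
  define \<kappa> where "\<kappa> = norm \<mu> / 2"
  \<comment> \<open>Cauchy-Schwarz: |\<mu>| measures the twist on the whole space, k only its
    restriction to the planes.\<close>
  have "2 * real k * L\<^sup>2 \<le> norm \<mu> * norm (sgn l)"
    using \<mu> norm_cauchy_schwarz[of \<mu> "sgn l"] by (simp add: L_def)
  then have k\<kappa>: "real k * L\<^sup>2 \<le> \<kappa>" using l by (simp add: \<kappa>_def norm_sgn)
  have kL: "real k * L\<^sup>2 > 0" using k L by simp
  have \<kappa>: "\<kappa> > 0" using k\<kappa> kL by linarith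
  have \<mu>0: "\<mu> \<noteq> 0" using \<kappa> by (auto simp: \<kappa>_def)
  \<comment> \<open>Two Gaussians in y are multiplied: k/2 comes from the plane kernel, and
    \<kappa>/2 from G on the plane, where lengths are scaled by 1/L.\<close>
  define q where "q = real k / 2 + \<kappa> / (2 * L\<^sup>2)"
  have q: "q > 0" unfolding q_def using k \<kappa> L by (intro add_pos_pos) auto
  have qL: "q * L\<^sup>2 = (real k * L\<^sup>2 + \<kappa>) / 2" using L by (simp add: q_def field_simps)
  \<comment> \<open>Equal to 2 \<kappa> / (k L^2 + \<kappa>): the lower bound 1 is Cauchy-Schwarz,
    the strict upper bound 2 is k > 0.\<close>
  define \<theta> where "\<theta> = \<kappa> / (q * L\<^sup>2)"
  have \<theta>: "1 \<le> \<theta>" "\<theta> < 2" unfolding \<theta>_def qL using k\<kappa> kL \<kappa> by (simp_all add: field_simps)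
  define J where "J w = (1 / norm \<mu>) *\<^sub>R Jmap br \<mu> w" for w
  have J1: "J x \<bullet> y = - (x \<bullet> J y)" for x y by (simp add: J_def Jmap_skew[OF h])
  have J2: "J x \<bullet> J y = x \<bullet> y" for x y
    using \<mu>0 by (simp add: J_def Jmap_inner_same[OF h] power2_eq_square)
  have Jlin: "linear J" unfolding J_def by (rule linearI) (auto simp: J\<mu>.add J\<mu>.scaleR algebra_simps)
  interpret J: linear J by fact
  have phase: "\<mu> \<bullet> vbr br w e / 2 = \<kappa> * (J w \<bullet> e)" for w e
    using \<mu>0 by (simp add: Jmap_inner[OF h, symmetric] J_def \<kappa>_def)
  \<comment> \<open>The exponent \<kappa>/2 matches the twist \<kappa> on the whole space; this is
    what cancels the terms quadratic in w produced by the integration over y.\<close>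
  define G :: "'v \<Rightarrow> complex" where "G w = of_real (exp (- (\<kappa> / 2) * (norm w)\<^sup>2))" for w
  define S where "S z = 1 + q * (norm z)\<^sup>2" for z :: complex
  define v where "v z = q * (norm z)\<^sup>2 / S z" for z
  have S1: "S z \<ge> 1" for z using q by (simp add: S_def)
  have S0: "S z > 0" for z using S1[of z] by linarith
  have v01: "0 \<le> v z" "v z \<le> 1" for z
    using S0[of z] q by (auto simp: v_def S_def divide_simps)
  have ab: "\<bar>1 - \<theta> * v z\<bar> \<le> 1" for z
  proof -
    have "\<theta> * v z \<le> 2 * 1" using v01 \<theta> by (intro mult_mono) auto
    moreover have "0 \<le> \<theta> * v z" using v01 \<theta> by simp
    ultimately show ?thesis by (simp add: abs_le_iff)
  qed
  have Sm [measurable]: "S \<in> borel_measurable borel" unfolding S_def by measurable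
  have vm [measurable]: "v \<in> borel_measurable borel" unfolding v_def by measurable
  have iSn: "integrable lborel (\<lambda>z. (of_real ((1 / S z) ^ n * b z) :: complex))"
    if [measurable]: "b \<in> borel_measurable borel" and b: "\<And>z. \<bar>b z\<bar> \<le> 1" for b :: "complex \<Rightarrow> real"
  proof (rule Bochner_Integration.integrable_bound)
    show "integrable lborel (\<lambda>z. (1 / S z)\<^sup>2)" unfolding S_def by (rule radial_integrable2[OF q \<theta>])
    have "(1 / S z) ^ n * \<bar>b z\<bar> \<le> (1 / S z)\<^sup>2 * 1" for z
      using S1[of z] S0[of z] n b[of z] by (intro mult_mono power_decreasing) (auto simp: divide_simps)
    then show "AE z in lborel. norm (of_real ((1 / S z) ^ n * b z) :: complex) \<le> norm ((1 / S z)\<^sup>2)"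
      using less_imp_le[OF S0] by (intro AE_I2) (simp only: norm_of_real, simp add: abs_mult)
  qed measurable
  have "AE w in lborel. g w * G w = 0"
  proof (rule fourier_uniqueness)
    have Gm [measurable]: "G \<in> borel_measurable borel" unfolding G_def by measurable
    have "norm (G w) \<le> 1" for w using \<kappa> by (simp add: G_def)
    then show "integrable lborel (\<lambda>w. g w * G w)" by (rule integrable_bounded_mult[OF g Gm])
    fix \<xi> :: 'v
    define A where "A w = Complex (\<xi> \<bullet> w) (\<xi> \<bullet> J w)" for w
    have cA: "continuous_on UNIV A"
      unfolding A_def by (intro continuous_intros linear_continuous_on_compose[OF continuous_on_id Jlin])
    have Am [measurable]: "A \<in> borel_measurable borel" by (rule borel_measurable_continuous_onI[OF cA])
    have nA: "norm (A w) \<le> 2 * norm \<xi> * norm w" for w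
    proof -
      have "norm (J w) = norm w" using J2[of w w] by (simp add: norm_eq_sqrt_inner)
      then have "\<bar>\<xi> \<bullet> w\<bar> \<le> norm \<xi> * norm w" "\<bar>\<xi> \<bullet> J w\<bar> \<le> norm \<xi> * norm w"
        using Cauchy_Schwarz_ineq2[of \<xi> w] Cauchy_Schwarz_ineq2[of \<xi> "J w"] by auto
      then show ?thesis using cmod_le[of "A w"] by (simp add: A_def)
    qed
    \<comment> \<open>Chosen such that Y A(w) + Y cnj (A(w)) = i \<xi> . w. The factor with the
      conjugate goes into U at once; the one with A is recovered at the end by summing the moments N
      with parameter Y.\<close>
    define Y where "Y = \<i> / 2"
    define U where "U w = exp (Y * cnj (A w)) * G w" for w
    have Um [measurable]: "U \<in> borel_measurable borel" unfolding U_def by measurable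
    have bU: "norm (U w) * exp (r * norm (A w)) \<le> exp (((1 / 2 + r) * (2 * norm \<xi>))\<^sup>2 / (4 * (\<kappa> / 2)))" if r: "0 \<le> r" for r w
    proof -
      have "norm (exp (Y * cnj (A w))) \<le> exp (norm (Y * cnj (A w)))" by (rule norm_exp)
      also have "norm (Y * cnj (A w)) = 1 / 2 * norm (A w)" by (simp add: Y_def norm_mult)
      finally have "norm (U w) * exp (r * norm (A w)) \<le> exp (1 / 2 * norm (A w)) * exp (- (\<kappa> / 2) * (norm w)\<^sup>2) * exp (r * norm (A w))"
        by (intro mult_right_mono) (auto simp: U_def G_def norm_mult intro!: mult_right_mono)
      also have "\<dots> = exp ((1 / 2 + r) * norm (A w)) * exp (- (\<kappa> / 2) * (norm w)\<^sup>2)"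
        by (simp add: algebra_simps exp_add)
      also have "\<dots> \<le> exp (((1 / 2 + r) * (2 * norm \<xi>)) * norm w) * exp (- (\<kappa> / 2) * (norm w)\<^sup>2)"
        using mult_left_mono[OF nA[of w], of "1 / 2 + r"] r by (intro mult_right_mono) (auto simp: mult_ac)
      also have "\<dots> \<le> exp (((1 / 2 + r) * (2 * norm \<xi>))\<^sup>2 / (4 * (\<kappa> / 2)))"
        by (rule exp_linear_gaussian_le) (use \<kappa> in simp)
      finally show ?thesis .
    qed
    define c where "c = (\<xi> \<bullet> \<xi>) / (q * L\<^sup>2)"
    have c0: "0 \<le> c" using q L by (simp add: c_def)
    \<comment> \<open>The coefficient of X in the exponent that the integration over y
      leaves.\<close>
    define B where "B p = Y * of_real (v (snd p) * c) + of_real (1 - \<theta> * v (snd p)) * A (fst p)" for p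
    define W where "W p = (g (fst p) * U (fst p)) * of_real ((1 / S (snd p)) ^ n * 1)" for p
    have Wm [measurable]: "W \<in> borel_measurable (lborel \<Otimes>\<^sub>M lborel)" unfolding W_def by measurable
    have Bm [measurable]: "B \<in> borel_measurable (lborel \<Otimes>\<^sub>M lborel)" unfolding B_def by measurable
    have nB: "norm (B p) \<le> c + norm (A (fst p))" for p
    proof -
      have "norm (B p) \<le> norm (Y * of_real (v (snd p) * c)) + norm (of_real (1 - \<theta> * v (snd p)) * A (fst p))"
        unfolding B_def by (rule norm_triangle_ineq)
      also have "norm (Y * of_real (v (snd p) * c)) \<le> c"
      proof -
        have "norm (Y * of_real (v (snd p) * c)) = v (snd p) * c / 2"
          using v01[of "snd p"] c0 by (simp add: Y_def norm_mult)
        also have "v (snd p) * c \<le> 1 * c" by (intro mult_right_mono v01 c0)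
        finally show ?thesis using c0 by simp
      qed
      also have "norm (of_real (1 - \<theta> * v (snd p)) * A (fst p)) \<le> norm (A (fst p))"
        using ab[of "snd p"] by (simp only: norm_mult norm_of_real) (intro mult_left_le_one_le; simp)
      finally show ?thesis by simp
    qed
    have dom: "integrable (lborel \<Otimes>\<^sub>M lborel) (\<lambda>p. norm (W p) * exp (norm (X * B p)))" for X
    proof -
      define r where "r = norm X"
      have iw: "integrable lborel (\<lambda>w. g w * (of_real (exp (r * c)) * (U w * of_real (exp (r * norm (A w))))))"
      proof (rule integrable_bounded_mult[OF g])
        fix w
        show "norm (of_real (exp (r * c)) * (U w * of_real (exp (r * norm (A w))))) \<le>
          exp (r * c) * exp (((1 / 2 + r) * (2 * norm \<xi>))\<^sup>2 / (4 * (\<kappa> / 2)))"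
          using bU[of r w] by (simp add: norm_mult r_def)
      qed measurable
      have "integrable (lborel \<Otimes>\<^sub>M lborel) (\<lambda>p. (g (fst p) * (of_real (exp (r * c)) * (U (fst p) * of_real (exp (r * norm (A (fst p))))))) *
        of_real ((1 / S (snd p)) ^ n * 1))"
        by (rule integrable_pair_mult[OF iw iSn]) auto
      then show ?thesis
      proof (rule Bochner_Integration.integrable_bound)
        have "norm (W p) * exp (norm (X * B p)) \<le> norm ((g (fst p) * (of_real (exp (r * c)) * (U (fst p) * of_real (exp (r * norm (A (fst p))))))) *
          (of_real ((1 / S (snd p)) ^ n * 1) :: complex))" for p
        proof -
          have "norm (X * B p) \<le> r * c + r * norm (A (fst p))"
            using mult_left_mono[OF nB[of p], of r] by (simp add: norm_mult r_def algebra_simps)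
          then have "norm (W p) * exp (norm (X * B p)) \<le> norm (W p) * (exp (r * c) * exp (r * norm (A (fst p))))"
            by (intro mult_left_mono) (auto simp flip: exp_add)
          then show ?thesis by (simp add: W_def norm_mult mult_ac)
        qed
        then show "AE p in lborel \<Otimes>\<^sub>M lborel. norm (norm (W p) * exp (norm (X * B p))) \<le> norm ((g (fst p) * (of_real (exp (r * c)) * (U (fst p) * of_real (exp (r * norm (A (fst p))))))) *
          (of_real ((1 / S (snd p)) ^ n * 1) :: complex))"
          by (intro AE_I2) (simp only: real_norm_def abs_mult abs_norm_cancel abs_exp_cancel)
      qed measurable
    qed
    have zero: "(LINT p|(lborel \<Otimes>\<^sub>M lborel). W p * exp (X * B p)) = 0" for X
    proof -
      define \<phi> where "\<phi> x = exp (X * A x) * U x" for x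
      have \<phi>m [measurable]: "\<phi> \<in> borel_measurable borel" unfolding \<phi>_def by measurable
      have b\<phi>: "norm (\<phi> w) \<le> exp (((1 / 2 + norm X) * (2 * norm \<xi>))\<^sup>2 / (4 * (\<kappa> / 2)))" for w
      proof -
        have "norm (\<phi> w) \<le> norm (U w) * exp (norm X * norm (A w))"
          using norm_exp[of "X * A w"] by (simp add: \<phi>_def norm_mult mult.commute mult_left_mono)
        also have "\<dots> \<le> exp (((1 / 2 + norm X) * (2 * norm \<xi>))\<^sup>2 / (4 * (\<kappa> / 2)))" by (rule bU) simp
        finally show ?thesis .
      qed
      have inner: "(LINT y|lborel. \<phi> (w - jplane br l y z) *
         (cis (\<mu> \<bullet> vbr br w (jplane br l y z) / 2) * of_real (exp (- (1 + real k / 2 * (norm z)\<^sup>2) * (y \<bullet> y))))) =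
         of_real (pi ^ n) * (U w * of_real ((1 / S z) ^ n * 1) * exp (X * B (w, z)))" for w z
      proof -
        \<comment> \<open>K is the adjoint of \<open>jplane br l y z\<close> as a map of y;
          \<open>p0\<close> and \<open>q0\<close> are the real and imaginary parts of the vector
          paired with \<open>jplane br l y z\<close> in the exponent.\<close>
        define K where "K u = (1 / norm l) *\<^sub>R (Im z *\<^sub>R u + (Re z / norm l) *\<^sub>R Jmap br l u)" for u
        define p0 where "p0 = \<kappa> *\<^sub>R w - Re X *\<^sub>R \<xi> - (Im X - 1/2) *\<^sub>R J \<xi>"
        define q0 where "q0 = \<kappa> *\<^sub>R J w - (Im X + 1/2) *\<^sub>R \<xi> + Re X *\<^sub>R J \<xi>"
        have \<phi>e: "\<phi> x = exp (X * A x + Y * cnj (A x) - of_real (\<kappa> / 2 * (x \<bullet> x)))" for x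
        proof -
          have "X * A x + Y * cnj (A x) - of_real (\<kappa> / 2 * (x \<bullet> x)) = X * A x + (Y * cnj (A x) + of_real (- (\<kappa> / 2) * (x \<bullet> x)))"
            by simp
          then show ?thesis
            by (simp only: \<phi>_def U_def G_def exp_of_real[symmetric] exp_add power2_norm_eq_inner)
        qed
        have "\<phi> (w - jplane br l y z) *
         (cis (\<mu> \<bullet> vbr br w (jplane br l y z) / 2) * of_real (exp (- (1 + real k / 2 * (norm z)\<^sup>2) * (y \<bullet> y)))) =
          \<phi> w * exp (of_real (K p0 \<bullet> y) + \<i> * of_real (K q0 \<bullet> y) - of_real (S z * (y \<bullet> y)))" for y
        proof -
          define e where "e = jplane br l y z"
          have ee: "e \<bullet> e = (norm z)\<^sup>2 / L\<^sup>2 * (y \<bullet> y)" unfolding e_def L_def by (rule jplane_norm[OF h l])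
          have Ae: "A (w - e) = A w - A e" by (simp add: A_def inner_diff_right J.diff complex_eq_iff)
          have p0e: "K p0 \<bullet> y = \<kappa> * (w \<bullet> e) - Re X * (\<xi> \<bullet> e) + (Im X - 1/2) * (\<xi> \<bullet> J e)"
            unfolding K_def jplane_inner[OF h, symmetric] e_def[symmetric] p0_def by (simp add: inner_diff_left J1)
          have q0e: "K q0 \<bullet> y = \<kappa> * (J w \<bullet> e) - (Im X + 1/2) * (\<xi> \<bullet> e) - Re X * (\<xi> \<bullet> J e)"
            unfolding K_def jplane_inner[OF h, symmetric] e_def[symmetric] q0_def
            by (simp add: inner_diff_left inner_add_left J1[of \<xi>])
          have lin: "- (X * A e + Y * cnj (A e)) + of_real (\<kappa> * (w \<bullet> e)) + \<i> * of_real (\<kappa> * (J w \<bullet> e)) =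
             of_real (K p0 \<bullet> y) + \<i> * of_real (K q0 \<bullet> y)"
            unfolding p0e q0e by (simp add: A_def Y_def complex_eq_iff algebra_simps)
          have Sz: "S z * (y \<bullet> y) = (1 + real k / 2 * (norm z)\<^sup>2) * (y \<bullet> y) + \<kappa> / 2 * (e \<bullet> e)"
            using L by (simp add: S_def q_def ee field_simps)
          have ww: "(w - e) \<bullet> (w - e) = w \<bullet> w - 2 * (w \<bullet> e) + e \<bullet> e"
            by (simp add: inner_diff_left inner_diff_right inner_commute)
          have "\<phi> (w - e) * (cis (\<kappa> * (J w \<bullet> e)) * of_real (exp (- (1 + real k / 2 * (norm z)\<^sup>2) * (y \<bullet> y)))) =
            exp ((X * A (w - e) + Y * cnj (A (w - e)) - of_real (\<kappa> / 2 * ((w - e) \<bullet> (w - e)))) +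
              (\<i> * of_real (\<kappa> * (J w \<bullet> e)) + of_real (- (1 + real k / 2 * (norm z)\<^sup>2) * (y \<bullet> y))))"
            unfolding \<phi>e by (simp only: exp_add cis_conv_exp exp_of_real)
          also have "(X * A (w - e) + Y * cnj (A (w - e)) - of_real (\<kappa> / 2 * ((w - e) \<bullet> (w - e)))) +
              (\<i> * of_real (\<kappa> * (J w \<bullet> e)) + of_real (- (1 + real k / 2 * (norm z)\<^sup>2) * (y \<bullet> y))) =
            (X * A w + Y * cnj (A w) - of_real (\<kappa> / 2 * (w \<bullet> w))) +
              ((- (X * A e + Y * cnj (A e)) + of_real (\<kappa> * (w \<bullet> e)) + \<i> * of_real (\<kappa> * (J w \<bullet> e))) - of_real (S z * (y \<bullet> y)))"
            unfolding Ae ww Sz by (simp add: algebra_simps)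
          also have "exp \<dots> = \<phi> w * exp (of_real (K p0 \<bullet> y) + \<i> * of_real (K q0 \<bullet> y) - of_real (S z * (y \<bullet> y)))"
            unfolding lin \<phi>e by (rule exp_add)
          finally show ?thesis unfolding phase e_def .
        qed
        then have "(LINT y|lborel. \<phi> (w - jplane br l y z) *
           (cis (\<mu> \<bullet> vbr br w (jplane br l y z) / 2) * of_real (exp (- (1 + real k / 2 * (norm z)\<^sup>2) * (y \<bullet> y))))) =
           \<phi> w * (of_real (sqrt (pi / S z) ^ DIM('v)) * exp ((of_real (K p0 \<bullet> K p0) - of_real (K q0 \<bullet> K q0) + 2 * \<i> * of_real (K p0 \<bullet> K q0)) / of_real (4 * S z)))"
          by (simp only: integral_mult_right_zero integral_gaussian_exp[OF S0])
        also have "sqrt (pi / S z) ^ DIM('v) = pi ^ n * (1 / S z) ^ n"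
        proof -
          have "0 \<le> pi / S z" using less_imp_le[OF S0[of z]] by simp
          then have "sqrt (pi / S z) ^ DIM('v) = (pi / S z) ^ n" by (simp only: d power_mult real_sqrt_pow2)
          then show ?thesis by (simp add: power_divide)
        qed
        also have "(of_real (K p0 \<bullet> K p0) - of_real (K q0 \<bullet> K q0) + 2 * \<i> * of_real (K p0 \<bullet> K q0)) / of_real (4 * S z) =
          of_real ((norm z)\<^sup>2 / L\<^sup>2) * (of_real (p0 \<bullet> p0) - of_real (q0 \<bullet> q0) + 2 * \<i> * of_real (p0 \<bullet> q0)) / of_real (4 * S z)"
        proof -
          have KK: "K u \<bullet> K u' = (norm z)\<^sup>2 / L\<^sup>2 * (u \<bullet> u')" for u u'
            unfolding K_def L_def by (rule jplane_adjoint_inner[OF h l])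
          have D: "a * b1 - a * b2 + 2 * \<i> * (a * b3) = a * (b1 - b2 + 2 * \<i> * b3)" for a b1 b2 b3 :: complex
            by (simp add: algebra_simps)
          show ?thesis unfolding KK of_real_mult D ..
        qed
        \<comment> \<open>Every surviving term is linear in X: the terms in X^2 and those free of X
          drop out along with those quadratic in w. Hence the exponent is exactly X times B.\<close>
        also have "of_real (p0 \<bullet> p0) - of_real (q0 \<bullet> q0) + 2 * \<i> * of_real (p0 \<bullet> q0) =
          4 * X * (\<i> / 2) * of_real (\<xi> \<bullet> \<xi>) - 4 * of_real \<kappa> * X * A w"
          unfolding p0_def q0_def A_def by (rule complex_structure_square[OF J1 J2])
        also have "of_real ((norm z)\<^sup>2 / L\<^sup>2) * (4 * X * (\<i> / 2) * of_real (\<xi> \<bullet> \<xi>) - 4 * of_real \<kappa> * X * A w) / of_real (4 * S z) =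
          X * (Y * of_real (v z * c) - of_real (\<theta> * v z) * A w)"
        proof -
          have 1: "v z * c = (norm z)\<^sup>2 / L\<^sup>2 * (\<xi> \<bullet> \<xi>) / S z" "\<theta> * v z = (norm z)\<^sup>2 / L\<^sup>2 * \<kappa> / S z"
            using q L S0[of z] by (simp_all add: v_def c_def \<theta>_def field_simps)
          show ?thesis unfolding 1 Y_def using S0[of z] L by (simp add: field_simps)
        qed
        finally have "(LINT y|lborel. \<phi> (w - jplane br l y z) *
           (cis (\<mu> \<bullet> vbr br w (jplane br l y z) / 2) * of_real (exp (- (1 + real k / 2 * (norm z)\<^sup>2) * (y \<bullet> y))))) =
           of_real (pi ^ n) * (U w * of_real ((1 / S z) ^ n * 1) * (exp (X * A w) * exp (X * (Y * of_real (v z * c) - of_real (\<theta> * v z) * A w))))"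
          by (simp add: \<phi>_def mult_ac)
        also have "exp (X * A w) * exp (X * (Y * of_real (v z * c) - of_real (\<theta> * v z) * A w)) = exp (X * B (w, z))"
          unfolding exp_add[symmetric] B_def by (simp add: algebra_simps)
        finally show ?thesis .
      qed
      have "(LINT w|lborel. g w * (LINT z|lborel. of_real (pi ^ n) * (U w * of_real ((1 / S z) ^ n * 1) * exp (X * B (w, z))))) = 0"
        using circle_null_average[OF h d n k l \<mu> g null \<phi>m b\<phi>] unfolding inner .
      then have "(LINT w|lborel. LINT z|lborel. of_real (pi ^ n) * (W (w, z) * exp (X * B (w, z)))) = 0"
        by (simp only: W_def fst_conv snd_conv mult_ac integral_mult_right_zero[symmetric])
      then have "(LINT w|lborel. LINT z|lborel. W (w, z) * exp (X * B (w, z))) = 0"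
        by (simp only: integral_mult_right_zero) simp
      moreover have "integrable (lborel \<Otimes>\<^sub>M lborel) (\<lambda>p. W p * exp (X * B p))"
        by (rule Bochner_Integration.integrable_bound[OF dom[of X]])
           (simp, rule AE_I2, simp only: norm_mult[of "W _"] real_norm_def abs_mult abs_norm_cancel abs_exp_cancel,
            intro mult_left_mono norm_exp norm_ge_zero)
      from lborel_pair.integral_fst'[OF this]
      have "(LINT w|lborel. LINT z|lborel. W (w, z) * exp (X * B (w, z))) = (LINT p|(lborel \<Otimes>\<^sub>M lborel). W p * exp (X * B p))" by simp
      ultimately show ?thesis by simp
    qed
    define N where "N m = (LINT w|lborel. (g w * U w) * A w ^ m)" for m
    have bUA: "norm (U w * A w ^ m) \<le> fact m * exp (((1 / 2 + 1) * (2 * norm \<xi>))\<^sup>2 / (4 * (\<kappa> / 2)))" for w m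
    proof -
      have "norm (U w * A w ^ m) \<le> norm (U w) * (fact m * exp (norm (A w)))"
        unfolding norm_mult norm_power by (intro mult_left_mono power_le_fact_exp) auto
      also have "\<dots> = fact m * (norm (U w) * exp (1 * norm (A w)))" by simp
      also have "\<dots> \<le> fact m * exp (((1 / 2 + 1) * (2 * norm \<xi>))\<^sup>2 / (4 * (\<kappa> / 2)))"
        by (intro mult_left_mono bU) auto
      finally show ?thesis .
    qed
    have iN: "integrable lborel (\<lambda>w. (g w * U w) * A w ^ m)" for m
      using integrable_bounded_mult[OF g _ bUA[where m = m]] by (simp add: mult.assoc)
    define e where "e i m = (LINT z|lborel. of_real ((1 / S z) ^ n * (v z ^ i * (1 - \<theta> * v z) ^ m)) :: complex)" for i m
    have ie: "integrable lborel (\<lambda>z. of_real ((1 / S z) ^ n * (v z ^ i * (1 - \<theta> * v z) ^ m)) :: complex)" for i m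
    proof (rule iSn)
      show "\<bar>v z ^ i * (1 - \<theta> * v z) ^ m\<bar> \<le> 1" for z
        using v01[of z] ab[of z] by (auto simp: abs_mult power_abs intro!: mult_le_one power_le_one)
    qed measurable
    have e0: "e 0 m \<noteq> 0" for m
    proof -
      have "e 0 m = of_real (LINT z|lborel. (1 / S z) ^ n * (1 - \<theta> * v z) ^ m)"
        unfolding e_def by (simp flip: integral_complex_of_real)
      moreover have "(LINT z|lborel. (1 / S z) ^ n * (1 - \<theta> * v z) ^ m) > 0"
        unfolding S_def v_def by (rule radial_moment_pos[OF q \<theta> n])
      ultimately show ?thesis by (simp only: of_real_eq_0_iff)
    qed
    \<comment> \<open>The Taylor coefficient of order j in X; the binomial theorem separates the
      variables w and z.\<close>
    have mom: "(\<Sum>i\<le>j. of_nat (j choose i) * (Y * of_real c) ^ i * (N (j - i) * e i (j - i))) = 0" for j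
    proof -
      have "W p * B p ^ j = (\<Sum>i\<le>j. (of_nat (j choose i) * (Y * of_real c) ^ i) * (((g (fst p) * U (fst p)) * A (fst p) ^ (j - i)) *
         of_real ((1 / S (snd p)) ^ n * (v (snd p) ^ i * (1 - \<theta> * v (snd p)) ^ (j - i)))))" for p
        unfolding B_def binomial_ring W_def sum_distrib_left
        by (intro sum.cong refl) (simp only: of_real_mult of_real_power power_mult_distrib mult_ac of_real_1 mult_1)
      moreover have "(LINT p|(lborel \<Otimes>\<^sub>M lborel). W p * B p ^ j) = 0"
        by (rule exp_moments_zero[OF Wm Bm dom zero])
      ultimately have "0 = (LINT p|(lborel \<Otimes>\<^sub>M lborel). (\<Sum>i\<le>j. (of_nat (j choose i) * (Y * of_real c) ^ i) * (((g (fst p) * U (fst p)) * A (fst p) ^ (j - i)) *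
         of_real ((1 / S (snd p)) ^ n * (v (snd p) ^ i * (1 - \<theta> * v (snd p)) ^ (j - i))))))"
        by (simp only:)
      also have "\<dots> = (\<Sum>i\<le>j. LINT p|(lborel \<Otimes>\<^sub>M lborel). (of_nat (j choose i) * (Y * of_real c) ^ i) * (((g (fst p) * U (fst p)) * A (fst p) ^ (j - i)) *
         of_real ((1 / S (snd p)) ^ n * (v (snd p) ^ i * (1 - \<theta> * v (snd p)) ^ (j - i)))))"
        by (rule Bochner_Integration.integral_sum) (intro integrable_mult_right integrable_pair_mult iN ie)
      also have "\<dots> = (\<Sum>i\<le>j. (of_nat (j choose i) * (Y * of_real c) ^ i) * (N (j - i) * e i (j - i)))"
        by (simp only: integral_mult_right_zero integral_pair_mult[OF iN ie] N_def e_def)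
      finally show ?thesis by simp
    qed
    have N0: "N j = 0" for j
    proof (induction j rule: less_induct)
      case (less j)
      have "(\<Sum>i\<le>j. of_nat (j choose i) * (Y * of_real c) ^ i * (N (j - i) * e i (j - i))) = N j * e 0 j"
        by (subst sum.remove[of _ 0]) (auto intro!: sum.neutral less)
      then show ?case using mom[of j] e0[of j] by simp
    qed
    have "(\<lambda>j. Y ^ j / fact j * (LINT w|lborel. (g w * U w) * A w ^ j)) sums (LINT w|lborel. (g w * U w) * exp (Y * A w))"
    proof (rule exp_moment_sums)
      have "integrable lborel (\<lambda>w. g w * (U w * of_real (exp (1 / 2 * norm (A w)))))"
        by (rule integrable_bounded_mult[OF g]) (use bU[of "1 / 2"] in \<open>auto simp: norm_mult\<close>)
      then have "integrable lborel (\<lambda>w. norm (g w * (U w * of_real (exp (1 / 2 * norm (A w))))))" by (rule integrable_norm)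
      then show "integrable lborel (\<lambda>w. norm (g w * U w) * exp (norm (Y * A w)))"
        by (simp add: norm_mult Y_def mult.assoc)
    qed measurable
    then have "(LINT w|lborel. (g w * U w) * exp (Y * A w)) = 0"
      by (simp add: N_def[symmetric] N0 sums_iff)
    moreover have "(g w * U w) * exp (Y * A w) = g w * G w * cis (\<xi> \<bullet> w)" for w
    proof -
      have "Y * cnj (A w) + Y * A w = \<i> * of_real (\<xi> \<bullet> w)"
        by (simp add: Y_def A_def complex_eq_iff)
      then have "exp (Y * cnj (A w)) * exp (Y * A w) = cis (\<xi> \<bullet> w)" by (simp add: cis_conv_exp flip: exp_add)
      then show ?thesis by (simp add: U_def mult_ac)
    qed
    ultimately show "(LINT w|lborel. g w * G w * cis (\<xi> \<bullet> w)) = 0" by simp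
  qed
  then show ?thesis by (simp add: G_def)
qed

section \<open>Widths and caps\<close>

text \<open>A set in no hyperplane has a convex hull with interior, and the width in any direction
  is at least the radius of a ball inside the hull. By compactness the extrema in each direction are
  attained, so the infimum over directions bounds the difference at two actual points.\<close>

lemma
  fixes Z :: "'z::euclidean_space set"
  assumes Z: "compact Z" and nh: "\<not> in_affine_hyperplane Z"
  shows min_width_pos: "0 < min_width Z"
    and min_width_attained: "\<mu> \<noteq> 0 \<Longrightarrow> \<exists>p\<in>Z. \<exists>q\<in>Z. \<mu> \<bullet> (p - q) \<ge> norm \<mu> * min_width Z"
proof -
  have ne: "Z \<noteq> {}"
  proof
    assume "Z = {}"
    define b :: 'z where "b = (SOME i. i \<in> Basis)"
    have "b \<in> Basis" unfolding b_def by (rule SOME_Basis)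
    then have "b \<noteq> 0" by (rule nonzero_Basis)
    with \<open>Z = {}\<close> have "b \<noteq> 0 \<and> Z \<subseteq> {x. b \<bullet> x = 0}" by simp
    then have "in_affine_hyperplane Z" unfolding in_affine_hyperplane_def by (intro exI)
    with nh show False by simp
  qed
  have att: "\<exists>p\<in>Z. \<exists>q\<in>Z. (SUP l\<in>Z. \<mu> \<bullet> l) - (INF l\<in>Z. \<mu> \<bullet> l) = \<mu> \<bullet> (p - q) \<and>
      (\<forall>l\<in>Z. \<mu> \<bullet> l \<le> \<mu> \<bullet> p \<and> \<mu> \<bullet> q \<le> \<mu> \<bullet> l)" for \<mu> :: 'z
  proof -
    have c: "continuous_on Z (\<lambda>l. \<mu> \<bullet> l)" by (intro continuous_intros)
    obtain p where p: "p \<in> Z" "\<And>l. l \<in> Z \<Longrightarrow> \<mu> \<bullet> l \<le> \<mu> \<bullet> p"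
      using continuous_attains_sup[OF Z ne c] by blast
    obtain q where q: "q \<in> Z" "\<And>l. l \<in> Z \<Longrightarrow> \<mu> \<bullet> q \<le> \<mu> \<bullet> l"
      using continuous_attains_inf[OF Z ne c] by blast
    have "(SUP l\<in>Z. \<mu> \<bullet> l) = \<mu> \<bullet> p" by (rule cSup_eq_maximum) (use p in auto)
    moreover have "(INF l\<in>Z. \<mu> \<bullet> l) = \<mu> \<bullet> q" by (rule cInf_eq_minimum) (use q in auto)
    ultimately show ?thesis using p q by (auto simp: inner_diff_right)
  qed
  have nn: "0 \<le> (SUP l\<in>Z. \<mu> \<bullet> l) - (INF l\<in>Z. \<mu> \<bullet> l)" for \<mu> :: 'z
    using att[of \<mu>] by (auto simp: inner_diff_right)
  then have bdd: "bdd_below ((\<lambda>\<mu>. (SUP l\<in>Z. \<mu> \<bullet> l) - (INF l\<in>Z. \<mu> \<bullet> l)) ` sphere 0 1)"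
    by (intro bdd_belowI[of _ 0]) auto
  show "\<exists>p\<in>Z. \<exists>q\<in>Z. \<mu> \<bullet> (p - q) \<ge> norm \<mu> * min_width Z" if \<mu>: "\<mu> \<noteq> 0" for \<mu>
  proof -
    obtain p q where pq: "p \<in> Z" "q \<in> Z" "(SUP l\<in>Z. sgn \<mu> \<bullet> l) - (INF l\<in>Z. sgn \<mu> \<bullet> l) = sgn \<mu> \<bullet> (p - q)"
      using att[of "sgn \<mu>"] by blast
    have "min_width Z \<le> sgn \<mu> \<bullet> (p - q)"
      unfolding min_width_def pq(3)[symmetric] using \<mu> by (intro cINF_lower bdd) (simp add: norm_sgn)
    then have "norm \<mu> * min_width Z \<le> norm \<mu> * (sgn \<mu> \<bullet> (p - q))" by (intro mult_left_mono) auto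
    also have "\<dots> = \<mu> \<bullet> (p - q)" using \<mu> by (simp add: sgn_div_norm)
    finally show ?thesis using pq by blast
  qed
  have "interior (convex hull Z) \<noteq> {}"
  proof
    assume "interior (convex hull Z) = {}"
    then obtain a b where "a \<noteq> 0" "convex hull Z \<subseteq> {x. a \<bullet> x = b}"
      by (rule empty_interior_subset_hyperplane[OF convex_convex_hull])
    then have "a \<noteq> 0 \<and> Z \<subseteq> {x. a \<bullet> x = b}" using hull_subset[of Z convex] by (meson subset_trans)
    then have "in_affine_hyperplane Z" unfolding in_affine_hyperplane_def by (intro exI)
    with nh show False by simp
  qed
  then obtain x r where r: "0 < r" "cball x r \<subseteq> convex hull Z" by (auto simp: mem_interior_cball)
  have "r \<le> (SUP l\<in>Z. \<mu> \<bullet> l) - (INF l\<in>Z. \<mu> \<bullet> l)" if \<mu>: "norm \<mu> = 1" for \<mu> :: 'z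
  proof -
    obtain p q where pq: "p \<in> Z" "q \<in> Z" "(SUP l\<in>Z. \<mu> \<bullet> l) - (INF l\<in>Z. \<mu> \<bullet> l) = \<mu> \<bullet> (p - q)"
      "\<And>l. l \<in> Z \<Longrightarrow> \<mu> \<bullet> l \<le> \<mu> \<bullet> p" "\<And>l. l \<in> Z \<Longrightarrow> \<mu> \<bullet> q \<le> \<mu> \<bullet> l"
      using att[of \<mu>] by blast
    have "convex hull Z \<subseteq> {l. \<mu> \<bullet> l \<le> \<mu> \<bullet> p} \<inter> {l. \<mu> \<bullet> l \<ge> \<mu> \<bullet> q}"
      using pq by (intro hull_minimal convex_Int convex_halfspace_le convex_halfspace_ge) auto
    moreover have "x + r *\<^sub>R \<mu> \<in> cball x r" "x \<in> cball x r" using \<mu> r by (auto simp: dist_norm)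
    ultimately have "\<mu> \<bullet> (x + r *\<^sub>R \<mu>) \<le> \<mu> \<bullet> p" "\<mu> \<bullet> q \<le> \<mu> \<bullet> x" using r by blast+
    moreover have "\<mu> \<bullet> \<mu> = 1" using \<mu> by (simp add: dot_square_norm)
    ultimately show ?thesis unfolding pq(3) by (simp add: inner_diff_right inner_add_right)
  qed
  then have "r \<le> min_width Z"
    unfolding min_width_def by (intro cINF_greatest) auto
  then show "0 < min_width Z" using r by simp
qed

lemma connected_inner_attains:
  fixes Z :: "'z::euclidean_space set"
  assumes "connected Z" "p \<in> Z" "q \<in> Z" "\<mu> \<bullet> q \<le> t" "t \<le> \<mu> \<bullet> p"
  shows "\<exists>l\<in>Z. \<mu> \<bullet> l = t"
proof -
  have "connected ((\<lambda>l. \<mu> \<bullet> l) ` Z)" by (intro connected_continuous_image continuous_intros assms)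
  then have "t \<in> (\<lambda>l. \<mu> \<bullet> l) ` Z" using connectedD_interval[of _ "\<mu> \<bullet> q" "\<mu> \<bullet> p" t] assms by blast
  then show ?thesis by auto
qed

text \<open>The cap is the radial projection of a cone K without its vertex, and K is star-shaped
  about \<open>l0\<close>. For h \<le> 1 the cone lies in a half space, so that segments from
  \<open>l0\<close> avoid the vertex.\<close>

lemma connected_sph_cap:
  fixes l0 :: "'z::euclidean_space"
  assumes l0: "norm l0 = 1" and h: "0 < h" "h \<le> 1"
  shows "connected (sph_cap h l0)"
proof -
  define K where "K = {x. x \<noteq> 0 \<and> x \<bullet> l0 \<ge> (1 - h) * norm x}"
  have l0l0: "l0 \<bullet> l0 = 1" using l0 by (simp add: dot_square_norm)
  have "starlike K"
    unfolding starlike_def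
  proof (intro bexI[of _ l0] ballI subsetI)
    show "l0 \<in> K" using l0 h l0l0 by (auto simp: K_def)
    fix x y assume x: "x \<in> K" and "y \<in> closed_segment l0 x"
    then obtain u where u: "0 \<le> u" "u \<le> 1" "y = (1 - u) *\<^sub>R l0 + u *\<^sub>R x" by (auto simp: closed_segment_def)
    have x0: "x \<noteq> 0" "(1 - h) * norm x \<le> x \<bullet> l0" using x by (auto simp: K_def)
    have nn: "0 \<le> (1 - h) * norm x" using h by simp
    have yl: "y \<bullet> l0 = (1 - u) + u * (x \<bullet> l0)" by (simp add: u inner_add_left l0l0)
    have "norm y \<le> (1 - u) + u * norm x"
      using norm_triangle_ineq[of "(1 - u) *\<^sub>R l0" "u *\<^sub>R x"] u l0 by simp
    then have "(1 - h) * norm y \<le> (1 - h) * ((1 - u) + u * norm x)" using h by (intro mult_left_mono) auto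
    also have "\<dots> = (1 - h) * (1 - u) + u * ((1 - h) * norm x)" by (simp add: algebra_simps)
    also have "\<dots> \<le> 1 * (1 - u) + u * (x \<bullet> l0)"
      using u h x0 by (intro add_mono mult_right_mono mult_left_mono) auto
    finally have 1: "(1 - h) * norm y \<le> y \<bullet> l0" by (simp add: yl)
    have "y \<noteq> 0"
    proof (cases "u = 1")
      case True then show ?thesis using u x0 by simp
    next
      case False
      then have "0 < y \<bullet> l0" unfolding yl using u x0 nn by (intro add_pos_nonneg mult_nonneg_nonneg) auto
      then show ?thesis by auto
    qed
    with 1 show "y \<in> K" by (simp add: K_def)
  qed
  then have "connected K" by (rule starlike_imp_connected)
  then have "connected (sgn ` K)"
    by (intro connected_continuous_image continuous_on_sgn continuous_on_id) (auto simp: K_def)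
  moreover have "sgn ` K = sph_cap h l0"
  proof
    show "sgn ` K \<subseteq> sph_cap h l0"
    proof (rule image_subsetI)
      fix x assume "x \<in> K"
      then have "x \<noteq> 0" "(1 - h) * norm x \<le> x \<bullet> l0" by (auto simp: K_def)
      moreover have "sgn x \<bullet> l0 = (x \<bullet> l0) / norm x" by (simp add: sgn_div_norm divide_inverse mult.commute)
      ultimately show "sgn x \<in> sph_cap h l0" by (simp add: sph_cap_def norm_sgn pos_le_divide_eq)
    qed
    show "sph_cap h l0 \<subseteq> sgn ` K"
    proof
      fix x assume x: "x \<in> sph_cap h l0"
      then have "x \<in> K" "sgn x = x" by (auto simp: sph_cap_def K_def sgn_div_norm)
      then show "x \<in> sgn ` K" by (metis image_eqI)
    qed
  qed
  ultimately show ?thesis by simp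
qed

text \<open>Two points suffice: the center \<open>l0\<close> and the rim point opposite to the
  component of \<mu> orthogonal to \<open>l0\<close>. Passing to - \<mu> settles the case of
  negative \<open>\<mu> \<bullet> l0\<close>.\<close>

lemma sph_cap_width:
  fixes l0 \<mu> :: "'z::euclidean_space"
  assumes l0: "norm l0 = 1" and h: "0 < h" "h \<le> 1" and d: "DIM('z) > 1"
  shows "\<exists>p\<in>sph_cap h l0. \<exists>q\<in>sph_cap h l0. \<mu> \<bullet> (p - q) \<ge> norm \<mu> * h"
proof -
  have l0l0: "l0 \<bullet> l0 = 1" using l0 by (simp add: dot_square_norm)
  have main: "\<exists>q\<in>sph_cap h l0. \<mu> \<bullet> (l0 - q) \<ge> norm \<mu> * h" if \<mu>: "\<mu> \<bullet> l0 \<ge> 0" for \<mu>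
  proof -
    define t where "t = \<mu> \<bullet> l0"
    define w where "w = \<mu> - t *\<^sub>R l0"
    have wl: "w \<bullet> l0 = 0" by (simp add: w_def inner_diff_left l0l0 t_def)
    obtain e where e: "norm e = 1" "e \<bullet> l0 = 0" "w = norm w *\<^sub>R e"
    \<comment> \<open>When \<mu> is a multiple of \<open>l0\<close>, any unit vector orthogonal to
      \<open>l0\<close> will do; a dimension above 1 provides it.\<close>
    proof (cases "w = 0")
      case True
      obtain x where x: "x \<noteq> 0" "orthogonal x l0"
        using orthogonal_to_vector_exists[of l0] d by (auto simp: orthogonal_commute)
      show ?thesis
        by (rule that[of "sgn x"]) (use x True in \<open>auto simp: norm_sgn sgn_div_norm orthogonal_def\<close>)
    next
      case False
      show ?thesis
        by (rule that[of "sgn w"]) (use False wl in \<open>auto simp: norm_sgn sgn_div_norm\<close>)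
    qed
    have ee: "e \<bullet> e = 1" using e(1) by (simp add: dot_square_norm)
    have el: "l0 \<bullet> e = 0" using e(2) by (simp add: inner_commute)
    \<comment> \<open>The radius of the rim, sqrt (2 h - h^2). It is at least h because h \<le> 1,
      so both components of \<mu> contribute at least h times their length.\<close>
    define s where "s = sqrt (1 - (1 - h)\<^sup>2)"
    have h2: "(1 - h)\<^sup>2 \<le> 1" using h by (simp add: power_le_one)
    have s2: "s\<^sup>2 = 1 - (1 - h)\<^sup>2" using h2 by (simp add: s_def)
    have sh: "h \<le> s"
    proof -
      have "h * h \<le> h * 1" using h by (intro mult_left_mono) auto
      then have "h\<^sup>2 \<le> 1 - (1 - h)\<^sup>2" by (simp add: power2_eq_square algebra_simps)
      then show ?thesis unfolding s_def by (rule real_le_rsqrt)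
    qed
    define q where "q = (1 - h) *\<^sub>R l0 - s *\<^sub>R e"
    have qq: "q \<bullet> q = 1"
      using s2 by (simp add: q_def inner_diff_left inner_diff_right l0l0 ee el e(1,2) power2_eq_square algebra_simps)
    have "q \<bullet> l0 = 1 - h" by (simp add: q_def inner_diff_left l0l0 e(2))
    then have "q \<in> sph_cap h l0" using qq by (simp add: sph_cap_def norm_eq_1)
    moreover have "\<mu> \<bullet> (l0 - q) \<ge> norm \<mu> * h"
    proof -
      have \<mu>e: "\<mu> = t *\<^sub>R l0 + norm w *\<^sub>R e" using e(3) by (simp add: w_def)
      have "\<mu> \<bullet> (l0 - q) = t * h + norm w * s"
        by (subst \<mu>e) (simp add: q_def inner_diff_right inner_add_left l0l0 ee el e(1,2) algebra_simps)
      moreover have "norm \<mu> \<le> t + norm w"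
      proof -
        have "norm (t *\<^sub>R l0 + norm w *\<^sub>R e) \<le> t + norm w"
          using norm_triangle_ineq[of "t *\<^sub>R l0" "norm w *\<^sub>R e"] l0 e(1) \<mu> by (simp add: t_def[symmetric])
        then show ?thesis by (subst \<mu>e)
      qed
      then have "norm \<mu> * h \<le> (t + norm w) * h" using h by (intro mult_right_mono) auto
      moreover have "norm w * h \<le> norm w * s" using sh by (intro mult_left_mono) auto
      ultimately show ?thesis by (simp add: algebra_simps)
    qed
    ultimately show ?thesis by blast
  qed
  have l0c: "l0 \<in> sph_cap h l0" using l0 l0l0 h by (simp add: sph_cap_def)
  show ?thesis
  proof (cases "\<mu> \<bullet> l0 \<ge> 0")
    case True
    then show ?thesis using main l0c by blast
  next
    case False
    then obtain q where "q \<in> sph_cap h l0" "(- \<mu>) \<bullet> (l0 - q) \<ge> norm (- \<mu>) * h" using main[of "- \<mu>"] by auto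
    then have "\<mu> \<bullet> (q - l0) \<ge> norm \<mu> * h" by (simp add: inner_diff_right)
    then show ?thesis using l0c \<open>q \<in> sph_cap h l0\<close> by blast
  qed
qed

section \<open>Vanishing of \<open>f\<^sup>\<mu>\<close>\<close>

lemma central_ft_integrable:
  fixes f :: "'v::euclidean_space \<times> 'z::euclidean_space \<Rightarrow> complex"
  assumes f: "integrable lborel f"
  shows "integrable lborel (central_ft f \<mu>)"
proof -
  have [measurable]: "f \<in> borel_measurable borel" using f by auto
  have [measurable]: "(\<lambda>p::'v \<times> 'z. cis (- (\<mu> \<bullet> snd p))) \<in> borel_measurable borel" by measurable
  have "integrable lborel (\<lambda>p. f p * cis (- (\<mu> \<bullet> snd p)))"
    by (rule Bochner_Integration.integrable_bound[OF f]) (auto simp: norm_mult)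
  then have "integrable (lborel \<Otimes>\<^sub>M lborel) (\<lambda>p. f p * cis (- (\<mu> \<bullet> snd p)))" by (simp add: lborel_prod)
  from lborel_pair.integrable_fst'[OF this] show ?thesis
    by (simp add: central_ft_def[abs_def] cis_conv_exp)
qed

text \<open>The factor \<open>z ^ k\<close> is \<open>cis (real k * t)\<close>, which the character
  contributes along the central part of the curve.\<close>

lemma I_zero_circle_null:
  fixes br :: "'v::euclidean_space \<times> 'z::euclidean_space \<Rightarrow> 'v \<times> 'z \<Rightarrow> 'v \<times> 'z"
  assumes h: "h_type br" and f: "integrable lborel f" and l: "l \<noteq> 0" and I: "I_zero br \<nu> l f"
    and k: "\<mu> \<bullet> sgn l = 2 * real k * (norm l)\<^sup>2"
  shows "circle_null (central_ft f \<mu>) (jplane br l \<nu>) (\<lambda>w z. \<mu> \<bullet> vbr br w (jplane br l \<nu> z) / 2) k"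
  unfolding circle_null_def
proof (intro allI impI)
  fix \<psi> :: "'v \<Rightarrow> complex" and C assume \<psi>: "\<psi> \<in> borel_measurable borel" "\<forall>x. norm (\<psi> x) \<le> C"
  have "\<mu> \<bullet> sgn l = 2 * of_int (int k) * (norm l)\<^sup>2" using k by simp
  from I_zero_test[OF h f l I this \<psi>(1), of C] \<psi>(2)
  have "(LINT w|lborel. central_ft f \<mu> w * (LINT t|lborel. indicator {0..<2*pi} t *\<^sub>R
      (\<psi> (w - jplane br l \<nu> (cis t)) * cis (real k * t + \<mu> \<bullet> vbr br w (jplane br l \<nu> (cis t)) / 2)))) = 0"
    by simp
  moreover have "cis (real k * t + x) = cis t ^ k * cis x" for t x
    by (simp add: Complex.DeMoivre cis_mult)
  ultimately show "(LINT w|lborel. central_ft f \<mu> w * circle_int (\<lambda>z. \<psi> (w - jplane br l \<nu> z) *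
      (z ^ k * cis (\<mu> \<bullet> vbr br w (jplane br l \<nu> z) / 2)))) = 0"
    by (simp only: circle_int_def)
qed

lemma central_ft_cnj: "central_ft (\<lambda>x. cnj (f x)) (- \<mu>) x = cnj (central_ft f \<mu> x)"
  unfolding central_ft_def Bochner_Integration.integral_cnj[symmetric]
  by (rule Bochner_Integration.integral_cong) (auto simp: exp_cnj)

lemma I_zero_cnj:
  assumes "I_zero br \<nu> l f"
  shows "I_zero br \<nu> l (\<lambda>x. cnj (f x))"
proof -
  have "Iint br \<nu> l (\<lambda>x. cnj (f x)) g = cnj (Iint br \<nu> l f g)" for g
    unfolding Iint_def by (rule Bochner_Integration.integral_cnj)
  then show ?thesis using assms by (simp add: I_zero_def)
qed

lemma central_ft_zero_odd_nat:
  fixes br :: "'v::euclidean_space \<times> 'z::euclidean_space \<Rightarrow> 'v \<times> 'z \<Rightarrow> 'v \<times> 'z"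
  assumes h: "h_type br" and f: "integrable lborel f" and l: "l \<noteq> 0" and \<nu>: "norm \<nu> = 1" and I: "I_zero br \<nu> l f"
    and \<mu>: "\<mu> \<bullet> sgn l = 2 * real k * (norm l)\<^sup>2" and k: "odd k"
  shows "AE x in lborel. central_ft f \<mu> x = 0"
proof -
  have k0: "real k \<noteq> 0" using k by (auto intro: odd_pos)
  show ?thesis
    by (rule circle_null_odd[OF central_ft_integrable[OF f] linear_jcoord[OF h, of \<mu> l \<nu> "real k"] linear_jplane
          jcoord_jplane[OF h l k0 \<mu> \<nu>] jplane_phase[OF h l k0] k I_zero_circle_null[OF h f l I \<mu>]])
qed

text \<open>\<open>\<mu> \<bullet> l = 0\<close> makes J_\<mu> map the plane into its orthogonal
  complement, so the plane is isotropic for the twist. As \<mu> \<noteq> 0, the twist is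
  nondegenerate on the whole space, which supplies a direction in which the argument of the Bessel
  factor varies.\<close>

lemma central_ft_zero_orthogonal:
  fixes br :: "'v::euclidean_space \<times> 'z::euclidean_space \<Rightarrow> 'v \<times> 'z \<Rightarrow> 'v \<times> 'z"
  assumes h: "h_type br" and f: "integrable lborel f" and l: "l \<noteq> 0" and \<nu>: "norm \<nu> = 1" and I: "I_zero br \<nu> l f"
    and \<mu>: "\<mu> \<bullet> l = 0" and \<mu>0: "\<mu> \<noteq> 0"
  shows "AE x in lborel. central_ft f \<mu> x = 0"
proof -
  interpret J: linear "Jmap br \<mu>" by (rule linear_Jmap[OF h])
  interpret E: linear "jplane br l \<nu>" by (rule linear_jplane)
  define \<rho> where "\<rho> w = Complex (Jmap br \<mu> w \<bullet> jplane br l \<nu> 1 / 2) (Jmap br \<mu> w \<bullet> jplane br l \<nu> \<i> / 2)" for w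
  have lin: "linear \<rho>"
    by (rule linearI) (auto simp: \<rho>_def J.add J.scaleR inner_add_left add_divide_distrib complex_eq_iff)
  have \<nu>\<nu>: "\<nu> \<bullet> \<nu> = 1" using \<nu> by (simp add: dot_square_norm)
  have 1: "Jmap br \<mu> \<nu> \<bullet> Jmap br l \<nu> = 0" by (simp add: Jmap_inner_Jmap[OF h] \<mu>)
  have 2: "Jmap br \<mu> (Jmap br l \<nu>) \<bullet> \<nu> = 0"
    using 1 Jmap_skew[OF h, of \<mu> "Jmap br l \<nu>" \<nu>] by (simp add: inner_commute)
  have iso: "Jmap br \<mu> (jplane br l \<nu> z) \<bullet> jplane br l \<nu> z' = 0" for z z'
    by (simp add: jplane_def J.scaleR J.diff inner_diff_left inner_diff_right 1 2 Jmap_inner_self[OF h])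
  \<comment> \<open>J_\<mu> d is a multiple of \<open>jplane br l \<nu> 1\<close>, which is
    orthogonal to \<open>jplane br l \<nu> \<i>\<close>.\<close>
  define d where "d = (- (2 * (norm l)\<^sup>2 / (norm \<mu>)\<^sup>2)) *\<^sub>R Jmap br \<mu> (jplane br l \<nu> 1)"
  have "Jmap br \<mu> d = (2 * (norm l)\<^sup>2) *\<^sub>R jplane br l \<nu> 1"
    using \<mu>0 by (simp add: d_def J.scaleR J.neg Jmap_Jmap[OF h])
  moreover have "jplane br l \<nu> 1 \<bullet> jplane br l \<nu> 1 = 1 / (norm l)\<^sup>2"
    using jplane_norm[OF h l, of \<nu> 1] by (simp add: \<nu>\<nu>)
  moreover have "jplane br l \<nu> 1 \<bullet> jplane br l \<nu> \<i> = 0"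
    by (simp add: jplane_def Jmap_inner_self[OF h])
  ultimately have d: "\<rho> d = 1" using l by (simp add: \<rho>_def complex_eq_iff)
  have \<theta>: "\<mu> \<bullet> vbr br w (jplane br l \<nu> z) / 2 = Re (cnj (\<rho> w) * z)" for w z
  proof -
    have "jplane br l \<nu> z = Re z *\<^sub>R jplane br l \<nu> 1 + Im z *\<^sub>R jplane br l \<nu> \<i>"
      by (simp add: jplane_def algebra_simps)
    then have "\<mu> \<bullet> vbr br w (jplane br l \<nu> z) = Re z * (Jmap br \<mu> w \<bullet> jplane br l \<nu> 1) + Im z * (Jmap br \<mu> w \<bullet> jplane br l \<nu> \<i>)"
      by (simp add: Jmap_inner[OF h, symmetric] inner_add_right)
    then show ?thesis by (simp add: \<rho>_def)
  qed
  have "\<mu> \<bullet> sgn l = 2 * real 0 * (norm l)\<^sup>2" using \<mu> by (simp add: sgn_div_norm)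
  note null = I_zero_circle_null[OF h f l I this]
  show ?thesis
    by (rule circle_null_zero[OF central_ft_integrable[OF f] lin linear_jplane _ d \<theta> null])
      (simp add: \<rho>_def iso complex_eq_iff)
qed

lemma central_ft_zero_cnj:
  assumes "AE x in lborel. central_ft (\<lambda>x. cnj (f x)) (- \<mu>) x = 0"
  shows "AE x in lborel. central_ft f \<mu> x = 0"
  using assms by (simp add: central_ft_cnj)

lemma central_ft_zero_odd:
  fixes br :: "'v::euclidean_space \<times> 'z::euclidean_space \<Rightarrow> 'v \<times> 'z \<Rightarrow> 'v \<times> 'z" and k :: int
  assumes h: "h_type br" and f: "integrable lborel f" and l: "l \<noteq> 0" and \<nu>: "norm \<nu> = 1" and I: "I_zero br \<nu> l f"
    and \<mu>: "\<mu> \<bullet> sgn l = 2 * of_int k * (norm l)\<^sup>2" and k: "odd k"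
  shows "AE x in lborel. central_ft f \<mu> x = 0"
proof (cases "0 \<le> k")
  case True
  then have "odd (nat k)" "\<mu> \<bullet> sgn l = 2 * real (nat k) * (norm l)\<^sup>2" using k \<mu> by (auto simp: even_nat_iff)
  then show ?thesis by (intro central_ft_zero_odd_nat[OF h f l \<nu> I])
next
  case False
  then have k': "odd (nat (- k))" "(- \<mu>) \<bullet> sgn l = 2 * real (nat (- k)) * (norm l)\<^sup>2" using k \<mu> by (auto simp: even_nat_iff)
  have "integrable lborel (\<lambda>x. cnj (f x))" using f by simp
  from central_ft_zero_odd_nat[OF h this l \<nu> I_zero_cnj[OF I] k'(2,1)]
  show ?thesis by (rule central_ft_zero_cnj)
qed

text \<open>For k = 0 a single direction is enough, hence the arbitrary unit vector there.\<close>

lemma central_ft_zero_all: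
  fixes br :: "'v::euclidean_space \<times> 'z::euclidean_space \<Rightarrow> 'v \<times> 'z \<Rightarrow> 'v \<times> 'z" and k :: int
  assumes h: "h_type br" and d: "DIM('v) = 2 * n" and n: "2 \<le> n" and f: "integrable lborel f" and l: "l \<noteq> 0"
    and I: "\<And>\<nu>. norm \<nu> = 1 \<Longrightarrow> I_zero br \<nu> l f"
    and \<mu>: "\<mu> \<bullet> sgn l = 2 * of_int k * (norm l)\<^sup>2" and \<mu>0: "\<mu> \<noteq> 0"
  shows "AE x in lborel. central_ft f \<mu> x = 0"
proof -
  consider "k = 0" | "0 < k" | "k < 0" by linarith
  then show ?thesis
  proof cases
    case 1
    have "\<mu> \<bullet> l = 0" using \<mu> l 1 by (simp add: sgn_div_norm)
    obtain \<nu> :: 'v where "norm \<nu> = 1" using vector_choose_size[of 1] by auto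
    then show ?thesis by (rule central_ft_zero_orthogonal[OF h f l _ I \<open>\<mu> \<bullet> l = 0\<close> \<mu>0]) fact
  next
    case 2
    then have k: "nat k > 0" "\<mu> \<bullet> sgn l = 2 * real (nat k) * (norm l)\<^sup>2" using \<mu> by auto
    show ?thesis
      by (rule circle_null_all_directions[OF h d n k(1) l k(2) central_ft_integrable[OF f] I_zero_circle_null[OF h f l I k(2)]])
  next
    case 3
    then have k: "nat (- k) > 0" "(- \<mu>) \<bullet> sgn l = 2 * real (nat (- k)) * (norm l)\<^sup>2" using \<mu> by auto
    have f': "integrable lborel (\<lambda>x. cnj (f x))" using f by simp
    show ?thesis
      by (rule central_ft_zero_cnj)
        (rule circle_null_all_directions[OF h d n k(1) l k(2) central_ft_integrable[OF f'] I_zero_circle_null[OF h f' l I_zero_cnj[OF I] k(2)]])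
  qed
qed

text \<open>For orthonormal \<open>a, b\<close> in the center, \<open>\<nu>\<close>, \<open>J\<^sub>a \<nu>\<close> and \<open>J\<^sub>b \<nu>\<close> are orthogonal.\<close>
lemma h_type_dim_ge:
  fixes br :: "'v::euclidean_space \<times> 'z::euclidean_space \<Rightarrow> 'v \<times> 'z \<Rightarrow> 'v \<times> 'z"
  assumes h: "h_type br" and m: "DIM('z) > 1"
  shows "DIM('v) > 2"
proof -
  obtain a :: 'z where a: "a \<noteq> 0" using vector_choose_size[of 1] by (metis norm_zero zero_neq_one zero_le_one)
  obtain b where b: "b \<noteq> 0" "orthogonal a b" using orthogonal_to_vector_exists[of a] m by auto
  obtain \<nu> :: 'v where \<nu>: "norm \<nu> = 1" using vector_choose_size[of 1] by auto
  then have \<nu>\<nu>: "\<nu> \<bullet> \<nu> = 1" by (simp add: dot_square_norm)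
  let ?a = "Jmap br a \<nu>" and ?b = "Jmap br b \<nu>"
  have ab: "?a \<bullet> ?b = 0" using b by (simp add: Jmap_inner_Jmap[OF h] orthogonal_def)
  have n: "?a \<bullet> ?a \<noteq> 0" "?b \<bullet> ?b \<noteq> 0" using a b by (simp_all add: Jmap_inner_same[OF h] \<nu>\<nu>)
  have z: "?a \<bullet> \<nu> = 0" "?b \<bullet> \<nu> = 0" by (simp_all add: Jmap_inner_self[OF h])
  have dist: "\<nu> \<noteq> ?a" "\<nu> \<noteq> ?b" "?a \<noteq> ?b"
    using ab n z \<nu>\<nu> by auto
  have "independent {\<nu>, ?a, ?b}"
    by (rule pairwise_orthogonal_independent)
      (use ab n z \<nu>\<nu> in \<open>auto simp: pairwise_def orthogonal_def inner_commute\<close>)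
  then have "card {\<nu>, ?a, ?b} \<le> DIM('v)" by (rule independent_bound[THEN conjunct2])
  then show ?thesis using dist by simp
qed

section \<open>Choice of \<lambda> for a given \<mu>\<close>

lemma L1_specI:
  fixes f :: "'v::euclidean_space \<times> 'z::euclidean_space \<Rightarrow> complex"
  assumes "integrable lborel f" "\<And>\<mu>. \<mu> \<noteq> 0 \<Longrightarrow> norm \<mu> > c \<Longrightarrow> AE x in lborel. central_ft f \<mu> x = 0"
  shows "f \<in> L1_spec (freq_ball c)"
  unfolding L1_spec_def
proof (intro CollectI conjI ballI assms(1))
  fix \<mu> :: 'z assume "\<mu> \<in> - {0} - freq_ball c"
  then show "AE x in lborel. central_ft f \<mu> x = 0" by (intro assms(2)) (auto simp: freq_ball_def)
qed

text \<open>The integers are not well-ordered, so \<open>LEAST\<close> needs a lower bound; shifted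
  by b the candidates become natural numbers.\<close>

lemma Least_int_bounded_below:
  fixes P :: "int \<Rightarrow> bool"
  assumes "P k" "\<And>j. P j \<Longrightarrow> b \<le> j"
  shows "P (LEAST k. P k)"
proof -
  obtain m where m: "P m" "\<And>j. P j \<Longrightarrow> nat (m - b) \<le> nat (j - b)"
    using ex_has_least_nat[of P k "\<lambda>j. nat (j - b)"] assms(1) by blast
  have "(LEAST k. P k) = m"
    by (rule Least_equality) (use m assms(2) in \<open>force simp: nat_le_eq_zle\<close>)+
  with m show ?thesis by simp
qed

text \<open>\<lambda> is taken parallel to \<mu>, so the condition reads |\<mu>| = 2 k
  |\<lambda>|^2. With k the largest of k0, k0 + s, k0 + 2 s, ... such that 2 k \<le> |\<mu>|, one
  has |\<mu>| < 2 k + 2 s, and s \<le> k (2 \<epsilon> + \<epsilon>^2) turns this into |\<mu>| \<le>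
  2 k (1 + \<epsilon>)^2. The step s is 2 for odd values and 1 for all integers.\<close>

lemma shell_frequency:
  fixes \<mu> :: "'z::euclidean_space" and k0 s :: int
  assumes \<epsilon>: "0 < \<epsilon>" and s: "0 < s" and k0: "of_int s / (2 * \<epsilon> + \<epsilon>\<^sup>2) \<le> of_int k0" and \<mu>: "2 * of_int k0 < norm \<mu>"
  obtains j l where "0 \<le> j" "norm l \<in> {1..1 + \<epsilon>}" "\<mu> \<bullet> sgn l = 2 * of_int (k0 + s * j) * (norm l)\<^sup>2"
proof -
  have \<delta>: "0 < 2 * \<epsilon> + \<epsilon>\<^sup>2" using \<epsilon> by (simp add: add_pos_pos)
  have "0 < of_int s / (2 * \<epsilon> + \<epsilon>\<^sup>2)" using s \<delta> by simp
  then have k0p: "0 < real_of_int k0" using k0 by linarith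
  define j where "j = \<lfloor>(norm \<mu> / 2 - of_int k0) / of_int s\<rfloor>"
  have s': "0 < real_of_int s" using s by simp
  have j0: "0 \<le> j" unfolding j_def using \<mu> s' by simp
  define k where "k = k0 + s * j"
  have "of_int j \<le> (norm \<mu> / 2 - of_int k0) / of_int s" "(norm \<mu> / 2 - of_int k0) / of_int s < of_int j + 1"
    unfolding j_def by linarith+
  then have kle: "2 * of_int k \<le> norm \<mu>" and klt: "norm \<mu> < 2 * of_int k + 2 * of_int s"
    using s' by (auto simp: k_def field_simps)
  have kk: "of_int k0 \<le> real_of_int k" using j0 s by (simp add: k_def)
  have kp: "0 < real_of_int k" using kk k0p by linarith
  have "of_int s \<le> of_int k * (2 * \<epsilon> + \<epsilon>\<^sup>2)"
  proof -
    have "of_int s \<le> of_int k0 * (2 * \<epsilon> + \<epsilon>\<^sup>2)" using k0 \<delta> by (simp add: pos_divide_le_eq)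
    also have "\<dots> \<le> of_int k * (2 * \<epsilon> + \<epsilon>\<^sup>2)" using kk \<delta> by (intro mult_right_mono) auto
    finally show ?thesis .
  qed
  then have "norm \<mu> \<le> 2 * of_int k * (1 + \<epsilon>)\<^sup>2" using klt by (simp add: power2_eq_square algebra_simps)
  then have r: "1 \<le> norm \<mu> / (2 * of_int k)" "norm \<mu> / (2 * of_int k) \<le> (1 + \<epsilon>)\<^sup>2"
    using kle kp by (simp_all add: field_simps)
  define r where "r = sqrt (norm \<mu> / (2 * of_int k))"
  have r1: "1 \<le> r" "r \<le> 1 + \<epsilon>"
    unfolding r_def using r \<epsilon> by (auto intro: real_le_lsqrt)
  have \<mu>0: "\<mu> \<noteq> 0" using \<mu> k0p by auto
  have nl: "norm (r *\<^sub>R sgn \<mu>) = r" using r1 \<mu>0 by (simp add: norm_sgn)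
  have "sgn (r *\<^sub>R sgn \<mu>) = sgn \<mu>" using r1 \<mu>0 by (simp add: sgn_scaleR sgn_div_norm[of "sgn \<mu>"] norm_sgn)
  then have "\<mu> \<bullet> sgn (r *\<^sub>R sgn \<mu>) = norm \<mu>"
    using \<mu>0 by (simp add: sgn_div_norm[of \<mu>] dot_square_norm power2_eq_square)
  also have "\<dots> = 2 * of_int (k0 + s * j) * r\<^sup>2"
    using kp r by (simp add: r_def k_def[symmetric])
  finally show ?thesis using that[OF j0, of "r *\<^sub>R sgn \<mu>"] r1 nl by simp
qed

text \<open>A closed interval of length 2 s contains a number 2 (1 + s j), and connectedness makes
  it a value of \<open>\<mu> \<bullet> l\<close>. The offset 1 makes these the odd k for s = 2 and
  all integers for s = 1.\<close>

lemma spherical_frequency: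
  fixes Z :: "'z::euclidean_space set" and s :: int
  assumes Z: "connected Z" "Z \<subseteq> sphere 0 1" and s: "0 < s"
    and pq: "p \<in> Z" "q \<in> Z" "2 * of_int s \<le> \<mu> \<bullet> (p - q)"
  obtains j l where "l \<in> Z" "l \<noteq> 0" "\<mu> \<bullet> sgn l = 2 * of_int (1 + s * j) * (norm l)\<^sup>2"
proof -
  define j where "j = \<lceil>(\<mu> \<bullet> q / 2 - 1) / of_int s\<rceil>"
  have s': "0 < real_of_int s" using s by simp
  have "(\<mu> \<bullet> q / 2 - 1) / of_int s \<le> of_int j" "of_int j < (\<mu> \<bullet> q / 2 - 1) / of_int s + 1"
    unfolding j_def by linarith+
  then have "\<mu> \<bullet> q \<le> 2 * of_int (1 + s * j)" "2 * of_int (1 + s * j) \<le> \<mu> \<bullet> p"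
    using s' pq(3) by (simp_all add: field_simps inner_diff_right)
  from connected_inner_attains[OF Z(1) pq(1,2) this]
  obtain l where l: "l \<in> Z" "\<mu> \<bullet> l = 2 * of_int (1 + s * j)" by blast
  then have n: "norm l = 1" using Z by auto
  show ?thesis by (rule that[of l j]) (use l n in \<open>auto simp: sgn_div_norm\<close>)
qed

text \<open>Stated for any lower bound \<delta> of the widths, so that the general case and the caps
  share it.\<close>

lemma spherical_zero_set:
  fixes br :: "'v::euclidean_space \<times> 'z::euclidean_space \<Rightarrow> 'v \<times> 'z \<Rightarrow> 'v \<times> 'z"
  assumes h: "h_type br" and d: "DIM('v) = 2 * n" and m: "DIM('z) > 1" and f: "integrable lborel f"
    and Z: "connected Z" "Z \<subseteq> sphere 0 1" "zero_set br f Z" and \<delta>: "0 < \<delta>"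
    and w: "\<And>\<mu>. \<mu> \<noteq> 0 \<Longrightarrow> \<exists>p\<in>Z. \<exists>q\<in>Z. \<mu> \<bullet> (p - q) \<ge> norm \<mu> * \<delta>"
  shows "f \<in> L1_spec (freq_ball (4 / \<delta>))"
    and "(\<forall>\<nu>\<in>sphere 0 1. \<forall>l\<in>Z. I_zero br \<nu> l f) \<Longrightarrow> f \<in> L1_spec (freq_ball (2 / \<delta>))"
proof -
  show "f \<in> L1_spec (freq_ball (4 / \<delta>))"
  proof (rule L1_specI[OF f])
    fix \<mu> :: 'z assume \<mu>: "\<mu> \<noteq> 0" "norm \<mu> > 4 / \<delta>"
    obtain p q where pq: "p \<in> Z" "q \<in> Z" "\<mu> \<bullet> (p - q) \<ge> norm \<mu> * \<delta>" using w[OF \<mu>(1)] by blast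
    have "norm \<mu> * \<delta> > 4" using \<mu> \<delta> by (simp add: field_simps)
    then have b: "2 * of_int 2 \<le> \<mu> \<bullet> (p - q)" using pq by simp
    have "0 < (2 :: int)" by simp
    then obtain j l where l: "l \<in> Z" "l \<noteq> 0" "\<mu> \<bullet> sgn l = 2 * of_int (1 + 2 * j) * (norm l)\<^sup>2"
      by (rule spherical_frequency[OF Z(1,2) _ pq(1,2) b])
    obtain \<nu> where "norm \<nu> = 1" "I_zero br \<nu> l f" using Z(3) l(1) by (auto simp: zero_set_def)
    then show "AE x in lborel. central_ft f \<mu> x = 0"
      by (intro central_ft_zero_odd[OF h f l(2) _ _ l(3)]) auto
  qed
  assume all: "\<forall>\<nu>\<in>sphere 0 1. \<forall>l\<in>Z. I_zero br \<nu> l f"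
  have n: "2 \<le> n" using h_type_dim_ge[OF h m] d by simp
  show "f \<in> L1_spec (freq_ball (2 / \<delta>))"
  proof (rule L1_specI[OF f])
    fix \<mu> :: 'z assume \<mu>: "\<mu> \<noteq> 0" "norm \<mu> > 2 / \<delta>"
    obtain p q where pq: "p \<in> Z" "q \<in> Z" "\<mu> \<bullet> (p - q) \<ge> norm \<mu> * \<delta>" using w[OF \<mu>(1)] by blast
    have "norm \<mu> * \<delta> > 2" using \<mu> \<delta> by (simp add: field_simps)
    then have b: "2 * of_int 1 \<le> \<mu> \<bullet> (p - q)" using pq by simp
    obtain j l where l: "l \<in> Z" "l \<noteq> 0" "\<mu> \<bullet> sgn l = 2 * of_int (1 + 1 * j) * (norm l)\<^sup>2"
      by (rule spherical_frequency[OF Z(1,2) zero_less_one pq(1,2) b])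
    show "AE x in lborel. central_ft f \<mu> x = 0"
      by (rule central_ft_zero_all[OF h d n f l(2) _ l(3) \<mu>(1)]) (use all l(1) in auto)
  qed
qed

lemma shell_zero_set:
  fixes br :: "'v::euclidean_space \<times> 'z::euclidean_space \<Rightarrow> 'v \<times> 'z \<Rightarrow> 'v \<times> 'z"
  assumes h: "h_type br" and d: "DIM('v) = 2 * n" and f: "integrable lborel f" and \<epsilon>: "0 < \<epsilon>"
    and Z: "Z = {l. norm l \<in> {1..1 + \<epsilon>}}" "zero_set br f Z"
  shows "f \<in> L1_spec (freq_ball (2 * of_int (LEAST k::int. odd k \<and> of_int k \<ge> 2 / (2 * \<epsilon> + \<epsilon>\<^sup>2))))"
    and "n > 1 \<Longrightarrow> (\<forall>\<nu>\<in>sphere 0 1. \<forall>l\<in>Z. I_zero br \<nu> l f) \<Longrightarrow>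
      f \<in> L1_spec (freq_ball (2 * of_int (LEAST k::int. of_int k \<ge> 1 / (2 * \<epsilon> + \<epsilon>\<^sup>2))))"
proof -
  show "f \<in> L1_spec (freq_ball (2 * of_int (LEAST k::int. odd k \<and> of_int k \<ge> 2 / (2 * \<epsilon> + \<epsilon>\<^sup>2))))"
  proof (rule L1_specI[OF f])
    define k0 :: int where "k0 = (LEAST k::int. odd k \<and> of_int k \<ge> 2 / (2 * \<epsilon> + \<epsilon>\<^sup>2))"
    have "odd k0 \<and> of_int k0 \<ge> 2 / (2 * \<epsilon> + \<epsilon>\<^sup>2)"
      unfolding k0_def
    proof (rule Least_int_bounded_below)
      \<comment> \<open>Some odd integer not below the bound, to show that there are candidates at
        all.\<close>
      show "odd (2 * \<lceil>2 / (2 * \<epsilon> + \<epsilon>\<^sup>2)\<rceil> + 1) \<and> 2 / (2 * \<epsilon> + \<epsilon>\<^sup>2) \<le> of_int (2 * \<lceil>2 / (2 * \<epsilon> + \<epsilon>\<^sup>2)\<rceil> + 1)"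
      proof -
        define r where "r = 2 / (2 * \<epsilon> + \<epsilon>\<^sup>2)"
        have "0 \<le> r" using \<epsilon> by (simp add: r_def)
        moreover have "r \<le> of_int \<lceil>r\<rceil>" by (rule le_of_int_ceiling)
        ultimately have "r \<le> 2 * of_int \<lceil>r\<rceil> + 1" by linarith
        then show ?thesis by (simp add: r_def)
      qed
      show "\<lceil>2 / (2 * \<epsilon> + \<epsilon>\<^sup>2)\<rceil> \<le> j" if "odd j \<and> 2 / (2 * \<epsilon> + \<epsilon>\<^sup>2) \<le> of_int j" for j
        using that by (simp add: ceiling_le)
    qed
    then have k0: "odd k0" "of_int 2 / (2 * \<epsilon> + \<epsilon>\<^sup>2) \<le> of_int k0" by auto
    fix \<mu> :: 'z assume "norm \<mu> > 2 * of_int k0"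
    then obtain j l where l: "0 \<le> j" "norm l \<in> {1..1 + \<epsilon>}" "\<mu> \<bullet> sgn l = 2 * of_int (k0 + 2 * j) * (norm l)\<^sup>2"
      by (rule shell_frequency[OF \<epsilon> zero_less_numeral k0(2)])
    then have "l \<noteq> 0" "l \<in> Z" using Z by auto
    moreover obtain \<nu> where "norm \<nu> = 1" "I_zero br \<nu> l f" using Z(2) \<open>l \<in> Z\<close> by (auto simp: zero_set_def)
    ultimately show "AE x in lborel. central_ft f \<mu> x = 0"
      using k0(1) by (intro central_ft_zero_odd[OF h f _ _ _ l(3)]) auto
  qed
  assume n: "n > 1" and all: "\<forall>\<nu>\<in>sphere 0 1. \<forall>l\<in>Z. I_zero br \<nu> l f"
  show "f \<in> L1_spec (freq_ball (2 * of_int (LEAST k::int. of_int k \<ge> 1 / (2 * \<epsilon> + \<epsilon>\<^sup>2))))"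
  proof (rule L1_specI[OF f])
    define k0 :: int where "k0 = (LEAST k::int. of_int k \<ge> 1 / (2 * \<epsilon> + \<epsilon>\<^sup>2))"
    have k0: "of_int 1 / (2 * \<epsilon> + \<epsilon>\<^sup>2) \<le> of_int k0"
      unfolding k0_def of_int_1
      by (rule Least_int_bounded_below[of _ "\<lceil>1 / (2 * \<epsilon> + \<epsilon>\<^sup>2)\<rceil>" "\<lceil>1 / (2 * \<epsilon> + \<epsilon>\<^sup>2)\<rceil>"])
        (auto simp: ceiling_le)
    fix \<mu> :: 'z assume \<mu>: "\<mu> \<noteq> 0" "norm \<mu> > 2 * of_int k0"
    obtain j l where l: "0 \<le> j" "norm l \<in> {1..1 + \<epsilon>}" "\<mu> \<bullet> sgn l = 2 * of_int (k0 + 1 * j) * (norm l)\<^sup>2"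
      by (rule shell_frequency[OF \<epsilon> zero_less_one k0 \<mu>(2)])
    then have l0: "l \<noteq> 0" "l \<in> Z" using Z by auto
    show "AE x in lborel. central_ft f \<mu> x = 0"
      by (rule central_ft_zero_all[OF h d _ f l0(1) _ l(3) \<mu>(1)]) (use n all l0 in auto)
  qed
qed

theorem theorem2p11:
  fixes br :: "'v::euclidean_space \<times> 'z::euclidean_space \<Rightarrow> 'v \<times> 'z \<Rightarrow> 'v \<times> 'z"
    and f :: "'v \<times> 'z \<Rightarrow> complex"
    and n m :: nat
  assumes "h_type br"
    and "DIM('v) = 2 * n"
    and "DIM('z) = m"
    and "integrable lborel f"
  shows
    "(m = 1 \<longrightarrow> (\<forall>\<epsilon>>0. \<forall>Z. Z = {l::'z. norm l \<in> {1..1 + \<epsilon>}} \<and> zero_set br f Z \<longrightarrow>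
        f \<in> L1_spec (freq_ball
              (2 * of_int (LEAST k::int. odd k \<and> of_int k \<ge> 2 / (2 * \<epsilon> + \<epsilon>\<^sup>2)))) \<and>
        (n > 1 \<and> (\<forall>\<nu>\<in>sphere 0 1. \<forall>l\<in>Z. I_zero br \<nu> l f) \<longrightarrow>
          f \<in> L1_spec (freq_ball
                (2 * of_int (LEAST k::int. of_int k \<ge> 1 / (2 * \<epsilon> + \<epsilon>\<^sup>2)))))))
     \<and> (m > 1 \<longrightarrow> (\<forall>Z::'z set. Z \<subseteq> sphere 0 1 \<and> compact Z \<and> connected Z \<and>
            \<not> in_affine_hyperplane Z \<and> zero_set br f Z \<longrightarrow>
        f \<in> L1_spec (freq_ball (4 / min_width Z)) \<and>
        ((\<forall>\<nu>\<in>sphere 0 1. \<forall>l\<in>Z. I_zero br \<nu> l f) \<longrightarrow>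
          f \<in> L1_spec (freq_ball (2 / min_width Z)))))
     \<and> (m > 1 \<longrightarrow> (\<forall>(l0::'z)\<in>sphere 0 1. \<forall>h Z. 0 < h \<and> h \<le> 1 \<and> Z = sph_cap h l0 \<and>
            zero_set br f Z \<longrightarrow>
        f \<in> L1_spec (freq_ball (4 / h)) \<and>
        ((\<forall>\<nu>\<in>sphere 0 1. \<forall>l\<in>Z. I_zero br \<nu> l f) \<longrightarrow>
          f \<in> L1_spec (freq_ball (2 / h)))))"
proof (intro conjI impI allI ballI; (elim conjE)?)
  fix \<epsilon> :: real and Z :: "'z set"
  assume "0 < \<epsilon>" "Z = {l. norm l \<in> {1..1 + \<epsilon>}}" "zero_set br f Z"
  note s = shell_zero_set[OF assms(1,2,4) this]
  show "f \<in> L1_spec (freq_ball (2 * of_int (LEAST k::int. odd k \<and> of_int k \<ge> 2 / (2 * \<epsilon> + \<epsilon>\<^sup>2))))"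
    by (rule s(1))
  assume "n > 1" "\<forall>\<nu>\<in>sphere 0 1. \<forall>l\<in>Z. I_zero br \<nu> l f"
  then show "f \<in> L1_spec (freq_ball (2 * of_int (LEAST k::int. of_int k \<ge> 1 / (2 * \<epsilon> + \<epsilon>\<^sup>2))))"
    by (rule s(2))
next
  fix Z :: "'z set"
  assume m: "m > 1" and Z: "Z \<subseteq> sphere 0 1" "compact Z" "connected Z" "\<not> in_affine_hyperplane Z" "zero_set br f Z"
  have m': "DIM('z) > 1" using m assms(3) by simp
  note s = spherical_zero_set[OF assms(1,2) m' assms(4) Z(3,1,5) min_width_pos[OF Z(2,4)] min_width_attained[OF Z(2,4)]]
  show "f \<in> L1_spec (freq_ball (4 / min_width Z))" by (rule s(1))
  assume all: "\<forall>\<nu>\<in>sphere 0 1. \<forall>l\<in>Z. I_zero br \<nu> l f"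
  show "f \<in> L1_spec (freq_ball (2 / min_width Z))" by (rule s(2)) (assumption, rule all)
next
  fix l0 :: 'z and h :: real and Z :: "'z set"
  assume m: "m > 1" and l0: "l0 \<in> sphere 0 1" and hh: "0 < h" "h \<le> 1" and Z: "Z = sph_cap h l0" "zero_set br f Z"
  have m': "DIM('z) > 1" using m assms(3) by simp
  have n0: "norm l0 = 1" using l0 by simp
  have c: "connected Z" "Z \<subseteq> sphere 0 1" unfolding Z(1) using connected_sph_cap[OF n0 hh] by (auto simp: sph_cap_def)
  \<comment> \<open>The cap comes with its own width estimate, \<delta> = h; its minimal width is
    not computed.\<close>
  note s = spherical_zero_set[OF assms(1,2) m' assms(4) c Z(2) hh(1) sph_cap_width[OF n0 hh m', folded Z(1)]]
  show "f \<in> L1_spec (freq_ball (4 / h))" by (rule s(1))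
  assume "\<forall>\<nu>\<in>sphere 0 1. \<forall>l\<in>Z. I_zero br \<nu> l f"
  then show "f \<in> L1_spec (freq_ball (2 / h))" by (rule s(2))
qed

end
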